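(* Let $T>0$, let $\Omega\subset\mathbb{R}^N$ be a (sufficiently smooth) bounded domain with outer normal $\nu$, $\Omega_T=(0,T)\times\Omega$, and let $(k,l)\in\mathcal{PC}$. Let $a_1,\ldots,a_4\in\mathbb{N}$ (stoichiometric coefficients), $d_1,\ldots,d_4>0$ (diffusion coefficients), $\nu_f,\nu_b>0$ (reaction constants), and $$r(c_1,c_2,c_3,c_4)=-\nu_f\,c_1^{a_1}c_2^{a_2}+\nu_b\,c_3^{a_3}c_4^{a_4}.$$ Let $m\ge1$ and $c_i^0\in L_\infty(\Omega)$ with $c_i^0\ge0$, $i=1,\ldots,4$. Suppose that $(c_1,c_2,c_3,c_4)$ is a sufficiently smooth solution on $(0,T]\times\Omega$ of the system $$\partial_t\big(k\ast[c_i-c_i^0]\big)-d_i\Delta c_i^m=a_i\,r(c_1,c_2,c_3,c_4),\quad i=1,2,$$ $$\partial_t\big(k\ast[c_i-c_i^0]\big)-d_i\Delta c_i^m=-a_i\,r(c_1,c_2,c_3,c_4),\quad i=3,4,$$ together with the homogeneous Neumann boundary conditions $\partial_\nu c_i=0$ on $\partial\Omega$ for $t>0$, $i=1,\ldots,4$, satisfying the initial conditions $c_i|_{t=0}=c_i^0$ in $\Omega$ for $i=1,\ldots,4$. Assume further that $c_i\ge0$ in $\Omega_T$ for all $i=1,\ldots,4$. Then $$\sum_{i=1}^4\|c_i\|_{L_{m+1}(\Omega_T)}\le C\sum_{i=1}^4\|c_i^0\|_{L_{m+1}(\Omega)},$$ where the constant $C$ depends only on $m$, $T$, $\|l\|_{L_1((0,T))}$,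 the coefficients $a_i$, and the diffusion coefficients $d_i$, $i=1,\ldots,4$.
   Context: Condition $\mathcal{PC}$: $(k,l)\in\mathcal{PC}$ means that $k\in L_{1,loc}([0,\infty))$ is nonnegative and nonincreasing and $l\in L_{1,loc}([0,\infty))$ satisfies $k\ast l=1$ on $(0,\infty)$ (such $l$ is automatically nonnegative). Here $(k\ast v)(t)=\int_0^t k(t-\tau)v(\tau)\,d\tau$, and $c_i^0=c_i^0(x)$ is regarded as constant in time in $k\ast[c_i-c_i^0]$. $\mathbb{N}=\{1,2,\ldots\}$. "Sufficiently smooth" is not quantified in the paper. It is to be read as: regular enough that the equations, boundary and initial conditions hold in the classical sense and the equations also hold in the (time-regularized) weak sense, i.e. $k\ast c_i\in C([0,T];L_2(\Omega))$ with $(k\ast c_i)|_{t=0}=0$, $c_i^m\in L_2((0,T);H^1_2(\Omega))$ with $H^1_2(\Omega)=W^{1,2}(\Omega)$, $R_i:=\pm a_i r(c_1,\ldots,c_4)\in L_2(\Omega_T)$ (sign $+$ for $i=1,2$, $-$ for $i=3,4$), and for all $\psi\in H^1_2(\Omega)$, $n\in\mathbb{N}$ and a.a. $t\in(0,T)$, $$\int_\Omega\Big(\psi\,\partial_t\big(k_n\ast[c_i-c_i^0]\big)+d_i(h_n\ast\nabla c_i^m)\cdot\nabla\psi\Big)dx=\int_\Omega(h_n\ast R_i)\psi\,dx,$$ where $h_n\in L_{1,loc}([0,\infty))$ is the solution of $h_n+n(h_n\ast l)=n\,l$ on $(0,\infty)$ and $k_n=k\ast h_n$. *)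

theory Defs
  imports "HOL-Analysis.Analysis"
begin

text \<open>
  The constant in the theorem must not depend on the space dimension \<open>N\<close>, so \<open>N\<close> has to be
  quantified inside the statement and cannot be a type. A point of \<open>\<real>\<^sup>N\<close> is therefore an
  element of \<open>{..<N} \<rightarrow>\<^sub>E UNIV\<close>, i.e. a function \<open>nat \<Rightarrow> real\<close> that is \<open>undefined\<close> outside
  \<open>{..<N}\<close>; this is both the carrier of the topology \<open>powertop_real {..<N}\<close> and the space of
  the product measure \<open>Pi\<^sub>M {..<N} (\<lambda>_. lborel)\<close>. Topological notions are taken relative to
  \<open>powertop_real {..<N}\<close> rather than to the type \<open>nat \<Rightarrow> real\<close>, in which these sets have
  empty interior. Time derivatives are taken with respect to an ordinary real variable.
\<close>

section \<open>Differential calculus on \<open>\<real>\<^sup>N\<close>\<close>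

definition pd :: "nat \<Rightarrow> ((nat \<Rightarrow> real) \<Rightarrow> real) \<Rightarrow> (nat \<Rightarrow> real) \<Rightarrow> real" where
  "pd j f x = deriv (\<lambda>s. f (x(j := s))) (x j)"

primrec iter_pd :: "nat list \<Rightarrow> ((nat \<Rightarrow> real) \<Rightarrow> real) \<Rightarrow> (nat \<Rightarrow> real) \<Rightarrow> real" where
  "iter_pd [] f = f"
| "iter_pd (j # js) f = pd j (iter_pd js f)"

text \<open>\<open>Ck N p U f\<close>: \<open>f\<close> is of class \<open>C\<^sup>p\<close> on \<open>U\<close>, meant for \<open>U\<close> open in \<open>\<real>\<^sup>N\<close>.\<close>

definition Ck :: "nat \<Rightarrow> nat \<Rightarrow> (nat \<Rightarrow> real) set \<Rightarrow> ((nat \<Rightarrow> real) \<Rightarrow> real) \<Rightarrow> bool" where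
  "Ck N p U f \<longleftrightarrow>
     (\<forall>js. set js \<subseteq> {..<N} \<and> length js < p \<longrightarrow>
        (\<forall>x\<in>U. \<forall>j<N. (\<lambda>s. iter_pd js f (x(j := s))) differentiable (at (x j)))) \<and>
     (\<forall>js. set js \<subseteq> {..<N} \<and> length js \<le> p \<longrightarrow>
        continuous_map (subtopology (powertop_real {..<N}) U) euclideanreal (iter_pd js f))"

definition laplacian :: "nat \<Rightarrow> ((nat \<Rightarrow> real) \<Rightarrow> real) \<Rightarrow> (nat \<Rightarrow> real) \<Rightarrow> real" where
  "laplacian N f x = (\<Sum>j<N. pd j (pd j f) x)"

text \<open>
  \<open>\<nu>\<close> is the outer unit normal at the boundary point \<open>p\<close>: near \<open>p\<close> the set is the sublevel
  set of a \<open>C\<^sup>1\<close> function \<open>\<rho>\<close> without critical points, and \<open>\<nu> = \<nabla>\<rho>(p)/|\<nabla>\<rho>(p)|\<close>.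
\<close>

definition outer_normal ::
  "nat \<Rightarrow> (nat \<Rightarrow> real) set \<Rightarrow> (nat \<Rightarrow> real) \<Rightarrow> (nat \<Rightarrow> real) \<Rightarrow> bool" where
  "outer_normal N \<Omega> p \<nu> \<longleftrightarrow>
     (\<exists>U \<rho>. openin (powertop_real {..<N}) U \<and> p \<in> U \<and> Ck N 1 U \<rho> \<and>
        (\<forall>x\<in>U. \<exists>j<N. pd j \<rho> x \<noteq> 0) \<and>
        \<Omega> \<inter> U = {x \<in> U. \<rho> x < 0} \<and>
        (powertop_real {..<N} frontier_of \<Omega>) \<inter> U = {x \<in> U. \<rho> x = 0} \<and>
        (\<forall>j<N. \<nu> j = pd j \<rho> p / sqrt (\<Sum>i<N. (pd i \<rho> p)\<^sup>2)))"

text \<open>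
  Bounded domain with \<open>C\<^sup>1\<close> boundary, the least smoothness for which the outer normal is
  defined at every boundary point. (The type-class predicate \<open>bounded\<close> on \<open>nat \<Rightarrow> real\<close>
  refers to a bounded metric and would be useless here.)
\<close>

definition smooth_bounded_domain :: "nat \<Rightarrow> (nat \<Rightarrow> real) set \<Rightarrow> bool" where
  "smooth_bounded_domain N \<Omega> \<longleftrightarrow>
     openin (powertop_real {..<N}) \<Omega> \<and> connectedin (powertop_real {..<N}) \<Omega> \<and> \<Omega> \<noteq> {} \<and>
     (\<exists>B. \<forall>x\<in>\<Omega>. \<forall>j<N. \<bar>x j\<bar> \<le> B) \<and>
     (\<forall>p \<in> powertop_real {..<N} frontier_of \<Omega>. \<exists>\<nu>. outer_normal N \<Omega> p \<nu>)"

text \<open>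
  \<open>\<partial>\<^sub>\<nu>u = D\<close> at the boundary point \<open>p\<close>, for \<open>u\<close> given on \<open>\<Omega>\<close>: \<open>u\<close> is \<open>C\<^sup>1\<close> in \<open>\<Omega>\<close> near \<open>p\<close>, its
  gradient has a limit \<open>q\<close> at \<open>p\<close>, and \<open>q \<cdot> \<nu> = D\<close>.
\<close>

definition has_normal_derivative ::
  "nat \<Rightarrow> (nat \<Rightarrow> real) set \<Rightarrow> ((nat \<Rightarrow> real) \<Rightarrow> real) \<Rightarrow> (nat \<Rightarrow> real) \<Rightarrow> real \<Rightarrow> bool" where
  "has_normal_derivative N \<Omega> u p D \<longleftrightarrow>
     (\<exists>\<nu> q U. outer_normal N \<Omega> p \<nu> \<and>
        openin (powertop_real {..<N}) U \<and> p \<in> U \<and> Ck N 1 (\<Omega> \<inter> U) u \<and>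
        (\<forall>j<N. (pd j u \<longlongrightarrow> q j) (atin_within (powertop_real {..<N}) p \<Omega>)) \<and>
        (\<Sum>j<N. q j * \<nu> j) = D)"

section \<open>Function spaces\<close>

definition dom_measure :: "nat \<Rightarrow> (nat \<Rightarrow> real) set \<Rightarrow> (nat \<Rightarrow> real) measure" where
  "dom_measure N \<Omega> = restrict_space (Pi\<^sub>M {..<N} (\<lambda>_. lborel)) \<Omega>"

text \<open>The measure on \<open>\<Omega>\<^sub>T = (0,T) \<times> \<Omega>\<close>.\<close>

definition cyl_measure ::
  "real \<Rightarrow> nat \<Rightarrow> (nat \<Rightarrow> real) set \<Rightarrow> (real \<times> (nat \<Rightarrow> real)) measure" where
  "cyl_measure T N \<Omega> = restrict_space lborel {0<..<T} \<Otimes>\<^sub>M dom_measure N \<Omega>"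

definition in_Lp :: "'a measure \<Rightarrow> real \<Rightarrow> ('a \<Rightarrow> real) \<Rightarrow> bool" where
  "in_Lp M p f \<longleftrightarrow> f \<in> borel_measurable M \<and> integrable M (\<lambda>x. \<bar>f x\<bar> powr p)"

text \<open>Only meaningful together with \<open>in_Lp M p f\<close>.\<close>

definition Lp_norm :: "'a measure \<Rightarrow> real \<Rightarrow> ('a \<Rightarrow> real) \<Rightarrow> real" where
  "Lp_norm M p f = (LINT x|M. \<bar>f x\<bar> powr p) powr (1 / p)"

definition in_Linf :: "'a measure \<Rightarrow> ('a \<Rightarrow> real) \<Rightarrow> bool" where
  "in_Linf M f \<longleftrightarrow> f \<in> borel_measurable M \<and> (\<exists>B. AE x in M. \<bar>f x\<bar> \<le> B)"

text \<open>\<open>C\<^sub>c\<^sup>\<infinity>(\<Omega>)\<close>, as functions on all of \<open>\<real>\<^sup>N\<close>.\<close>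

definition test_function :: "nat \<Rightarrow> (nat \<Rightarrow> real) set \<Rightarrow> ((nat \<Rightarrow> real) \<Rightarrow> real) \<Rightarrow> bool" where
  "test_function N \<Omega> \<phi> \<longleftrightarrow>
     (\<forall>p. Ck N p (topspace (powertop_real {..<N})) \<phi>) \<and>
     (\<exists>K. compactin (powertop_real {..<N}) K \<and> K \<subseteq> \<Omega> \<and>
        (\<forall>x \<in> topspace (powertop_real {..<N}) - K. \<phi> x = 0))"

text \<open>\<open>u \<in> W\<^sup>1\<^sup>,\<^sup>2(\<Omega>)\<close> with weak gradient \<open>(g 0, \<dots>, g (N - 1))\<close>.\<close>

definition W12_with_grad ::
  "nat \<Rightarrow> (nat \<Rightarrow> real) set \<Rightarrow> ((nat \<Rightarrow> real) \<Rightarrow> real) \<Rightarrow> (nat \<Rightarrow> (nat \<Rightarrow> real) \<Rightarrow> real) \<Rightarrow> bool" where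
  "W12_with_grad N \<Omega> u g \<longleftrightarrow>
     in_Lp (dom_measure N \<Omega>) 2 u \<and>
     (\<forall>j<N. in_Lp (dom_measure N \<Omega>) 2 (g j) \<and>
        (\<forall>\<phi>. test_function N \<Omega> \<phi> \<longrightarrow>
           (LINT x|dom_measure N \<Omega>. u x * pd j \<phi> x) = - (LINT x|dom_measure N \<Omega>. g j x * \<phi> x)))"

text \<open>\<open>w \<in> L\<^sub>2((0,T); W\<^sup>1\<^sup>,\<^sup>2(\<Omega>))\<close> with spatial weak gradient \<open>G j t\<close>.\<close>

definition L2_W12_with_grad ::
  "real \<Rightarrow> nat \<Rightarrow> (nat \<Rightarrow> real) set \<Rightarrow> (real \<Rightarrow> (nat \<Rightarrow> real) \<Rightarrow> real) \<Rightarrow>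
   (nat \<Rightarrow> real \<Rightarrow> (nat \<Rightarrow> real) \<Rightarrow> real) \<Rightarrow> bool" where
  "L2_W12_with_grad T N \<Omega> w G \<longleftrightarrow>
     in_Lp (cyl_measure T N \<Omega>) 2 (\<lambda>(t, x). w t x) \<and>
     (\<forall>j<N. in_Lp (cyl_measure T N \<Omega>) 2 (\<lambda>(t, x). G j t x)) \<and>
     (AE t in lborel. t \<in> {0<..<T} \<longrightarrow> W12_with_grad N \<Omega> (w t) (\<lambda>j. G j t))"

text \<open>\<open>v \<in> C([0,T]; L\<^sub>2(\<Omega>))\<close>.\<close>

definition cont_into_L2 ::
  "real \<Rightarrow> nat \<Rightarrow> (nat \<Rightarrow> real) set \<Rightarrow> (real \<Rightarrow> (nat \<Rightarrow> real) \<Rightarrow> real) \<Rightarrow> bool" where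
  "cont_into_L2 T N \<Omega> v \<longleftrightarrow>
     (\<forall>t\<in>{0..T}. in_Lp (dom_measure N \<Omega>) 2 (v t)) \<and>
     (\<forall>t\<in>{0..T}. ((\<lambda>s. Lp_norm (dom_measure N \<Omega>) 2 (\<lambda>x. v s x - v t x)) \<longlongrightarrow> 0)
        (at t within {0..T}))"

section \<open>Kernels\<close>

definition conv :: "(real \<Rightarrow> real) \<Rightarrow> (real \<Rightarrow> real) \<Rightarrow> real \<Rightarrow> real" where
  "conv k v t = (LBINT \<tau>:{0<..<t}. k (t - \<tau>) * v \<tau>)"

definition L1loc :: "(real \<Rightarrow> real) \<Rightarrow> bool" where
  "L1loc f \<longleftrightarrow> (\<forall>b>0. set_integrable lborel {0<..<b} f)"

text \<open>
  The convolution of two locally integrable functions is defined almost everywhere, and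
  identities between such convolutions are identities in \<open>L\<^sub>1\<^sub>,\<^sub>l\<^sub>o\<^sub>c\<close>.
\<close>

definition PC :: "(real \<Rightarrow> real) \<Rightarrow> (real \<Rightarrow> real) \<Rightarrow> bool" where
  "PC k l \<longleftrightarrow> L1loc k \<and> L1loc l \<and>
     (\<forall>t>0. 0 \<le> k t) \<and> (\<forall>s t. 0 < s \<and> s \<le> t \<longrightarrow> k t \<le> k s) \<and>
     (AE t in lborel. 0 < t \<longrightarrow> conv k l t = 1)"

definition is_h :: "(real \<Rightarrow> real) \<Rightarrow> nat \<Rightarrow> (real \<Rightarrow> real) \<Rightarrow> bool" where
  "is_h l n h \<longleftrightarrow> L1loc h \<and>
     (AE t in lborel. 0 < t \<longrightarrow> h t + real n * conv h l t = real n * l t)"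

section \<open>The reaction-diffusion system\<close>

definition rate :: "real \<Rightarrow> real \<Rightarrow> (nat \<Rightarrow> nat) \<Rightarrow> (nat \<Rightarrow> real) \<Rightarrow> real" where
  "rate \<nu>f \<nu>b a u = - \<nu>f * u 1 ^ a 1 * u 2 ^ a 2 + \<nu>b * u 3 ^ a 3 * u 4 ^ a 4"

definition reaction ::
  "real \<Rightarrow> real \<Rightarrow> (nat \<Rightarrow> nat) \<Rightarrow> nat \<Rightarrow> (nat \<Rightarrow> real) \<Rightarrow> real" where
  "reaction \<nu>f \<nu>b a i u = (if i \<in> {1, 2} then 1 else - 1) * real (a i) * rate \<nu>f \<nu>b a u"

text \<open>
  The limit in the initial condition and the continuity of \<open>c i\<close> make all convolutions
  \<open>k * [c i - c0 i]\<close> below converge absolutely. At \<open>t = T\<close> the time derivative is one-sided.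
\<close>

definition classical_solution ::
  "real \<Rightarrow> nat \<Rightarrow> (nat \<Rightarrow> real) set \<Rightarrow> (real \<Rightarrow> real) \<Rightarrow> real \<Rightarrow> (nat \<Rightarrow> nat) \<Rightarrow> (nat \<Rightarrow> real) \<Rightarrow>
   real \<Rightarrow> real \<Rightarrow> (nat \<Rightarrow> (nat \<Rightarrow> real) \<Rightarrow> real) \<Rightarrow> (nat \<Rightarrow> real \<Rightarrow> (nat \<Rightarrow> real) \<Rightarrow> real) \<Rightarrow> bool" where
  "classical_solution T N \<Omega> k m a d \<nu>f \<nu>b c0 c \<longleftrightarrow> (\<forall>i\<in>{1..4}.
     continuous_map
       (prod_topology (top_of_set {0<..T}) (subtopology (powertop_real {..<N}) \<Omega>))
       euclideanreal (\<lambda>(t, x). c i t x) \<and>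
     (\<forall>t\<in>{0<..T}. Ck N 2 \<Omega> (\<lambda>x. c i t x powr m)) \<and>
     (\<forall>t\<in>{0<..T}. \<forall>x\<in>\<Omega>.
        ((\<lambda>s. conv k (\<lambda>\<tau>. c i \<tau> x - c0 i x) s) has_real_derivative
           d i * laplacian N (\<lambda>y. c i t y powr m) x + reaction \<nu>f \<nu>b a i (\<lambda>j. c j t x))
        (at t within {0<..T})) \<and>
     (\<forall>t\<in>{0<..T}. \<forall>p \<in> powertop_real {..<N} frontier_of \<Omega>.
        has_normal_derivative N \<Omega> (c i t) p 0) \<and>
     (\<forall>x\<in>\<Omega>. ((\<lambda>t. c i t x) \<longlongrightarrow> c0 i x) (at_right 0)))"

text \<open>
  The time-regularized weak formulation; \<open>h n\<close> is the kernel \<open>h\<^sub>n\<close> and \<open>conv k (h n)\<close> is \<open>k\<^sub>n\<close>.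
  The function \<open>v\<close> is the continuous representative of \<open>k * c i\<close>, \<open>G\<close> is the gradient of
  \<open>(c i)\<^sup>m\<close>, and \<open>D\<close> is the time derivative of \<open>k\<^sub>n * [c i - c0 i]\<close> at time \<open>t\<close>, which exists for
  almost every \<open>x\<close>.
\<close>

definition weak_solution ::
  "real \<Rightarrow> nat \<Rightarrow> (nat \<Rightarrow> real) set \<Rightarrow> (real \<Rightarrow> real) \<Rightarrow> (nat \<Rightarrow> real \<Rightarrow> real) \<Rightarrow> real \<Rightarrow>
   (nat \<Rightarrow> nat) \<Rightarrow> (nat \<Rightarrow> real) \<Rightarrow> real \<Rightarrow> real \<Rightarrow>
   (nat \<Rightarrow> (nat \<Rightarrow> real) \<Rightarrow> real) \<Rightarrow> (nat \<Rightarrow> real \<Rightarrow> (nat \<Rightarrow> real) \<Rightarrow> real) \<Rightarrow> bool" where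
  "weak_solution T N \<Omega> k h m a d \<nu>f \<nu>b c0 c \<longleftrightarrow> (\<forall>i\<in>{1..4}.
     (\<exists>v. cont_into_L2 T N \<Omega> v \<and> (AE x in dom_measure N \<Omega>. v 0 x = 0) \<and>
        (AE t in lborel. t \<in> {0<..<T} \<longrightarrow>
           (AE x in dom_measure N \<Omega>. v t x = conv k (\<lambda>\<tau>. c i \<tau> x) t))) \<and>
     in_Lp (cyl_measure T N \<Omega>) 2 (\<lambda>(t, x). reaction \<nu>f \<nu>b a i (\<lambda>j. c j t x)) \<and>
     (\<exists>G. L2_W12_with_grad T N \<Omega> (\<lambda>t x. c i t x powr m) G \<and>
        (\<forall>n\<ge>1. \<forall>\<psi> g. W12_with_grad N \<Omega> \<psi> g \<longrightarrow>
           (AE t in lborel. t \<in> {0<..<T} \<longrightarrow>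
              (\<exists>D. (AE x in dom_measure N \<Omega>.
                      ((\<lambda>s. conv (conv k (h n)) (\<lambda>\<tau>. c i \<tau> x - c0 i x) s)
                         has_real_derivative D x) (at t)) \<and>
                   integrable (dom_measure N \<Omega>) (\<lambda>x. \<psi> x * D x +
                      d i * (\<Sum>j<N. conv (h n) (\<lambda>\<tau>. G j \<tau> x) t * g j x)) \<and>
                   integrable (dom_measure N \<Omega>) (\<lambda>x.
                      conv (h n) (\<lambda>\<tau>. reaction \<nu>f \<nu>b a i (\<lambda>j. c j \<tau> x)) t * \<psi> x) \<and>
                   (LINT x|dom_measure N \<Omega>. \<psi> x * D x +
                      d i * (\<Sum>j<N. conv (h n) (\<lambda>\<tau>. G j \<tau> x) t * g j x)) =
                   (LINT x|dom_measure N \<Omega>.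
                      conv (h n) (\<lambda>\<tau>. reaction \<nu>f \<nu>b a i (\<lambda>j. c j \<tau> x)) t * \<psi> x))))))"

end

theory Submission
  imports Defs
begin

text \<open>
  The estimate is a duality estimate in which the solution is tested with itself. Divide the
  \<open>i\<close>-th equation by \<open>a i\<close> and add the four of them: the reaction terms cancel, and
  \<open>w = \<Sum> c i / a i\<close>, \<open>z = \<Sum> (d i / a i) (c i)\<^sup>m\<close> satisfy \<open>\<partial>\<^sub>t (k * [w - w0]) = \<Delta> z\<close>.
  Since \<open>k * l = 1\<close>, convolution with \<open>l\<close> turns this into \<open>w - w0 = \<Delta> (l * z)\<close>. Multiplying by
  \<open>z\<close> and integrating over \<open>\<Omega>\<^sub>T\<close> gives, by the Neumann condition,
  \<open>\<integral>\<integral> z (w - w0) = - \<integral>\<integral> \<nabla>z \<cdot> (l * \<nabla>z)\<close>. The right-hand side is not positive, because \<open>l\<close> is a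
  kernel of positive type: if \<open>u = l * v\<close> then \<open>v = \<partial>\<^sub>t (k * u)\<close>, and \<open>\<integral> u \<partial>\<^sub>t (k * u) \<ge> 0\<close> as \<open>k\<close> is
  nonnegative and nonincreasing. Hence \<open>\<integral>\<integral> z w \<le> \<integral>\<integral> z w0\<close>. All functions being nonnegative,
  \<open>z w\<close> dominates a multiple of \<open>\<Sum> (c i)\<^bsup>m+1\<^esup>\<close>, while by Young's inequality \<open>z w0\<close> is at most half
  of this multiple plus a constant times \<open>\<Sum> (c0 i)\<^bsup>m+1\<^esup>\<close>; absorbing the first part gives the claim.

  Four points need care.

  The weak formulation contains \<open>h = h\<^sub>1\<close> with \<open>h + h * l = l\<close>. Then \<open>k * h = 1 - 1 * h\<close>, so the
  time derivative of \<open>k * h * u\<close> is \<open>u - h * u\<close> almost everywhere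
  (\<open>derivative_of_convolution\<close>, which rests on the \<open>L\<^sub>1\<close> version of Lebesgue's differentiation theorem,
  \<open>fdiff_conv_integrable\<close>). For a fixed test function the equation becomes
  \<open>A - h * A + h * B = 0\<close> for two scalar functions of time, and this implies
  \<open>A + l * B = 0\<close> (\<open>resolvent_inversion\<close>, \<open>tested_equation\<close>).

  The times at which the equation holds depend on the test function, so \<open>z(t)\<close> cannot be used as a
  test function at time \<open>t\<close>. Testing with \<open>z(s)\<close> for almost all \<open>s\<close> gives instead
  \<open>\<langle>z(s), (w - w0)(t)\<rangle> + \<langle>\<nabla>z(s), (l * \<nabla>z)(t)\<rangle> = 0\<close> for almost all pairs \<open>(s, t)\<close>. The diagonal is
  reached by averaging both variables over the same interval \<open>(r - 1/n, r)\<close> and integrating over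
  \<open>r\<close> (\<open>smoothed_energy_nonpos\<close>). The averaging commutes with \<open>l *\<close>, so positivity survives.

  The averaged functions are absolutely continuous in time, and this is all that the proof of
  positivity uses about them (\<open>integral_positive_avg\<close>).

  As \<open>n \<rightarrow> \<infinity>\<close>, only an inequality is required: \<open>z\<close> and \<open>w\<close> are nonnegative and continuous in
  time, so Fatou's lemma applies to the averages of \<open>z\<close> and \<open>w\<close>, and the term with \<open>w0\<close> is bounded
  uniformly in \<open>n\<close> (\<open>energy_inequality\<close>).
\<close>

section \<open>Convolution on the real line\<close>

text \<open>
The data of the problem are extended by zero in time. The convolution over \<open>(0, t)\<close> is then a special
case of the one over the whole line (\<open>conv_eq_star\<close>), and the translation invariance of Lebesgue measure can be
used without keeping track of the limits of integration.
\<close>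

definition star :: "(real \<Rightarrow> real) \<Rightarrow> (real \<Rightarrow> real) \<Rightarrow> real \<Rightarrow> real" (infixl "\<star>" 70) where
  "(f \<star> g) t = (LINT \<tau>|lborel. f (t - \<tau>) * g \<tau>)"

lemma integrable_reflect: 
  fixes f :: "real \<Rightarrow> real"
  shows "integrable lborel f \<Longrightarrow> integrable lborel (\<lambda>\<tau>. f (t - \<tau>))"
  using lborel_integrable_real_affine[of f "-1" t] by simp

lemma integral_reflect: 
  fixes f :: "real \<Rightarrow> real"
  shows "(LINT \<tau>|lborel. f (t - \<tau>)) = (LINT \<tau>|lborel. f \<tau>)"
  using lborel_integral_real_affine[of "-1" f t] by simp

lemma nn_integral_shift: 
  fixes f :: "real \<Rightarrow> ennreal"
  assumes [measurable]: "f \<in> borel_measurable borel"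
  shows "(\<integral>\<^sup>+t. f (t - \<tau>) \<partial>lborel) = (\<integral>\<^sup>+t. f t \<partial>lborel)"
  using nn_integral_real_affine[of f "1" "-\<tau>"] by simp

lemma AE_reflect:
  assumes "AE \<tau> in lborel. P \<tau>" shows "AE \<tau> in lborel. P (t - \<tau> :: real)"
proof -
  from assms obtain N where N: "N \<in> null_sets lborel" "{x. \<not> P x} \<subseteq> N"
    unfolding eventually_ae_filter by auto
  then have [measurable]: "N \<in> sets borel" by auto
  have "AE \<tau> in lborel. \<tau> \<notin> N" using N(1) AE_not_in by blast
  then have "AE \<tau> in lborel. t + (-1) * \<tau> \<notin> N"
    by (intro AE_borel_affine) auto
  then show ?thesis by eventually_elim (use N(2) in auto)
qed

lemma star_commute: "f \<star> g = g \<star> f"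
proof
  fix t show "(f \<star> g) t = (g \<star> f) t"
    using integral_reflect[of "\<lambda>\<tau>. g (t - \<tau>) * f \<tau>" t]
    unfolding star_def by (simp add: mult.commute)
qed

lemma measurable_star_pair:
  assumes [measurable]: "h \<in> borel_measurable borel" 
    "(\<lambda>(t, x). f t x) \<in> borel_measurable (lborel \<Otimes>\<^sub>M M)"
  shows "(\<lambda>(t, x). (h \<star> (\<lambda>\<tau>. f \<tau> x)) t) \<in> borel_measurable (lborel \<Otimes>\<^sub>M M)"
  unfolding star_def by measurable

text \<open>
Causality: up to time \<open>T\<close> a convolution with a function supported on the positive half-line only
sees the values of the other factor before \<open>T\<close>.
\<close>

lemma star_cong_AE:
  assumes "AE \<tau> in lborel. \<tau> < T \<longrightarrow> f \<tau> = f' \<tau>" and "\<And>\<tau>. \<tau> \<le> 0 \<Longrightarrow> g \<tau> = 0" and "t \<le> T"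
    and [measurable]: "f \<in> borel_measurable borel" "f' \<in> borel_measurable borel" "g \<in> borel_measurable borel"
  shows "(f \<star> g) t = (f' \<star> g) t"
  unfolding star_def
proof (rule integral_cong_AE)
  show "AE \<tau> in lborel. f (t - \<tau>) * g \<tau> = f' (t - \<tau>) * g \<tau>"
    using AE_reflect[OF assms(1), of t]
  proof eventually_elim
    case (elim \<tau>)
    then show ?case using assms(2)[of \<tau>] \<open>t \<le> T\<close> by (cases "\<tau> \<le> 0") auto
  qed
qed measurable

lemma star_causal:
  assumes "\<And>\<tau>. \<tau> \<le> 0 \<Longrightarrow> f \<tau> = 0" "\<And>\<tau>. \<tau> \<le> 0 \<Longrightarrow> g \<tau> = 0" "t \<le> 0"
  shows "(f \<star> g) t = 0"
proof -
  have "f (t - \<tau>) * g \<tau> = 0" for \<tau>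
    using assms(1)[of "t - \<tau>"] assms(2)[of \<tau>] assms(3) by (cases "\<tau> \<le> 0") auto
  then show ?thesis unfolding star_def by (simp only: integral_zero)
qed

lemma integrable_shifted_prod:
  fixes h :: "real \<Rightarrow> real" and F :: "real \<Rightarrow> 'b \<Rightarrow> real"
  assumes M: "sigma_finite_measure M" and h: "integrable lborel h"
    and F: "integrable (lborel \<Otimes>\<^sub>M M) (\<lambda>(\<tau>, y). F \<tau> y)"
  shows "integrable (lborel \<Otimes>\<^sub>M (lborel \<Otimes>\<^sub>M M)) (\<lambda>(t, (\<tau>, y)). h (t - \<tau>) * F \<tau> y)"
proof (rule integrableI_bounded)
  interpret M: sigma_finite_measure M by fact
  interpret P: pair_sigma_finite "lborel :: real measure" M ..
  interpret P2: sigma_finite_measure "lborel \<Otimes>\<^sub>M M :: (real \<times> 'b) measure" by (rule P.sigma_finite_measure_axioms)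
  interpret Q: pair_sigma_finite "lborel :: real measure" "lborel \<Otimes>\<^sub>M M :: (real \<times> 'b) measure" ..
  have [measurable]: "h \<in> borel_measurable borel" using h by auto
  have [measurable]: "(\<lambda>(\<tau>, y). F \<tau> y) \<in> borel_measurable (lborel \<Otimes>\<^sub>M M)" using F by auto
  show "(\<lambda>(t, (\<tau>, y)). h (t - \<tau>) * F \<tau> y) \<in> borel_measurable (lborel \<Otimes>\<^sub>M (lborel \<Otimes>\<^sub>M M))"
    by measurable
  have "(\<integral>\<^sup>+ p. ennreal (norm (case p of (t, (\<tau>, y)) \<Rightarrow> h (t - \<tau>) * F \<tau> y)) \<partial>(lborel \<Otimes>\<^sub>M (lborel \<Otimes>\<^sub>M M)))
    = (\<integral>\<^sup>+ q. (\<integral>\<^sup>+ t. ennreal \<bar>h (t - fst q)\<bar> * ennreal \<bar>F (fst q) (snd q)\<bar> \<partial>lborel) \<partial>(lborel \<Otimes>\<^sub>M M))"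
    by (subst Q.nn_integral_snd[symmetric])
       (auto simp: case_prod_unfold abs_mult ennreal_mult)
  also have "\<dots> = (\<integral>\<^sup>+ q. (\<integral>\<^sup>+ t. ennreal \<bar>h t\<bar> \<partial>lborel) * ennreal \<bar>F (fst q) (snd q)\<bar> \<partial>(lborel \<Otimes>\<^sub>M M))"
    by (intro nn_integral_cong, subst nn_integral_multc)
       (auto intro!: arg_cong2[where f="(*)"] nn_integral_shift[where f="\<lambda>s. ennreal \<bar>h s\<bar>"])
  also have "\<dots> = (\<integral>\<^sup>+ t. ennreal \<bar>h t\<bar> \<partial>lborel) * (\<integral>\<^sup>+ q. ennreal \<bar>F (fst q) (snd q)\<bar> \<partial>(lborel \<Otimes>\<^sub>M M))"
    by (rule nn_integral_cmult) measurable
  also have "\<dots> < \<infinity>"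
    using h F unfolding integrable_iff_bounded by (auto simp: case_prod_unfold ennreal_mult_less_top)
  finally show "(\<integral>\<^sup>+ p. ennreal (norm (case p of (t, (\<tau>, y)) \<Rightarrow> h (t - \<tau>) * F \<tau> y)) \<partial>(lborel \<Otimes>\<^sub>M (lborel \<Otimes>\<^sub>M M))) < \<infinity>" .
qed

text \<open>
The only use of Fubini's theorem for a convolution and an integral over a second variable. The
associative law and the interchange of convolutions with integrals over \<open>\<Omega>\<close> are both instances.
\<close>

lemma star_integral_swap:
  fixes h :: "real \<Rightarrow> real" and F :: "real \<Rightarrow> 'b \<Rightarrow> real"
  assumes M: "sigma_finite_measure M" and h: "integrable lborel h"
    and F: "integrable (lborel \<Otimes>\<^sub>M M) (\<lambda>(\<tau>, y). F \<tau> y)"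
  shows "AE t in lborel. integrable M (\<lambda>y. (h \<star> (\<lambda>\<tau>. F \<tau> y)) t) \<and>
     (h \<star> (\<lambda>\<tau>. LINT y|M. F \<tau> y)) t = (LINT y|M. (h \<star> (\<lambda>\<tau>. F \<tau> y)) t)"
proof -
  interpret M: sigma_finite_measure M by fact
  interpret P: pair_sigma_finite "lborel :: real measure" M ..
  interpret P2: sigma_finite_measure "lborel \<Otimes>\<^sub>M M :: (real \<times> 'b) measure" by (rule P.sigma_finite_measure_axioms)
  interpret Q: pair_sigma_finite "lborel :: real measure" "lborel \<Otimes>\<^sub>M M :: (real \<times> 'b) measure" ..
  have "AE t in lborel. integrable (lborel \<Otimes>\<^sub>M M) (\<lambda>(\<tau>, y). h (t - \<tau>) * F \<tau> y)"
    using Q.AE_integrable_fst'[OF integrable_shifted_prod[OF M h F]] by simp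
  then show ?thesis
  proof eventually_elim
    case (elim t)
    show ?case
      unfolding star_def using P.Fubini_integral[OF elim] P.integrable_snd[OF elim] by simp
  qed
qed

lemma integrable_conv_kernel:
  fixes f g :: "real \<Rightarrow> real"
  assumes f: "integrable lborel f" and g: "integrable lborel g"
  shows "integrable (lborel \<Otimes>\<^sub>M lborel) (\<lambda>(t, \<tau>). f (t - \<tau>) * g \<tau>)"
proof (rule integrableI_bounded)
  have [measurable]: "f \<in> borel_measurable borel" "g \<in> borel_measurable borel" using f g by auto
  have "(\<integral>\<^sup>+ p. ennreal (norm (case p of (t, \<tau>) \<Rightarrow> f (t - \<tau>) * g \<tau>)) \<partial>(lborel \<Otimes>\<^sub>M lborel))
    = (\<integral>\<^sup>+ \<tau>. (\<integral>\<^sup>+ t. ennreal \<bar>f (t - \<tau>)\<bar> * ennreal \<bar>g \<tau>\<bar> \<partial>lborel) \<partial>lborel)"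
    by (subst lborel_pair.nn_integral_snd[symmetric])
       (auto simp: case_prod_unfold abs_mult ennreal_mult)
  also have "\<dots> = (\<integral>\<^sup>+ \<tau>. (\<integral>\<^sup>+ t. ennreal \<bar>f t\<bar> \<partial>lborel) * ennreal \<bar>g \<tau>\<bar> \<partial>lborel)"
    by (intro nn_integral_cong, subst nn_integral_multc)
       (auto intro!: arg_cong2[where f="(*)"] nn_integral_shift[where f="\<lambda>s. ennreal \<bar>f s\<bar>"])
  also have "\<dots> = (\<integral>\<^sup>+ t. ennreal \<bar>f t\<bar> \<partial>lborel) * (\<integral>\<^sup>+ \<tau>. ennreal \<bar>g \<tau>\<bar> \<partial>lborel)"
    by (rule nn_integral_cmult) measurable
  also have "\<dots> < \<infinity>"
    using f g unfolding integrable_iff_bounded by (auto simp: ennreal_mult_less_top)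
  finally show "(\<integral>\<^sup>+ p. ennreal (norm (case p of (t, \<tau>) \<Rightarrow> f (t - \<tau>) * g \<tau>)) \<partial>(lborel \<Otimes>\<^sub>M lborel)) < \<infinity>" .
  show "(\<lambda>(t, \<tau>). f (t - \<tau>) * g \<tau>) \<in> borel_measurable (lborel \<Otimes>\<^sub>M lborel)" by measurable
qed

lemma
  fixes f g :: "real \<Rightarrow> real"
  assumes f: "integrable lborel f" and g: "integrable lborel g"
  shows star_integrable: "integrable lborel (f \<star> g)"
    and star_AE_integrable: "AE t in lborel. integrable lborel (\<lambda>\<tau>. f (t - \<tau>) * g \<tau>)"
    and integral_star: "(LINT t|lborel. (f \<star> g) t) = (LINT t|lborel. f t) * (LINT t|lborel. g t)"
proof -
  have [measurable]: "f \<in> borel_measurable borel" "g \<in> borel_measurable borel" using f g by auto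
  note int = integrable_conv_kernel[OF f g]
  show "integrable lborel (f \<star> g)"
    using lborel_pair.integrable_fst[OF int] unfolding star_def[abs_def] .
  show "AE t in lborel. integrable lborel (\<lambda>\<tau>. f (t - \<tau>) * g \<tau>)"
    using lborel_pair.AE_integrable_fst[OF int] .
  have "(LINT t|lborel. f (t - \<tau>)) = (LINT t|lborel. f t)" for \<tau>
    using lborel_integral_real_affine[of 1 f "-\<tau>"] by simp
  then show "(LINT t|lborel. (f \<star> g) t) = (LINT t|lborel. f t) * (LINT t|lborel. g t)"
    using lborel_pair.Fubini_integral[OF int] unfolding star_def by simp
qed

lemma measurable_star:
  assumes [measurable]: "f \<in> borel_measurable borel" "g \<in> borel_measurable borel"
  shows "f \<star> g \<in> borel_measurable borel"
  unfolding star_def[abs_def] by measurable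

lemma nn_integral_star_le:
  fixes f g :: "real \<Rightarrow> real"
  assumes [measurable]: "f \<in> borel_measurable borel" "g \<in> borel_measurable borel"
  shows "(\<integral>\<^sup>+ t. ennreal \<bar>(f \<star> g) t\<bar> \<partial>lborel) \<le>
     (\<integral>\<^sup>+ t. ennreal \<bar>f t\<bar> \<partial>lborel) * (\<integral>\<^sup>+ t. ennreal \<bar>g t\<bar> \<partial>lborel)"
proof -
  have "(\<integral>\<^sup>+ t. ennreal \<bar>(f \<star> g) t\<bar> \<partial>lborel) \<le> (\<integral>\<^sup>+ t. (\<integral>\<^sup>+ \<tau>. ennreal \<bar>f (t - \<tau>) * g \<tau>\<bar> \<partial>lborel) \<partial>lborel)"
  proof (rule nn_integral_mono)
    fix t
    show "ennreal \<bar>(f \<star> g) t\<bar> \<le> (\<integral>\<^sup>+ \<tau>. ennreal \<bar>f (t - \<tau>) * g \<tau>\<bar> \<partial>lborel)"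
      unfolding star_def
      by (cases "integrable lborel (\<lambda>\<tau>. f (t - \<tau>) * g \<tau>)")
         (use integral_norm_bound_ennreal[of lborel "\<lambda>\<tau>. f (t - \<tau>) * g \<tau>"] in
           \<open>auto simp: not_integrable_integral_eq\<close>)
  qed
  also have "\<dots> = (\<integral>\<^sup>+ \<tau>. (\<integral>\<^sup>+ t. ennreal \<bar>f (t - \<tau>)\<bar> * ennreal \<bar>g \<tau>\<bar> \<partial>lborel) \<partial>lborel)"
    by (subst lborel_pair.Fubini') (auto simp: abs_mult ennreal_mult)
  also have "\<dots> = (\<integral>\<^sup>+ \<tau>. (\<integral>\<^sup>+ t. ennreal \<bar>f t\<bar> \<partial>lborel) * ennreal \<bar>g \<tau>\<bar> \<partial>lborel)"
    by (intro nn_integral_cong, subst nn_integral_multc)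
       (auto intro!: arg_cong2[where f="(*)"] nn_integral_shift[where f="\<lambda>s. ennreal \<bar>f s\<bar>"])
  also have "\<dots> = (\<integral>\<^sup>+ t. ennreal \<bar>f t\<bar> \<partial>lborel) * (\<integral>\<^sup>+ \<tau>. ennreal \<bar>g \<tau>\<bar> \<partial>lborel)"
    by (rule nn_integral_cmult) measurable
  finally show ?thesis .
qed

lemma star_assoc:
  fixes f g h :: "real \<Rightarrow> real"
  assumes f: "integrable lborel f" and g: "integrable lborel g" and h: "integrable lborel h"
  shows "AE t in lborel. (f \<star> (g \<star> h)) t = ((f \<star> g) \<star> h) t"
proof -
  have [measurable]: "f \<in> borel_measurable borel" "g \<in> borel_measurable borel" 
    "h \<in> borel_measurable borel" using f g h by auto
  note int = integrable_conv_kernel[OF g h]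
  show ?thesis
    using star_integral_swap[OF lborel.sigma_finite_measure_axioms f int]
  proof eventually_elim
    case (elim t)
    have "(f \<star> (\<lambda>\<tau>. g (\<tau> - y) * h y)) t = (f \<star> g) (t - y) * h y" for y
    proof -
      have "(f \<star> (\<lambda>\<tau>. g (\<tau> - y) * h y)) t = (LINT \<tau>|lborel. f (t - \<tau>) * g (\<tau> - y)) * h y"
        unfolding star_def by (simp flip: mult.assoc)
      also have "(LINT \<tau>|lborel. f (t - \<tau>) * g (\<tau> - y)) = (f \<star> g) (t - y)"
        using lborel_integral_real_affine[of 1 "\<lambda>\<tau>. f (t - \<tau>) * g (\<tau> - y)" y]
        unfolding star_def by (simp add: algebra_simps)
      finally show ?thesis .
    qed
    moreover have "(LINT y|lborel. (f \<star> g) (t - y) * h y) = ((f \<star> g) \<star> h) t"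
      by (simp add: star_def[of "f \<star> g"])
    moreover have "(g \<star> h) = (\<lambda>\<tau>. LINT y|lborel. g (\<tau> - y) * h y)"
      by (auto simp: star_def)
    ultimately show ?case using elim by simp
  qed
qed

lemma star_add_right:
  fixes f g h :: "real \<Rightarrow> real"
  assumes f: "integrable lborel f" and g: "integrable lborel g" and h: "integrable lborel h"
  shows "AE t in lborel. (f \<star> (\<lambda>\<tau>. g \<tau> + h \<tau>)) t = (f \<star> g) t + (f \<star> h) t"
  using star_AE_integrable[OF f g] star_AE_integrable[OF f h]
  by eventually_elim (simp add: star_def distrib_left)

lemma star_scale_right: "(f \<star> (\<lambda>\<tau>. c * g \<tau>)) t = c * (f \<star> g) t"
  unfolding star_def by (simp add: mult.left_commute)

lemma star_diff_right:
  fixes f g h :: "real \<Rightarrow> real"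
  assumes f: "integrable lborel f" and g: "integrable lborel g" and h: "integrable lborel h"
  shows "AE t in lborel. (f \<star> (\<lambda>\<tau>. g \<tau> - h \<tau>)) t = (f \<star> g) t - (f \<star> h) t"
  using star_AE_integrable[OF f g] star_AE_integrable[OF f h]
  by eventually_elim (simp add: star_def right_diff_distrib)

section \<open>Differentiation of integrals in \<open>L\<^sub>1\<close>\<close>

lemma star_abs_le: "\<bar>(f \<star> g) t\<bar> \<le> ((\<lambda>s. \<bar>f s\<bar>) \<star> (\<lambda>s. \<bar>g s\<bar>)) t"
  unfolding star_def using integral_norm_bound[of lborel "\<lambda>\<tau>. f (t - \<tau>) * g \<tau>"]
  by (simp add: abs_mult)

lemma integral_abs_star_le:
  assumes f: "integrable lborel f" and g: "integrable lborel g"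
  shows "(LINT t|lborel. \<bar>(f \<star> g) t\<bar>) \<le> (LINT t|lborel. \<bar>f t\<bar>) * (LINT t|lborel. \<bar>g t\<bar>)"
proof -
  have "(LINT t|lborel. \<bar>(f \<star> g) t\<bar>) \<le> (LINT t|lborel. ((\<lambda>s. \<bar>f s\<bar>) \<star> (\<lambda>s. \<bar>g s\<bar>)) t)"
    using star_integrable[OF f g] star_integrable[OF integrable_abs[OF f] integrable_abs[OF g]]
    by (intro integral_mono) (auto intro: star_abs_le)
  also have "\<dots> = (LINT t|lborel. \<bar>f t\<bar>) * (LINT t|lborel. \<bar>g t\<bar>)"
    by (rule integral_star) (use f g in auto)
  finally show ?thesis .
qed

text \<open>
Convolution with \<open>fdiff n\<close> is the difference quotient with step \<open>1 / (n + 1)\<close> of the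
primitive, see \<open>fdiff_star_eq\<close>; the step is written with \<open>Suc n\<close> to avoid division by zero.
\<close>

definition fdiff :: "nat \<Rightarrow> real \<Rightarrow> real" where
  "fdiff n s = real (Suc n) * indicator {-1 / real (Suc n)<..0} s"

definition prim :: "(real \<Rightarrow> real) \<Rightarrow> real \<Rightarrow> real" where
  "prim f t = (LINT \<tau>|lborel. indicator {..<t} \<tau> * f \<tau>)"

lemma fdiff_integrable: "integrable lborel (fdiff n)"
  unfolding fdiff_def[abs_def] by (intro integrable_mult_right integrable_real_indicator) auto

lemma fdiff_nonneg: "0 \<le> fdiff n s"
  by (simp add: fdiff_def)

lemma integral_fdiff: "(LINT s|lborel. fdiff n s) = 1"
  unfolding fdiff_def by (simp add: field_simps)

lemma integrable_indicator_times:
  fixes f :: "real \<Rightarrow> real"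
  assumes "integrable lborel f" "A \<in> sets borel" shows "integrable lborel (\<lambda>\<tau>. indicator A \<tau> * f \<tau>)"
  using integrable_mult_indicator[of A lborel f] assms by simp

lemma fdiff_star_eq:
  assumes "integrable lborel f"
  shows "(fdiff n \<star> f) t = real (Suc n) * (prim f (t + 1 / real (Suc n)) - prim f t)"
proof -
  have "prim f (t + 1 / real (Suc n)) - prim f t =
    (LINT \<tau>|lborel. indicator {..<t + 1 / real (Suc n)} \<tau> * f \<tau> - indicator {..<t} \<tau> * f \<tau>)"
    unfolding prim_def using assms
    by (intro Bochner_Integration.integral_diff[symmetric] integrable_indicator_times) auto
  also have "(\<lambda>\<tau>. indicator {..<t + 1 / real (Suc n)} \<tau> * f \<tau> - indicator {..<t} \<tau> * f \<tau>)
     = (\<lambda>\<tau>. indicator {-1 / real (Suc n)<..0} (t - \<tau>) * f \<tau>)"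
  proof
    fix \<tau>
    define \<delta> where "\<delta> = 1 / real (Suc n)"
    have "\<delta> > 0" "-1 / real (Suc n) = - \<delta>" by (simp_all add: \<delta>_def)
    then show "indicator {..<t + 1 / real (Suc n)} \<tau> * f \<tau> - indicator {..<t} \<tau> * f \<tau>
       = indicator {-1 / real (Suc n)<..0} (t - \<tau>) * f \<tau>"
      unfolding indicator_def \<delta>_def[symmetric] by auto
  qed
  finally show ?thesis
    unfolding star_def fdiff_def by (simp add: mult.assoc)
qed

definition fdiff_conv :: "(real \<Rightarrow> real) \<Rightarrow> bool" where
  "fdiff_conv f \<longleftrightarrow> (\<lambda>n. LINT t|lborel. \<bar>(fdiff n \<star> f) t - f t\<bar>) \<longlonglongrightarrow> 0"

lemma fdiff_err_triangle:
  assumes f: "integrable lborel f" and g: "integrable lborel g"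
  shows "(LINT t|lborel. \<bar>(fdiff n \<star> f) t - f t\<bar>) \<le>
     (LINT t|lborel. \<bar>(fdiff n \<star> g) t - g t\<bar>) + 2 * (LINT t|lborel. \<bar>f t - g t\<bar>)"
proof -
  let ?d = "\<lambda>t. f t - g t"
  have d: "integrable lborel ?d" using f g by auto
  note i = star_integrable[OF fdiff_integrable d, of n] star_integrable[OF fdiff_integrable g, of n]
    star_integrable[OF fdiff_integrable f, of n]
  have "(LINT t|lborel. \<bar>(fdiff n \<star> f) t - f t\<bar>) \<le>
    (LINT t|lborel. \<bar>(fdiff n \<star> g) t - g t\<bar> + (\<bar>(fdiff n \<star> ?d) t\<bar> + \<bar>f t - g t\<bar>))"
  proof (rule integral_mono_AE)
    show "AE t in lborel. \<bar>(fdiff n \<star> f) t - f t\<bar> \<le> \<bar>(fdiff n \<star> g) t - g t\<bar> + (\<bar>(fdiff n \<star> ?d) t\<bar> + \<bar>f t - g t\<bar>)"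
      using star_diff_right[OF fdiff_integrable f g, of n] by eventually_elim linarith
  qed (use f g i in auto)
  also have "\<dots> = (LINT t|lborel. \<bar>(fdiff n \<star> g) t - g t\<bar>) + ((LINT t|lborel. \<bar>(fdiff n \<star> ?d) t\<bar>) + (LINT t|lborel. \<bar>f t - g t\<bar>))"
    using f g i by (subst Bochner_Integration.integral_add; simp)+
  also have "(LINT t|lborel. \<bar>(fdiff n \<star> ?d) t\<bar>) \<le> (LINT t|lborel. \<bar>fdiff n t\<bar>) * (LINT t|lborel. \<bar>f t - g t\<bar>)"
    by (rule integral_abs_star_le[OF fdiff_integrable d])
  also have "(LINT t|lborel. \<bar>fdiff n t\<bar>) = 1"
    using integral_fdiff[of n] by (simp add: fdiff_nonneg)
  finally show ?thesis by simp
qed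

text \<open>
Convolution with \<open>fdiff n\<close> is a contraction of \<open>L\<^sub>1\<close>, so the set of functions with convergent
difference quotients is closed.
\<close>

lemma fdiff_conv_approx:
  assumes f: "integrable lborel f"
    and g: "\<And>e. e > 0 \<Longrightarrow> \<exists>g. integrable lborel g \<and> fdiff_conv g \<and> (LINT t|lborel. \<bar>f t - g t\<bar>) \<le> e"
  shows "fdiff_conv f"
  unfolding fdiff_conv_def
proof (rule LIMSEQ_I)
  fix e :: real assume "e > 0"
  then obtain g where g: "integrable lborel g" "fdiff_conv g" "(LINT t|lborel. \<bar>f t - g t\<bar>) \<le> e / 4"
    using g[of "e / 4"] by auto
  from LIMSEQ_D[OF g(2)[unfolded fdiff_conv_def], of "e / 2"] \<open>e > 0\<close> obtain N where
    N: "\<And>n. n \<ge> N \<Longrightarrow> (LINT t|lborel. \<bar>(fdiff n \<star> g) t - g t\<bar>) < e / 2" by force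
  have "norm ((LINT t|lborel. \<bar>(fdiff n \<star> f) t - f t\<bar>) - 0) < e" if "n \<ge> N" for n
    using N[OF that] fdiff_err_triangle[OF f g(1), of n] g(3) by simp
  then show "\<exists>N. \<forall>n\<ge>N. norm ((LINT t|lborel. \<bar>(fdiff n \<star> f) t - f t\<bar>) - 0) < e" by blast
qed

lemma fdiff_conv_scale:
  assumes "fdiff_conv f" shows "fdiff_conv (\<lambda>t. c * f t)"
proof -
  have "(LINT t|lborel. \<bar>(fdiff n \<star> (\<lambda>t. c * f t)) t - c * f t\<bar>) = \<bar>c\<bar> * (LINT t|lborel. \<bar>(fdiff n \<star> f) t - f t\<bar>)" for n
    by (simp add: star_scale_right abs_mult flip: right_diff_distrib)
  then show ?thesis
    using tendsto_mult_right_zero[OF assms[unfolded fdiff_conv_def], of "\<bar>c\<bar>"]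
    unfolding fdiff_conv_def by simp
qed

lemma fdiff_conv_add:
  assumes f: "integrable lborel f" and g: "integrable lborel g" and "fdiff_conv f" "fdiff_conv g"
  shows "fdiff_conv (\<lambda>t. f t + g t)"
  unfolding fdiff_conv_def
proof (rule Lim_null_comparison)
  show "((\<lambda>n. (LINT t|lborel. \<bar>(fdiff n \<star> f) t - f t\<bar>) + (LINT t|lborel. \<bar>(fdiff n \<star> g) t - g t\<bar>)) \<longlongrightarrow> 0) sequentially"
    using tendsto_add[OF assms(3,4)[unfolded fdiff_conv_def]] by simp
  show "\<forall>\<^sub>F n in sequentially. norm (LINT t|lborel. \<bar>(fdiff n \<star> (\<lambda>t. f t + g t)) t - (f t + g t)\<bar>)
    \<le> (LINT t|lborel. \<bar>(fdiff n \<star> f) t - f t\<bar>) + (LINT t|lborel. \<bar>(fdiff n \<star> g) t - g t\<bar>)"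
  proof (rule always_eventually, rule allI)
    fix n
    have s: "integrable lborel (\<lambda>t. f t + g t)" using f g by auto
    note i = star_integrable[OF fdiff_integrable s, of n] star_integrable[OF fdiff_integrable g, of n]
      star_integrable[OF fdiff_integrable f, of n]
    have "(LINT t|lborel. \<bar>(fdiff n \<star> (\<lambda>t. f t + g t)) t - (f t + g t)\<bar>) \<le>
      (LINT t|lborel. \<bar>(fdiff n \<star> f) t - f t\<bar> + \<bar>(fdiff n \<star> g) t - g t\<bar>)"
    proof (rule integral_mono_AE)
      show "AE t in lborel. \<bar>(fdiff n \<star> (\<lambda>t. f t + g t)) t - (f t + g t)\<bar> \<le> \<bar>(fdiff n \<star> f) t - f t\<bar> + \<bar>(fdiff n \<star> g) t - g t\<bar>"
        using star_add_right[OF fdiff_integrable f g, of n] by eventually_elim linarith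
    qed (use f g i in auto)
    also have "\<dots> = (LINT t|lborel. \<bar>(fdiff n \<star> f) t - f t\<bar>) + (LINT t|lborel. \<bar>(fdiff n \<star> g) t - g t\<bar>)"
      using f g i by (intro Bochner_Integration.integral_add) auto
    finally show "norm (LINT t|lborel. \<bar>(fdiff n \<star> (\<lambda>t. f t + g t)) t - (f t + g t)\<bar>)
      \<le> (LINT t|lborel. \<bar>(fdiff n \<star> f) t - f t\<bar>) + (LINT t|lborel. \<bar>(fdiff n \<star> g) t - g t\<bar>)" by simp
  qed
qed

text \<open>
At a point of the open set the difference quotients are eventually equal to 1; on the boundary nothing is
known pointwise. But the integrals of \<open>fdiff n \<star> 1\<^sub>U\<close> and \<open>1\<^sub>U\<close> agree, so the \<open>L\<^sub>1\<close> distance is twice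
the mass missing inside \<open>U\<close>, which tends to 0 by dominated convergence.
\<close>

lemma fdiff_conv_open:
  fixes U :: "real set"
  assumes U: "open U" "emeasure lborel U < \<infinity>"
  shows "fdiff_conv (indicator U)"
proof -
  let ?g = "indicator U :: real \<Rightarrow> real"
  have [measurable]: "U \<in> sets borel" using U by auto
  have g: "integrable lborel ?g" using U by (intro integrable_real_indicator) auto
  let ?p = "\<lambda>n. fdiff n \<star> ?g"
  note p = star_integrable[OF fdiff_integrable g]
  have p0: "0 \<le> ?p n t" for n t
    unfolding star_def by (intro integral_nonneg_AE) (auto simp: fdiff_nonneg)
  have fi: "integrable lborel (\<lambda>\<tau>. fdiff n (t - \<tau>))" "(LINT \<tau>|lborel. fdiff n (t - \<tau>)) = 1" for n t
    using integrable_reflect[OF fdiff_integrable, of n t] integral_reflect[of "fdiff n" t] integral_fdiff[of n] by simp_all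
  have p1: "?p n t \<le> 1" for n t
  proof -
    have "?p n t \<le> (LINT \<tau>|lborel. fdiff n (t - \<tau>))"
      unfolding star_def
      by (intro integral_mono fi Bochner_Integration.integrable_bound[OF fi(1)[of n t]])
         (auto simp: fdiff_nonneg fdiff_def split: split_indicator)
    with fi(2)[of n t] show ?thesis by simp
  qed
  have pU: "(\<lambda>n. ?p n t) \<longlonglongrightarrow> 1" if "t \<in> U" for t
  proof -
    obtain e where e: "e > 0" "ball t e \<subseteq> U" using U \<open>t \<in> U\<close> open_contains_ball by blast
    obtain N where N: "1 / real (Suc N) < e" using e nat_approx_posE by blast
    have "?p n t = 1" if "n \<ge> N" for n
    proof -
      have "1 / real (Suc n) \<le> 1 / real (Suc N)" using that by (simp add: frac_le)
      with N have "1 / real (Suc n) < e" by linarith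
      then have "fdiff n (t - \<tau>) * ?g \<tau> = fdiff n (t - \<tau>)" for \<tau>
        using e(2) by (auto simp: fdiff_def dist_real_def subset_eq simp del: of_nat_Suc split: split_indicator)
      then show ?thesis unfolding star_def using fi(2)[of n t] by (simp only:)
    qed
    then show ?thesis by (intro tendsto_eventually) (auto simp: eventually_sequentially)
  qed
  have "(LINT t|lborel. \<bar>?p n t - ?g t\<bar>) = 2 * (LINT t|lborel. ?g t * (1 - ?p n t))" for n
  proof -
    have i: "integrable lborel (\<lambda>t. ?g t * (1 - ?p n t))"
      by (rule Bochner_Integration.integrable_bound[OF g])
         (use p0[of n] p1[of n] p[of n] in \<open>auto split: split_indicator simp: abs_le_iff\<close>)
    have "(LINT t|lborel. \<bar>?p n t - ?g t\<bar>) = (LINT t|lborel. (?p n t - ?g t) + 2 * (?g t * (1 - ?p n t)))"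
      using p0[of n] p1[of n] by (intro Bochner_Integration.integral_cong) (auto split: split_indicator simp: abs_if not_less intro!: antisym)
    also have "\<dots> = (LINT t|lborel. ?p n t) - (LINT t|lborel. ?g t) + 2 * (LINT t|lborel. ?g t * (1 - ?p n t))"
      using p[of n] g i by (subst Bochner_Integration.integral_add; simp)+
    also have "(LINT t|lborel. ?p n t) = (LINT t|lborel. ?g t)"
      using integral_star[OF fdiff_integrable g, of n] by (simp add: integral_fdiff)
    finally show ?thesis by simp
  qed
  moreover have "(\<lambda>n. LINT t|lborel. ?g t * (1 - ?p n t)) \<longlonglongrightarrow> (LINT t::real|lborel. (0::real))"
  proof (rule integral_dominated_convergence[OF _ _ g])
    show "AE t in lborel. (\<lambda>n. ?g t * (1 - ?p n t)) \<longlonglongrightarrow> 0"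
    proof (rule AE_I2)
      fix t show "(\<lambda>n. ?g t * (1 - ?p n t)) \<longlonglongrightarrow> 0"
        using tendsto_diff[OF tendsto_const pU, of t 1] by (cases "t \<in> U") auto
    qed
    show "AE t in lborel. norm (?g t * (1 - ?p n t)) \<le> ?g t" for n
      using p0[of n] p1[of n] by (auto split: split_indicator simp: abs_le_iff)
  qed (use p in auto)
  ultimately show ?thesis unfolding fdiff_conv_def
    using tendsto_mult_right_zero[of _ sequentially "2::real"] by simp
qed

text \<open>
Lebesgue's differentiation theorem in the \<open>L\<^sub>1\<close> sense. Borel sets are approximated by open sets from
outside, the general case follows from the closedness of the set of good functions.
\<close>

theorem fdiff_conv_integrable:
  fixes f :: "real \<Rightarrow> real"
  assumes "integrable lborel f" shows "fdiff_conv f"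
  using assms
proof (induction rule: integrable_induct)
  case (base A c)
  then have [measurable]: "A \<in> sets borel" by auto
  have "fdiff_conv (\<lambda>t. c * indicator A t)"
  proof (rule fdiff_conv_approx)
    show "integrable lborel (\<lambda>t. c * indicator A t)" using base by auto
    fix e :: real assume "e > 0"
    define e' where "e' = e / (\<bar>c\<bar> + 1)"
    have "e' > 0" using \<open>e > 0\<close> by (auto simp: e'_def)
    then obtain U where U: "open U" "A \<subseteq> U" "emeasure lborel (U - A) < e'"
      using outer_regular_lborel[of A e'] by auto
    have [measurable]: "U \<in> sets borel" using U by auto
    have UA: "emeasure lborel (U - A) < \<infinity>" using U(3) ennreal_less_top[of e'] by (metis infinity_ennreal_def order_less_trans)
    have "U = A \<union> (U - A)" using U by auto
    then have "emeasure lborel U \<le> emeasure lborel A + emeasure lborel (U - A)"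
      by (metis \<open>A \<in> sets borel\<close> \<open>U \<in> sets borel\<close> emeasure_subadditive sets.Diff sets_lborel)
    then have Uf: "emeasure lborel U < \<infinity>"
      using base UA by (simp add: less_top[symmetric]) (metis ennreal_add_eq_top neq_top_trans)
    show "\<exists>g. integrable lborel g \<and> fdiff_conv g \<and> (LINT t|lborel. \<bar>c * indicator A t - g t\<bar>) \<le> e"
    proof (intro exI conjI)
      show "integrable lborel (\<lambda>t. c * indicator U t)"
        using Uf by (intro integrable_mult_right integrable_real_indicator) auto
      show "fdiff_conv (\<lambda>t. c * indicator U t)"
        by (rule fdiff_conv_scale[OF fdiff_conv_open[OF U(1) Uf]])
      have "(LINT t|lborel. \<bar>c * indicator A t - c * indicator U t\<bar>) = (LINT t|lborel. \<bar>c\<bar> * indicator (U - A) t)"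
        using U(2) by (intro Bochner_Integration.integral_cong) (auto split: split_indicator)
      also have "\<dots> = \<bar>c\<bar> * measure lborel (U - A)" by simp
      also have "\<dots> \<le> \<bar>c\<bar> * e'"
      proof (rule mult_left_mono)
        show "measure lborel (U - A) \<le> e'"
          using U(3) UA \<open>e' > 0\<close> by (simp add: emeasure_eq_ennreal_measure ennreal_less_iff less_top)
      qed simp
      also have "\<dots> \<le> e" unfolding e'_def using \<open>e > 0\<close> by (simp add: field_simps)
      finally show "(LINT t|lborel. \<bar>c * indicator A t - c * indicator U t\<bar>) \<le> e" .
    qed
  qed
  then show ?case by (simp add: mult.commute)
next
  case (add f g)
  then show ?case using fdiff_conv_add by blast
next
  case (lim f s)
  show ?case
  proof (rule fdiff_conv_approx)
    fix e :: real assume "e > 0"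
    have "(\<lambda>i. LINT t|lborel. \<bar>f t - s i t\<bar>) \<longlonglongrightarrow> (LINT t::real|lborel. (0::real))"
    proof (rule integral_dominated_convergence[where w="\<lambda>t::real. 3 * norm (f t)"])
      show "AE t in lborel. (\<lambda>i. \<bar>f t - s i t\<bar>) \<longlonglongrightarrow> (0::real)"
      proof (rule AE_I2)
        fix t have "(\<lambda>i. s i t) \<longlonglongrightarrow> f t" using lim by auto
        from tendsto_rabs[OF tendsto_diff[OF tendsto_const[of "f t"] this]]
        show "(\<lambda>i. \<bar>f t - s i t\<bar>) \<longlonglongrightarrow> 0" by simp
      qed
      show "AE t in lborel. norm \<bar>f t - s i t\<bar> \<le> 3 * norm (f t)" for i
      proof (rule AE_I2)
        fix t have "norm (s i t) \<le> 2 * norm (f t)" using lim by auto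
        then show "norm \<bar>f t - s i t\<bar> \<le> 3 * norm (f t)" by simp
      qed
    qed (use lim in auto)
    from LIMSEQ_D[OF this \<open>e > 0\<close>] obtain i where "(LINT t|lborel. \<bar>f t - s i t\<bar>) < e"
      by force
    with lim show "\<exists>g. integrable lborel g \<and> fdiff_conv g \<and> (LINT t|lborel. \<bar>f t - g t\<bar>) \<le> e"
      by (intro exI[of _ "s i"]) auto
  qed (use lim in auto)
qed

section \<open>The convolution algebra of causal functions\<close>

definition causal :: "(real \<Rightarrow> real) \<Rightarrow> bool" where
  "causal f \<longleftrightarrow> integrable lborel f \<and> (\<forall>t\<le>0. f t = 0)"

text \<open>
Truncating \<open>k\<close> and \<open>l\<close> to \<open>(0, T)\<close> destroys relations such as \<open>k * l = 1\<close> beyond \<open>T\<close>. The relation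
\<open>eq_below T\<close> is a congruence for the convolution of causal functions, so identities may be computed
with it as if they were identities in an algebra.
\<close>

definition eq_below :: "real \<Rightarrow> (real \<Rightarrow> real) \<Rightarrow> (real \<Rightarrow> real) \<Rightarrow> bool" where
  "eq_below T f g \<longleftrightarrow> (AE t in lborel. t < T \<longrightarrow> f t = g t)"

text \<open>
The constant function 1 on \<open>(0, T)\<close>. Up to time \<open>T\<close>, convolution of a causal function with it is
integration from 0.
\<close>

definition one :: "real \<Rightarrow> real \<Rightarrow> real" where
  "one T t = indicator {0<..<T} t"

lemma causalI: "integrable lborel f \<Longrightarrow> (\<And>t. t \<le> 0 \<Longrightarrow> f t = 0) \<Longrightarrow> causal f"
  by (auto simp: causal_def)

lemma causalD: assumes "causal f" shows "integrable lborel f" "t \<le> 0 \<Longrightarrow> f t = 0" "f \<in> borel_measurable borel"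
  using assms by (auto simp: causal_def)

lemma causal_star: "causal f \<Longrightarrow> causal g \<Longrightarrow> causal (f \<star> g)"
  by (intro causalI star_integrable) (auto simp: causal_def intro: star_causal)

lemma causal_add: "causal f \<Longrightarrow> causal g \<Longrightarrow> causal (\<lambda>t. f t + g t)"
  and causal_diff: "causal f \<Longrightarrow> causal g \<Longrightarrow> causal (\<lambda>t. f t - g t)"
  and causal_scale: "causal f \<Longrightarrow> causal (\<lambda>t. c * f t)"
  by (auto simp: causal_def)

lemma causal_one: "causal (one T)"
  using emeasure_lborel_Ioo[of 0 T]
  by (intro causalI) (cases "0 \<le> T"; auto simp: one_def[abs_def] intro!: integrable_real_indicator)+

lemma causal_zero: "causal (\<lambda>t. 0)"
  by (auto simp: causal_def)

lemmas causal_intros = causal_star causal_add causal_diff causal_scale causal_one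

lemma eq_below_refl: "eq_below T f f" by (simp add: eq_below_def)

lemma eq_below_sym: "eq_below T f g \<Longrightarrow> eq_below T g f"
  unfolding eq_below_def by (auto elim!: eventually_mono)

lemma eq_below_trans [trans]: 
  assumes "eq_below T f g" "eq_below T g h" shows "eq_below T f h"
  using assms unfolding eq_below_def by eventually_elim auto

lemma eq_below_add: 
  assumes "eq_below T f f'" "eq_below T g g'" shows "eq_below T (\<lambda>t. f t + g t) (\<lambda>t. f' t + g' t)"
  using assms unfolding eq_below_def by eventually_elim auto

lemma eq_below_diff: 
  assumes "eq_below T f f'" "eq_below T g g'" shows "eq_below T (\<lambda>t. f t - g t) (\<lambda>t. f' t - g' t)"
  using assms unfolding eq_below_def by eventually_elim auto

lemma star_cong_left:
  assumes "eq_below T f f'" "causal f" "causal f'" "causal g" "t \<le> T"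
  shows "(f \<star> g) t = (f' \<star> g) t"
  using assms by (intro star_cong_AE[of T]) (auto simp: eq_below_def causal_def)

lemma star_cong_right:
  assumes "eq_below T f f'" "causal f" "causal f'" "causal g" "t \<le> T"
  shows "(g \<star> f) t = (g \<star> f') t"
  using star_cong_left[OF assms] by (simp add: star_commute)

lemma eq_below_star:
  assumes "eq_below T f f'" "eq_below T g g'" "causal f" "causal f'" "causal g" "causal g'"
  shows "eq_below T (f \<star> g) (f' \<star> g')"
  unfolding eq_below_def using star_cong_left[OF assms(1,3,4,5)] star_cong_right[OF assms(2,5,6,4)]
  by (auto intro!: AE_I2)

lemma eq_below_assoc:
  "causal f \<Longrightarrow> causal g \<Longrightarrow> causal h \<Longrightarrow> eq_below T (f \<star> (g \<star> h)) ((f \<star> g) \<star> h)"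
  using star_assoc[of f g h] unfolding eq_below_def causal_def by auto

lemma eq_below_left_commute:
  assumes "causal f" "causal g" "causal h" 
  shows "eq_below T (f \<star> (g \<star> h)) (g \<star> (f \<star> h))"
proof -
  have "eq_below T (f \<star> (g \<star> h)) ((f \<star> g) \<star> h)" by (rule eq_below_assoc[OF assms])
  also have "eq_below T ((f \<star> g) \<star> h) (g \<star> (f \<star> h))"
    using eq_below_sym[OF eq_below_assoc[OF assms(2,1,3)]] by (simp add: star_commute[of f g])
  finally show ?thesis .
qed

lemma eq_below_star_add:
  "causal f \<Longrightarrow> causal g \<Longrightarrow> causal h \<Longrightarrow> eq_below T (f \<star> (\<lambda>t. g t + h t)) (\<lambda>t. (f \<star> g) t + (f \<star> h) t)"
  using star_add_right[of f g h] unfolding eq_below_def causal_def by auto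

lemma eq_below_star_diff:
  "causal f \<Longrightarrow> causal g \<Longrightarrow> causal h \<Longrightarrow> eq_below T (f \<star> (\<lambda>t. g t - h t)) (\<lambda>t. (f \<star> g) t - (f \<star> h) t)"
  using star_diff_right[of f g h] unfolding eq_below_def causal_def by auto

lemma one_star_eq_prim:
  assumes "causal f" "t \<le> T" shows "(one T \<star> f) t = prim f t"
proof -
  have "one T (t - \<tau>) * f \<tau> = indicator {..<t} \<tau> * f \<tau>" for \<tau>
    using assms(2) causalD(2)[OF assms(1), of \<tau>] by (cases "\<tau> \<le> 0") (auto simp: one_def split: split_indicator)
  then show ?thesis unfolding star_def prim_def by (simp only:)
qed

text \<open>
If the primitive vanishes, so do its difference quotients, which converge to the function in \<open>L\<^sub>1\<close>.
\<close>

lemma one_star_eq_zero_imp: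
  assumes f: "causal f" and z: "eq_below T (one T \<star> f) (\<lambda>t. 0)"
  shows "eq_below T f (\<lambda>t. 0)"
proof -
  have fi: "integrable lborel f" and [measurable]: "f \<in> borel_measurable borel" using causalD[OF f] by auto
  have p0: "AE t in lborel. t < T \<longrightarrow> prim f t = 0"
    using z unfolding eq_below_def by eventually_elim (use one_star_eq_prim[OF f] in auto)
  have "AE t in lborel. t < T - 1 / real (Suc N) \<longrightarrow> f t = 0" for N
  proof -
    let ?I = "LINT t|lborel. indicator {..<T - 1 / real (Suc N)} t * \<bar>f t\<bar>"
    have ii: "integrable lborel (\<lambda>t. indicator {..<T - 1 / real (Suc N)} t * \<bar>f t\<bar>)"
      using fi by (intro integrable_indicator_times) auto
    have le: "?I \<le> (LINT t|lborel. \<bar>(fdiff n \<star> f) t - f t\<bar>)" if "n \<ge> N" for n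
    proof (rule integral_mono_AE[OF ii])
      show "integrable lborel (\<lambda>t. \<bar>(fdiff n \<star> f) t - f t\<bar>)"
        using star_integrable[OF fdiff_integrable fi] fi by auto
      have 1: "1 / real (Suc n) \<le> 1 / real (Suc N)" using that by (simp add: frac_le)
      have "AE t in lborel. t + 1 / real (Suc n) < T \<longrightarrow> prim f (t + 1 / real (Suc n)) = 0"
        using AE_reflect[OF AE_reflect[OF p0, of "0"], of "-1 / real (Suc n)"] by (simp add: algebra_simps)
      then show "AE t in lborel. indicator {..<T - 1 / real (Suc N)} t * \<bar>f t\<bar> \<le> \<bar>(fdiff n \<star> f) t - f t\<bar>"
        using p0
      proof eventually_elim
        case (elim t)
        show ?case
        proof (cases "t < T - 1 / real (Suc N)")
          case True
          have "1 / real (Suc N) > 0" by simp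
          with True have "t < T" by linarith
          with True 1 elim have "(fdiff n \<star> f) t = 0" unfolding fdiff_star_eq[OF fi] by simp
          then show ?thesis by (auto split: split_indicator)
        qed auto
      qed
    qed
    have "?I \<le> 0"
      using fdiff_conv_integrable[OF fi] le unfolding fdiff_conv_def
      by (intro tendsto_lowerbound[OF _ _ sequentially_bot])
         (auto simp: eventually_sequentially intro!: exI[of _ N])
    moreover have "?I \<ge> 0" by (intro integral_nonneg_AE) auto
    ultimately have "?I = 0" by (rule antisym)
    then have "AE t in lborel. indicator {..<T - 1 / real (Suc N)} t * \<bar>f t\<bar> = 0"
      using integral_nonneg_eq_0_iff_AE[OF ii] by auto
    then show ?thesis by eventually_elim (auto split: split_indicator_asm)
  qed
  then have "AE t in lborel. \<forall>N. t < T - 1 / real (Suc N) \<longrightarrow> f t = 0" by (subst AE_all_countable) blast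
  then show ?thesis unfolding eq_below_def
  proof eventually_elim
    case (elim t)
    show ?case
    proof
      assume "t < T"
      then obtain N where "1 / real (Suc N) < T - t" using nat_approx_posE[of "T - t"] by auto
      then have "t < T - 1 / real (Suc N)" by linarith
      then show "f t = 0" using elim by blast
    qed
  qed
qed

section \<open>Positivity of the kernel \<open>l\<close>\<close>

lemma prim_bound: assumes "integrable lborel f" shows "\<bar>prim f t\<bar> \<le> (LINT s|lborel. \<bar>f s\<bar>)"
proof -
  have "\<bar>prim f t\<bar> \<le> (LINT s|lborel. \<bar>indicator {..<t} s * f s\<bar>)"
    unfolding prim_def using integral_norm_bound[of lborel "\<lambda>s. indicator {..<t} s * f s"] by simp
  also have "\<dots> \<le> (LINT s|lborel. \<bar>f s\<bar>)"
    using assms by (intro integral_mono integrable_abs integrable_indicator_times) (auto split: split_indicator)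
  finally show ?thesis .
qed

text \<open>
Young's inequality for \<open>\<integral> U (p * U)\<close>, by \<open>U(t) U(\<tau>) \<le> (U(t)\<^sup>2 + U(\<tau>)\<^sup>2) / 2\<close> under the integral.
\<close>

lemma integral_square_star_le:
  assumes p: "integrable lborel p" "\<And>s. 0 \<le> p s" and U: "integrable lborel U" "\<And>s. \<bar>U s\<bar> \<le> B"
  shows "(LINT t|lborel. U t * (p \<star> U) t) \<le> (LINT t|lborel. p t) * (LINT t|lborel. (U t)\<^sup>2)"
    and "integrable lborel (\<lambda>t. U t * (p \<star> U) t)" "integrable lborel (\<lambda>t. (U t)\<^sup>2)"
proof -
  have [measurable]: "U \<in> borel_measurable borel" "p \<in> borel_measurable borel" using U p by auto
  have B: "0 \<le> B" using U(2)[of 0] by linarith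
  have U2: "integrable lborel (\<lambda>t. (U t)\<^sup>2)"
  proof (rule Bochner_Integration.integrable_bound[where f="\<lambda>t. B * U t"])
    show "AE t in lborel. norm ((U t)\<^sup>2) \<le> norm (B * U t)"
      using mult_right_mono[OF U(2) abs_ge_zero] B
      by (auto simp: power2_eq_square abs_mult intro!: AE_I2 simp del: abs_mult_self_eq)
  qed (use U in auto)
  show "integrable lborel (\<lambda>t. (U t)\<^sup>2)" by fact
  have pU: "integrable lborel (p \<star> U)" using star_integrable[OF p(1) U(1)] .
  show UpU: "integrable lborel (\<lambda>t. U t * (p \<star> U) t)"
    by (rule Bochner_Integration.integrable_bound[where f="\<lambda>t. B * (p \<star> U) t"])
       (use U(2) B pU in \<open>auto simp: abs_mult intro!: mult_right_mono AE_I2\<close>)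
  have pU2: "integrable lborel (p \<star> (\<lambda>t. (U t)\<^sup>2))" using star_integrable[OF p(1) U2] .
  have "(LINT t|lborel. U t * (p \<star> U) t) \<le> (LINT t|lborel. (LINT t|lborel. p t) / 2 * (U t)\<^sup>2 + 1/2 * (p \<star> (\<lambda>t. (U t)\<^sup>2)) t)"
  proof (rule integral_mono_AE[OF UpU])
    show "AE t in lborel. U t * (p \<star> U) t \<le> (LINT t|lborel. p t) / 2 * (U t)\<^sup>2 + 1/2 * (p \<star> (\<lambda>t. (U t)\<^sup>2)) t"
      using star_AE_integrable[OF p(1) U(1)] star_AE_integrable[OF p(1) U2]
    proof eventually_elim
      case (elim t)
      note pr = integrable_reflect[OF p(1), of t]
      have "U t * (p \<star> U) t = (LINT \<tau>|lborel. U t * (p (t - \<tau>) * U \<tau>))"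
        unfolding star_def by simp
      also have "\<dots> \<le> (LINT \<tau>|lborel. (U t)\<^sup>2 / 2 * p (t - \<tau>) + 1/2 * (p (t - \<tau>) * (U \<tau>)\<^sup>2))"
      proof (rule integral_mono)
        fix \<tau>
        have "U t * U \<tau> \<le> (U t)\<^sup>2 / 2 + (U \<tau>)\<^sup>2 / 2"
          using sum_squares_bound[of "U t" "U \<tau>"] by simp
        from mult_left_mono[OF this p(2)[of "t - \<tau>"]]
        show "U t * (p (t - \<tau>) * U \<tau>) \<le> (U t)\<^sup>2 / 2 * p (t - \<tau>) + 1/2 * (p (t - \<tau>) * (U \<tau>)\<^sup>2)"
          by (simp add: algebra_simps)
      qed (use elim pr in auto)
      also have "\<dots> = (U t)\<^sup>2 / 2 * (LINT \<tau>|lborel. p (t - \<tau>)) + 1/2 * (p \<star> (\<lambda>t. (U t)\<^sup>2)) t"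
        unfolding star_def using elim pr by (subst Bochner_Integration.integral_add; simp)
      finally show ?case unfolding integral_reflect by (simp add: algebra_simps)
    qed
  qed (use U2 pU2 in auto)
  also have "\<dots> = (LINT t|lborel. p t) * (LINT t|lborel. (U t)\<^sup>2)"
    using U2 pU2 by (subst Bochner_Integration.integral_add; simp add: integral_star[OF p(1) U2])
  finally show "(LINT t|lborel. U t * (p \<star> U) t) \<le> (LINT t|lborel. p t) * (LINT t|lborel. (U t)\<^sup>2)" .
qed

lemma prim_shift_cut:
  assumes k: "causal k" and "\<delta> > 0" "t > 0"
  shows "prim (\<lambda>s. indicator {0<..} s * k (s + \<delta>)) t = prim k (t + \<delta>) - prim k \<delta>"
proof -
  note ki = causalD(1)[OF k]
  have "prim (\<lambda>s. indicator {0<..} s * k (s + \<delta>)) t = (LINT s|lborel. indicator {0<..<t} s * k (s + \<delta>))"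
    unfolding prim_def by (intro Bochner_Integration.integral_cong) (auto split: split_indicator)
  also have "\<dots> = (LINT s|lborel. indicator {\<delta><..<t + \<delta>} s * k s)"
    by (subst lborel_integral_real_affine[where c=1 and t=\<delta>])
       (auto intro!: Bochner_Integration.integral_cong split: split_indicator simp: add.commute)
  also have "\<dots> = (LINT s|lborel. indicator {..<t + \<delta>} s * k s - indicator {..<\<delta>} s * k s)"
  proof (rule integral_cong_AE)
    show "AE s in lborel. indicator {\<delta><..<t + \<delta>} s * k s = indicator {..<t + \<delta>} s * k s - indicator {..<\<delta>} s * k s"
      using AE_lborel_singleton[of \<delta>]
      by eventually_elim (use assms in \<open>auto split: split_indicator\<close>)
  qed (use ki in auto)
  also have "\<dots> = prim k (t + \<delta>) - prim k \<delta>"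
    unfolding prim_def by (intro Bochner_Integration.integral_diff integrable_indicator_times ki) auto
  finally show ?thesis .
qed

text \<open>
Positivity of \<open>\<integral> u v\<close> for \<open>u = l * v\<close>, up to an error. Before \<open>T\<close> write \<open>k = c - 1 * p + e\<close>, where
\<open>c - 1 * p\<close> is the average of \<open>k\<close> over \<open>(t, t + \<delta>)\<close>. As \<open>k\<close> is nonnegative and
nonincreasing, \<open>p \<ge> 0\<close> and \<open>\<integral> p \<le> c\<close>.
With \<open>u = 1 * u1\<close>, the relation \<open>k * u = 1 * v\<close> becomes \<open>v = c u - p * u + e * u1\<close> after
cancelling one integration. Young's inequality shows that the first two terms contribute
\<open>\<integral> u (c u - p * u) \<ge> 0\<close>, and the last is small with \<open>e\<close> since \<open>u\<close> is bounded. The assumption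
\<open>v = 1 * v1\<close> makes \<open>u\<close> a primitive.
\<close>

lemma integral_positive_lower:
  assumes k: "causal k" "\<And>t. 0 \<le> k t" "\<And>s t. 0 < s \<Longrightarrow> s \<le> t \<Longrightarrow> k t \<le> k s"
    and l: "causal l" and kl: "eq_below T (k \<star> l) (one T)" and v1: "causal v1"
  defines "u1 \<equiv> l \<star> v1" and "M \<equiv> (\<lambda>g. LINT t|lborel. \<bar>g t\<bar>)"
  shows "(LINT t|lborel. one T t * ((one T \<star> u1) t * (one T \<star> v1) t)) \<ge>
     - (M u1 * (M (\<lambda>t. (fdiff n \<star> k) t - k t) * M u1))"
proof -
  define \<delta> where "\<delta> = 1 / real (Suc n)"
  have d0: "\<delta> > 0" by (simp add: \<delta>_def)
  note ki = causalD(1)[OF k(1)]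
  have [measurable]: "k \<in> borel_measurable borel" using ki by auto
  \<comment> \<open>\<open>c\<close> is the value at 0 of the average of \<open>k\<close> over \<open>(t, t + \<delta>)\<close>, \<open>- p\<close> the derivative of this average.\<close>
  define c where "c = prim k \<delta> / \<delta>"
  define sk where "sk = (\<lambda>s. indicator {0<..} s * k (s + \<delta>))"
  define p where "p = (\<lambda>s. 1 / \<delta> * (k s - sk s))"
  define e where "e = (\<lambda>t. indicator {0<..} t * (k t - (fdiff n \<star> k) t))"
  define u where "u = one T \<star> u1"
  define v where "v = one T \<star> v1"
  have ski: "integrable lborel sk"
    unfolding sk_def using lborel_integrable_real_affine[OF ki, of 1 \<delta>]
    by (intro integrable_indicator_times) (auto simp: add.commute)
  have sk: "causal sk" by (intro causalI ski) (auto simp: sk_def)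
  have p: "causal p" unfolding p_def by (intro causal_intros k(1) sk)
  have e: "causal e" unfolding e_def
    by (intro causalI integrable_indicator_times Bochner_Integration.integrable_diff ki star_integrable fdiff_integrable) auto
  have u1: "causal u1" unfolding u1_def by (intro causal_intros l v1)
  have u: "causal u" unfolding u_def by (intro causal_intros u1)
  have v: "causal v" unfolding v_def by (intro causal_intros v1)
  have p0: "0 \<le> p s" for s
  proof (cases "s > 0")
    case True
    then show ?thesis using k(3)[of s "s + \<delta>"] d0 by (simp add: p_def sk_def)
  qed (use causalD(2)[OF p] in auto)
  have prim_p: "prim p t = c - (fdiff n \<star> k) t" if "t > 0" for t
  proof -
    have "prim p t = 1 / \<delta> * (prim k t - prim sk t)"
    proof -
      have "prim p t = (LINT \<tau>|lborel. 1 / \<delta> * (indicator {..<t} \<tau> * k \<tau> - indicator {..<t} \<tau> * sk \<tau>))"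
        unfolding prim_def p_def by (intro Bochner_Integration.integral_cong) (auto simp: algebra_simps)
      also have "\<dots> = 1 / \<delta> * (prim k t - prim sk t)"
        unfolding prim_def using ki ski by (subst integral_mult_right_zero, subst Bochner_Integration.integral_diff) (auto intro!: integrable_indicator_times)
      finally show ?thesis .
    qed
    also have "prim sk t = prim k (t + \<delta>) - prim k \<delta>"
      unfolding sk_def by (rule prim_shift_cut[OF k(1) d0 that])
    finally show ?thesis
      unfolding fdiff_star_eq[OF ki] c_def \<delta>_def by (simp add: field_simps)
  qed
  have int_p: "(LINT t|lborel. p t) \<le> c"
  proof -
    have "(LINT s|lborel. sk s) = (LINT s|lborel. indicator {\<delta><..} s * k s)"
      unfolding sk_def
      by (subst (2) lborel_integral_real_affine[where c=1 and t=\<delta>])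
         (auto intro!: Bochner_Integration.integral_cong split: split_indicator simp: add.commute)
    moreover have "(LINT s|lborel. indicator {\<delta><..} s * k s) + prim k \<delta> = (LINT s|lborel. k s)"
    proof -
      have "(LINT s|lborel. indicator {\<delta><..} s * k s) + prim k \<delta> = (LINT s|lborel. indicator {\<delta><..} s * k s + indicator {..<\<delta>} s * k s)"
        unfolding prim_def by (intro Bochner_Integration.integral_add[symmetric] integrable_indicator_times ki) auto
      also have "\<dots> = (LINT s|lborel. k s)"
      proof (rule integral_cong_AE)
        show "AE s in lborel. indicator {\<delta><..} s * k s + indicator {..<\<delta>} s * k s = k s"
          using AE_lborel_singleton[of \<delta>] by eventually_elim (auto split: split_indicator)
      qed auto
      finally show ?thesis .
    qed
    ultimately have "(LINT s|lborel. sk s) = (LINT s|lborel. k s) - prim k \<delta>" by linarith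
    moreover have "(LINT t|lborel. p t) = 1 / \<delta> * ((LINT s|lborel. k s) - (LINT s|lborel. sk s))"
      unfolding p_def using ki ski by simp
    ultimately show ?thesis by (simp add: c_def)
  qed
  \<comment> \<open>The average is \<open>fdiff n \<star> k\<close>, so that \<open>e\<close> is controlled by \<open>fdiff_conv_integrable\<close>.\<close>
  have dec: "eq_below T k (\<lambda>t. (c * one T t - (one T \<star> p) t) + e t)"
    unfolding eq_below_def
  proof (intro AE_I2 impI)
    fix t assume "t < T"
    show "k t = (c * one T t - (one T \<star> p) t) + e t"
    proof (cases "t > 0")
      case True
      then show ?thesis using \<open>t < T\<close> prim_p[OF True] one_star_eq_prim[OF p, of t T]
        by (simp add: one_def e_def)
    next
      case False
      then have "k t = 0" "one T t = 0" "e t = 0" "(one T \<star> p) t = 0"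
        using causalD(2)[OF k(1), of t] causalD(2)[OF causal_one, of t] causalD(2)[OF e, of t] causalD(2)[OF causal_star[OF causal_one p], of t] by auto
      then show ?thesis by simp
    qed
  qed
  note ca = causal_intros causal_one k(1) l v1 u1 u v p e
  define f where "f = (\<lambda>t. v t - ((c * u t - (p \<star> u) t) + (e \<star> u1) t))"
  have f: "causal f" unfolding f_def by (intro ca)
  have "eq_below T (one T \<star> f) (\<lambda>t. 0)"
  proof -
    have 1: "eq_below T (k \<star> u) (one T \<star> v)"
    proof -
      have "eq_below T (k \<star> u) (one T \<star> (k \<star> (l \<star> v1)))"
        unfolding u_def u1_def by (intro eq_below_left_commute ca)
      also have "eq_below T (one T \<star> (k \<star> (l \<star> v1))) (one T \<star> ((k \<star> l) \<star> v1))"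
        by (intro eq_below_star eq_below_refl eq_below_assoc ca)
      also have "eq_below T (one T \<star> ((k \<star> l) \<star> v1)) (one T \<star> v)"
        unfolding v_def by (intro eq_below_star eq_below_refl kl ca)
      finally show ?thesis .
    qed
    have 2: "eq_below T (k \<star> u) (\<lambda>t. (c * (one T \<star> u) t - (one T \<star> (p \<star> u)) t) + (one T \<star> (e \<star> u1)) t)"
    proof -
      have "eq_below T (k \<star> u) (u \<star> (\<lambda>t. (c * one T t - (one T \<star> p) t) + e t))"
        unfolding star_commute[of k] by (intro eq_below_star eq_below_refl dec ca)
      also have "eq_below T (u \<star> (\<lambda>t. (c * one T t - (one T \<star> p) t) + e t))
         (\<lambda>t. (u \<star> (\<lambda>t. c * one T t - (one T \<star> p) t)) t + (u \<star> e) t)"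
        by (intro eq_below_star_add ca)
      also have "eq_below T (\<lambda>t. (u \<star> (\<lambda>t. c * one T t - (one T \<star> p) t)) t + (u \<star> e) t)
         (\<lambda>t. ((u \<star> (\<lambda>t. c * one T t)) t - (u \<star> (one T \<star> p)) t) + (u \<star> e) t)"
        by (intro eq_below_add eq_below_refl eq_below_star_diff ca)
      also have "eq_below T (\<lambda>t. ((u \<star> (\<lambda>t. c * one T t)) t - (u \<star> (one T \<star> p)) t) + (u \<star> e) t)
         (\<lambda>t. (c * (one T \<star> u) t - (one T \<star> (p \<star> u)) t) + (one T \<star> (e \<star> u1)) t)"
      proof (intro eq_below_add eq_below_diff)
        show "eq_below T (u \<star> (\<lambda>t. c * one T t)) (\<lambda>t. c * (one T \<star> u) t)"
          by (simp only: eq_below_def star_scale_right star_commute[of u "one T"] simp_thms eventually_True)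
        show "eq_below T (u \<star> (one T \<star> p)) (one T \<star> (p \<star> u))"
          unfolding star_commute[of p u] by (intro eq_below_left_commute ca)
        show "eq_below T (u \<star> e) (one T \<star> (e \<star> u1))"
          unfolding star_commute[of u e] unfolding u_def by (intro eq_below_left_commute ca)
      qed
      finally show ?thesis .
    qed
    have "eq_below T (one T \<star> f) (\<lambda>t. (one T \<star> v) t - (one T \<star> (\<lambda>t. (c * u t - (p \<star> u) t) + (e \<star> u1) t)) t)"
      unfolding f_def by (intro eq_below_star_diff ca)
    moreover have "eq_below T (one T \<star> (\<lambda>t. (c * u t - (p \<star> u) t) + (e \<star> u1) t))
        (\<lambda>t. (one T \<star> (\<lambda>t. c * u t - (p \<star> u) t)) t + (one T \<star> (e \<star> u1)) t)"
      by (intro eq_below_star_add ca)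
    moreover have "eq_below T (one T \<star> (\<lambda>t. c * u t - (p \<star> u) t))
        (\<lambda>t. (one T \<star> (\<lambda>t. c * u t)) t - (one T \<star> (p \<star> u)) t)"
      by (intro eq_below_star_diff ca)
    ultimately show ?thesis using 1 2 unfolding eq_below_def
      by eventually_elim (auto simp: star_scale_right)
  qed
  then have f0: "eq_below T f (\<lambda>t. 0)" by (rule one_star_eq_zero_imp[OF f])
  \<comment> \<open>Young's inequality needs a bounded integrable function on the line, hence the truncation.\<close>
  define U where "U = (\<lambda>t. one T t * u t)"
  define B where "B = M u1"
  have uB: "\<bar>u t\<bar> \<le> B" if "t < T" for t
    using prim_bound[OF causalD(1)[OF u1], of t] one_star_eq_prim[OF u1, of t T] that
    by (simp add: u_def B_def M_def)
  have UB: "\<bar>U t\<bar> \<le> B" for t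
  proof (cases "t < T")
    case True then show ?thesis using uB[OF True] by (auto simp: U_def one_def split: split_indicator)
  next
    case False
    have "0 \<le> B" unfolding B_def M_def by (intro integral_nonneg_AE) auto
    with False show ?thesis by (auto simp: U_def one_def)
  qed
  have Ui: "integrable lborel U" unfolding U_def one_def
    by (intro integrable_indicator_times causalD[OF u]) auto
  have U: "causal U" by (intro causalI Ui) (auto simp: U_def causalD(2)[OF u])
  have Uu: "eq_below T U u" unfolding eq_below_def
    using causalD(2)[OF u] by (auto simp: U_def one_def not_less split: split_indicator intro!: AE_I2)
  have B0: "0 \<le> B" using UB[of 0] by linarith
  have eu: "integrable lborel (e \<star> u1)" by (intro star_integrable causalD[OF e] causalD[OF u1])
  have Ueu: "integrable lborel (\<lambda>t. U t * (e \<star> u1) t)"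
    by (rule Bochner_Integration.integrable_bound[where f="\<lambda>t. B * (e \<star> u1) t"])
       (use UB B0 eu Ui in \<open>auto simp: abs_mult intro!: mult_right_mono AE_I2\<close>)
  note sq = integral_square_star_le[OF causalD(1)[OF p] p0 Ui UB]
  have Mle: "(LINT t|lborel. \<bar>e t\<bar>) \<le> M (\<lambda>t. (fdiff n \<star> k) t - k t)"
    unfolding M_def
  proof (rule integral_mono)
    show "integrable lborel (\<lambda>t. \<bar>(fdiff n \<star> k) t - k t\<bar>)"
      using ki star_integrable[OF fdiff_integrable ki] by auto
  qed (use causalD(1)[OF e] in \<open>auto simp: e_def split: split_indicator\<close>)
  have "- (B * (M (\<lambda>t. (fdiff n \<star> k) t - k t) * B)) \<le> - (B * (LINT t|lborel. \<bar>(e \<star> u1) t\<bar>))"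
  proof -
    have "(LINT t|lborel. \<bar>(e \<star> u1) t\<bar>) \<le> (LINT t|lborel. \<bar>e t\<bar>) * B"
      unfolding B_def M_def by (intro integral_abs_star_le causalD[OF e] causalD[OF u1])
    also have "\<dots> \<le> M (\<lambda>t. (fdiff n \<star> k) t - k t) * B"
      by (rule mult_right_mono[OF Mle B0])
    finally show ?thesis using B0 by (simp add: mult_left_mono)
  qed
  also have "\<dots> = (LINT t|lborel. - (B * \<bar>(e \<star> u1) t\<bar>))" by simp
  also have "\<dots> \<le> (LINT t|lborel. U t * (e \<star> u1) t)"
  proof (rule integral_mono[OF _ Ueu])
    fix t
    have "\<bar>U t * (e \<star> u1) t\<bar> \<le> B * \<bar>(e \<star> u1) t\<bar>"
      unfolding abs_mult by (rule mult_right_mono[OF UB]) simp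
    then show "- (B * \<bar>(e \<star> u1) t\<bar>) \<le> U t * (e \<star> u1) t" by linarith
  qed (use eu in auto)
  also have "\<dots> \<le> (c * (LINT t|lborel. (U t)\<^sup>2) - (LINT t|lborel. U t * (p \<star> U) t)) + (LINT t|lborel. U t * (e \<star> u1) t)"
  proof -
    have "(LINT t|lborel. p t) * (LINT t|lborel. (U t)\<^sup>2) \<le> c * (LINT t|lborel. (U t)\<^sup>2)"
      by (rule mult_right_mono[OF int_p]) (auto intro: integral_nonneg_AE)
    then show ?thesis using sq(1) by linarith
  qed
  also have "\<dots> = (LINT t|lborel. (c * (U t)\<^sup>2 - U t * (p \<star> U) t) + U t * (e \<star> u1) t)"
    using sq(2,3) Ueu by simp
  also have "(LINT t|lborel. (c * (U t)\<^sup>2 - U t * (p \<star> U) t) + U t * (e \<star> u1) t) = (LINT t|lborel. one T t * (u t * v t))"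
  proof (rule integral_cong_AE)
    have "AE t in lborel. t < T \<longrightarrow> f t = 0" using f0 by (simp add: eq_below_def)
    then show "AE t in lborel. (c * (U t)\<^sup>2 - U t * (p \<star> U) t) + U t * (e \<star> u1) t = one T t * (u t * v t)"
    proof eventually_elim
      case (elim t)
      show ?case
      proof (cases "0 < t \<and> t < T")
        case True
        have 1: "(p \<star> U) t = (p \<star> u) t" using True by (intro star_cong_right[OF Uu U u p]) auto
        have 2: "v t = (c * u t - (p \<star> u) t) + (e \<star> u1) t" using elim True by (simp add: f_def)
        have 3: "U t = u t" "one T t = 1" using True by (auto simp: U_def one_def)
        show ?thesis unfolding 1 2 3 by (simp add: algebra_simps power2_eq_square)
      qed (auto simp: U_def one_def)
    qed
  qed (intro borel_measurable_times borel_measurable_add borel_measurable_diff borel_measurable_power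
       borel_measurable_const borel_measurable_integrable causalD(1) ca U)+
  finally show ?thesis unfolding u_def v_def B_def .
qed

text \<open>
The error \<open>e\<close> of the preceding decomposition of \<open>k\<close> is the difference between \<open>k\<close> and the difference
quotients of its primitive, so it tends to 0 in \<open>L\<^sub>1\<close>.
\<close>

lemma integral_positive:
  assumes k: "causal k" "\<And>t. 0 \<le> k t" "\<And>s t. 0 < s \<Longrightarrow> s \<le> t \<Longrightarrow> k t \<le> k s"
    and l: "causal l" and kl: "eq_below T (k \<star> l) (one T)" and v1: "causal v1"
  shows "(LINT t|lborel. one T t * ((one T \<star> (l \<star> v1)) t * (one T \<star> v1) t)) \<ge> 0"
proof (rule LIMSEQ_le_const2)
  let ?M = "LINT t|lborel. \<bar>(l \<star> v1) t\<bar>" and ?E = "\<lambda>n. LINT t|lborel. \<bar>(fdiff n \<star> k) t - k t\<bar>"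
  have "(\<lambda>n. - (?M * (?E n * ?M))) \<longlonglongrightarrow> - (?M * (0 * ?M))"
    using fdiff_conv_integrable[OF causalD(1)[OF k(1)]] unfolding fdiff_conv_def
    by (intro tendsto_intros)
  then show "(\<lambda>n. - (?M * (?E n * ?M))) \<longlonglongrightarrow> 0" by simp
  show "\<exists>N. \<forall>n\<ge>N. - (?M * (?E n * ?M)) \<le> (LINT t|lborel. one T t * ((one T \<star> (l \<star> v1)) t * (one T \<star> v1) t))"
    using integral_positive_lower[OF assms] by blast
qed

definition avg :: "nat \<Rightarrow> real \<Rightarrow> real" where
  "avg n s = real (Suc n) * indicator {0<..1 / real (Suc n)} s"

lemma causal_avg: "causal (avg n)"
  by (intro causalI) (auto simp: avg_def[abs_def] intro!: integrable_mult_right integrable_real_indicator simp del: of_nat_Suc)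

lemma avg_star_eq_fdiff: "(avg n \<star> f) t = (fdiff n \<star> f) (t - 1 / real (Suc n))"
proof -
  define \<delta> where "\<delta> = 1 / real (Suc n)"
  have "-1 / real (Suc n) = - \<delta>" by (simp add: \<delta>_def)
  then have "avg n (t - \<tau>) = fdiff n (t - 1 / real (Suc n) - \<tau>)" for \<tau>
    unfolding avg_def fdiff_def \<delta>_def[symmetric] by (auto split: split_indicator)
  then show ?thesis unfolding star_def by (simp only:)
qed

text \<open>
The average of \<open>v\<close> over \<open>(t - \<delta>, t)\<close> is the primitive of \<open>(v(t) - v(t - \<delta>)) / \<delta>\<close>, so it satisfies
the hypothesis of \<open>integral_positive\<close>.
\<close>

lemma integral_positive_avg:
  assumes k: "causal k" "\<And>t. 0 \<le> k t" "\<And>s t. 0 < s \<Longrightarrow> s \<le> t \<Longrightarrow> k t \<le> k s"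
    and l: "causal l" and kl: "eq_below T (k \<star> l) (one T)" and v: "causal v"
  shows "(LINT t|lborel. one T t * ((avg n \<star> v) t * (avg n \<star> (l \<star> v)) t)) \<ge> 0"
proof -
  define \<delta> where "\<delta> = 1 / real (Suc n)"
  have d0: "\<delta> > 0" by (simp add: \<delta>_def)
  \<comment> \<open>The derivative of the average of \<open>v\<close>.\<close>
  define v1 where "v1 = (\<lambda>t. real (Suc n) * (v t - v (t - \<delta>)))"
  have vi: "integrable lborel v" "integrable lborel (\<lambda>t. v (t - \<delta>))" 
    using causalD[OF v] lborel_integrable_real_affine[of v 1 "-\<delta>"] by auto
  have v1: "causal v1" unfolding v1_def
    using vi causalD(2)[OF v] d0 by (intro causalI) auto
  have pe: "eq_below T (one T \<star> v1) (avg n \<star> v)"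
    unfolding eq_below_def
  proof (intro AE_I2 impI)
    fix t assume "t < T"
    have "(one T \<star> v1) t = prim v1 t" using \<open>t < T\<close> by (intro one_star_eq_prim v1) auto
    also have "\<dots> = (LINT s|lborel. real (Suc n) * (indicator {..<t} s * v s - indicator {..<t} s * v (s - \<delta>)))"
      unfolding prim_def v1_def by (intro Bochner_Integration.integral_cong) (auto simp: algebra_simps)
    also have "\<dots> = real (Suc n) * (prim v t - (LINT s|lborel. indicator {..<t} s * v (s - \<delta>)))"
      unfolding prim_def using vi
      by (subst integral_mult_right_zero, subst Bochner_Integration.integral_diff) (auto intro!: integrable_indicator_times)
    also have "(LINT s|lborel. indicator {..<t} s * v (s - \<delta>)) = prim v (t - \<delta>)"
      unfolding prim_def
      by (subst lborel_integral_real_affine[where c=1 and t=\<delta>])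
         (auto intro!: Bochner_Integration.integral_cong split: split_indicator)
    finally show "(one T \<star> v1) t = (avg n \<star> v) t"
      unfolding avg_star_eq_fdiff fdiff_star_eq[OF vi(1)] \<delta>_def by simp
  qed
  note ca = causal_intros k(1) l v v1 causal_avg
  have pl: "eq_below T (one T \<star> (l \<star> v1)) (avg n \<star> (l \<star> v))"
  proof -
    have "eq_below T (one T \<star> (l \<star> v1)) (l \<star> (one T \<star> v1))" by (intro eq_below_left_commute ca)
    also have "eq_below T (l \<star> (one T \<star> v1)) (l \<star> (avg n \<star> v))"
      by (intro eq_below_star eq_below_refl pe ca)
    also have "eq_below T (l \<star> (avg n \<star> v)) (avg n \<star> (l \<star> v))" by (intro eq_below_left_commute ca)
    finally show ?thesis .
  qed
  have "(LINT t|lborel. one T t * ((one T \<star> (l \<star> v1)) t * (one T \<star> v1) t)) =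
     (LINT t|lborel. one T t * ((avg n \<star> v) t * (avg n \<star> (l \<star> v)) t))"
  proof (rule integral_cong_AE)
    show "AE t in lborel. one T t * ((one T \<star> (l \<star> v1)) t * (one T \<star> v1) t) =
       one T t * ((avg n \<star> v) t * (avg n \<star> (l \<star> v)) t)"
      using pe pl unfolding eq_below_def by eventually_elim (auto simp: one_def split: split_indicator)
  qed (intro borel_measurable_times borel_measurable_integrable causalD(1) ca)+
  then show ?thesis using integral_positive[OF k l kl v1] by simp
qed

section \<open>Functions of time and space\<close>

lemma conv_eq_star:
  assumes "t \<le> T"
  shows "conv k v t = ((\<lambda>s. one T s * k s) \<star> (\<lambda>s. one T s * v s)) t"
proof -
  have "indicator {0<..<t} \<tau> *\<^sub>R (k (t - \<tau>) * v \<tau>) = (one T (t - \<tau>) * k (t - \<tau>)) * (one T \<tau> * v \<tau>)" for \<tau>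
    using assms by (auto simp: one_def split: split_indicator)
  then show ?thesis unfolding conv_def star_def set_lebesgue_integral_def by (simp only:)
qed

abbreviation time_conv :: "(real \<Rightarrow> real) \<Rightarrow> (real \<Rightarrow> 'a \<Rightarrow> real) \<Rightarrow> real \<Rightarrow> 'a \<Rightarrow> real" (infixl "\<diamond>" 70) where
  "(h \<diamond> f) t x \<equiv> (h \<star> (\<lambda>\<tau>. f \<tau> x)) t"

context finite_measure begin

interpretation P: pair_sigma_finite "lborel :: real measure" M by unfold_locales

text \<open>
The class \<open>L\<^sub>2(M; L\<^sub>1(\<real>))\<close> of functions that vanish for \<open>t \<le> 0\<close>. It contains the square
integrable functions on a bounded time interval, and requiring only \<open>L\<^sub>1\<close> in time makes it trivially stable
under convolution in time with \<open>L\<^sub>1\<close> kernels, while products of two such functions at independent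
times \<open>s\<close> and \<open>t\<close> are integrable over \<open>(s, t, x)\<close>.
\<close>

definition mixed :: "(real \<Rightarrow> 'a \<Rightarrow> real) \<Rightarrow> bool" where
  "mixed f \<longleftrightarrow> (\<lambda>(t, x). f t x) \<in> borel_measurable (lborel \<Otimes>\<^sub>M M) \<and>
     (\<forall>t\<le>0. \<forall>x. f t x = 0) \<and> (\<integral>\<^sup>+x. (\<integral>\<^sup>+t. ennreal \<bar>f t x\<bar> \<partial>lborel)\<^sup>2 \<partial>M) < \<infinity>"

definition L2 :: "('a \<Rightarrow> real) \<Rightarrow> bool" where
  "L2 \<psi> \<longleftrightarrow> \<psi> \<in> borel_measurable M \<and> (\<integral>\<^sup>+x. (ennreal \<bar>\<psi> x\<bar>)\<^sup>2 \<partial>M) < \<infinity>"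

lemma mixed_measurable: "mixed f \<Longrightarrow> (\<lambda>(t, x). f t x) \<in> borel_measurable (lborel \<Otimes>\<^sub>M M)"
  by (simp add: mixed_def)

lemma mixed_measurable_comp:
  assumes "mixed f" and [measurable]: "a \<in> N \<rightarrow>\<^sub>M lborel" "b \<in> N \<rightarrow>\<^sub>M M"
  shows "(\<lambda>y. f (a y) (b y)) \<in> borel_measurable N"
proof -
  note [measurable] = mixed_measurable[OF assms(1)]
  have "(\<lambda>y. (case (a y, b y) of (t, x) \<Rightarrow> f t x)) \<in> borel_measurable N" by measurable
  then show ?thesis by simp
qed

lemma mixed_causal: "mixed f \<Longrightarrow> t \<le> 0 \<Longrightarrow> f t x = 0"
  by (simp add: mixed_def)

lemma mixed_finite: "mixed f \<Longrightarrow> (\<integral>\<^sup>+x. (\<integral>\<^sup>+t. ennreal \<bar>f t x\<bar> \<partial>lborel)\<^sup>2 \<partial>M) < \<infinity>"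
  by (simp add: mixed_def)

lemma ennreal_mult_le_squares: "(a::ennreal) * b \<le> a\<^sup>2 + b\<^sup>2"
proof (cases "a \<le> b")
  case True
  then have "a * b \<le> b * b" by (intro mult_right_mono) auto
  then show ?thesis by (simp add: power2_eq_square add_increasing)
next
  case False
  then have "a * b \<le> a * a" by (intro mult_left_mono) auto
  then show ?thesis by (simp add: power2_eq_square add_increasing2)
qed

lemma mixed_AE_causal:
  assumes f: "mixed f" shows "AE x in M. causal (\<lambda>t. f t x)"
proof -
  note [measurable] = mixed_measurable[OF f]
  have "AE x in M. (\<integral>\<^sup>+t. ennreal \<bar>f t x\<bar> \<partial>lborel)\<^sup>2 \<noteq> \<infinity>"
    using mixed_finite[OF f] by (intro nn_integral_noteq_infinite) auto
  then show ?thesis using AE_space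
  proof eventually_elim
    case (elim x)
    note [measurable] = elim(2)
    have "(\<lambda>t. f t x) \<in> borel_measurable lborel" by measurable
    moreover have "(\<integral>\<^sup>+t. ennreal \<bar>f t x\<bar> \<partial>lborel) < \<infinity>"
      using elim(1) by (auto simp: power2_eq_square less_top ennreal_mult_eq_top_iff)
    ultimately show ?case using mixed_causal[OF f]
      by (intro causalI) (auto simp: integrable_iff_bounded)
  qed
qed

lemma nn_integral_mult_finite:
  assumes [measurable]: "F \<in> borel_measurable M" "G \<in> borel_measurable M"
    and "(\<integral>\<^sup>+x. (F x)\<^sup>2 \<partial>M) < \<infinity>" "(\<integral>\<^sup>+x. (G x)\<^sup>2 \<partial>M) < \<infinity>"
  shows "(\<integral>\<^sup>+x. F x * G x \<partial>M) < (\<infinity>::ennreal)"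
proof -
  have "(\<integral>\<^sup>+x. F x * G x \<partial>M) \<le> (\<integral>\<^sup>+x. (F x)\<^sup>2 + (G x)\<^sup>2 \<partial>M)"
    by (intro nn_integral_mono ennreal_mult_le_squares)
  also have "\<dots> = (\<integral>\<^sup>+x. (F x)\<^sup>2 \<partial>M) + (\<integral>\<^sup>+x. (G x)\<^sup>2 \<partial>M)" by (intro nn_integral_add) auto
  also have "\<dots> < \<infinity>" using assms(3,4) by simp
  finally show ?thesis .
qed

lemma mixed_mult_finite:
  assumes f: "mixed f" and g: "mixed g"
  shows "(\<integral>\<^sup>+x. (\<integral>\<^sup>+t. ennreal \<bar>f t x\<bar> \<partial>lborel) * (\<integral>\<^sup>+t. ennreal \<bar>g t x\<bar> \<partial>lborel) \<partial>M) < \<infinity>"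
proof (intro nn_integral_mult_finite mixed_finite f g)
  note [measurable] = mixed_measurable[OF f] mixed_measurable[OF g]
  show "(\<lambda>x. \<integral>\<^sup>+t. ennreal \<bar>f t x\<bar> \<partial>lborel) \<in> borel_measurable M"
    "(\<lambda>x. \<integral>\<^sup>+t. ennreal \<bar>g t x\<bar> \<partial>lborel) \<in> borel_measurable M" by measurable
qed

lemma power2_add_le_ennreal: "((a::ennreal) + b)\<^sup>2 \<le> 4 * (a\<^sup>2 + b\<^sup>2)"
proof -
  have "(a + b)\<^sup>2 = a\<^sup>2 + b\<^sup>2 + (a * b + a * b)"
    by (simp add: power2_eq_square algebra_simps)
  also have "\<dots> \<le> a\<^sup>2 + b\<^sup>2 + ((a\<^sup>2 + b\<^sup>2) + (a\<^sup>2 + b\<^sup>2))"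
    by (intro add_mono order_refl ennreal_mult_le_squares)
  also have "\<dots> \<le> a\<^sup>2 + b\<^sup>2 + ((a\<^sup>2 + b\<^sup>2) + (a\<^sup>2 + b\<^sup>2)) + (a\<^sup>2 + b\<^sup>2)" by simp
  also have "\<dots> = 4 * (a\<^sup>2 + b\<^sup>2)"
  proof -
    have "(4::ennreal) = 1 + 1 + 1 + 1" by simp
    then show ?thesis by (simp only: distrib_right mult_1_left add.assoc)
  qed
  finally show ?thesis .
qed

lemma mixedI_bound:
  assumes [measurable]: "(\<lambda>(t, x). f t x) \<in> borel_measurable (lborel \<Otimes>\<^sub>M M)" and "\<And>t x. t \<le> 0 \<Longrightarrow> f t x = 0"
    and G [measurable]: "G \<in> borel_measurable M" and "(\<integral>\<^sup>+x. (G x)\<^sup>2 \<partial>M) < \<infinity>"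
    and "AE x in M. (\<integral>\<^sup>+t. ennreal \<bar>f t x\<bar> \<partial>lborel) \<le> G x"
  shows "mixed f"
  unfolding mixed_def
proof (intro conjI allI impI)
  have "(\<integral>\<^sup>+x. (\<integral>\<^sup>+t. ennreal \<bar>f t x\<bar> \<partial>lborel)\<^sup>2 \<partial>M) \<le> (\<integral>\<^sup>+x. (G x)\<^sup>2 \<partial>M)"
    using assms(5) by (intro nn_integral_mono_AE) (auto elim!: eventually_mono intro: power_mono)
  also note assms(4)
  finally show "(\<integral>\<^sup>+x. (\<integral>\<^sup>+t. ennreal \<bar>f t x\<bar> \<partial>lborel)\<^sup>2 \<partial>M) < \<infinity>" .
qed (use assms in auto)

lemma mixed_add:
  assumes f: "mixed f" and g: "mixed g"
  shows "mixed (\<lambda>t x. f t x + g t x)"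
proof (rule mixedI_bound)
  note [measurable] = mixed_measurable[OF f] mixed_measurable[OF g]
  let ?F = "\<lambda>x. \<integral>\<^sup>+t. ennreal \<bar>f t x\<bar> \<partial>lborel" and ?G = "\<lambda>x. \<integral>\<^sup>+t. ennreal \<bar>g t x\<bar> \<partial>lborel"
  show "(\<lambda>(t, x). f t x + g t x) \<in> borel_measurable (lborel \<Otimes>\<^sub>M M)" by measurable
  show [measurable]: "(\<lambda>x. ?F x + ?G x) \<in> borel_measurable M" by measurable
  have "(\<integral>\<^sup>+x. (?F x + ?G x)\<^sup>2 \<partial>M) \<le> (\<integral>\<^sup>+x. 4 * ((?F x)\<^sup>2 + (?G x)\<^sup>2) \<partial>M)"
    by (intro nn_integral_mono power2_add_le_ennreal)
  also have "\<dots> = 4 * ((\<integral>\<^sup>+x. (?F x)\<^sup>2 \<partial>M) + (\<integral>\<^sup>+x. (?G x)\<^sup>2 \<partial>M))"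
    by (subst nn_integral_cmult, measurable, subst nn_integral_add) auto
  also have "\<dots> < \<infinity>" using mixed_finite[OF f] mixed_finite[OF g] by (simp add: ennreal_mult_less_top)
  finally show "(\<integral>\<^sup>+x. (?F x + ?G x)\<^sup>2 \<partial>M) < \<infinity>" .
  show "AE x in M. (\<integral>\<^sup>+t. ennreal \<bar>f t x + g t x\<bar> \<partial>lborel) \<le> ?F x + ?G x"
  proof (rule AE_I2)
    fix x assume [measurable]: "x \<in> space M"
    have "(\<integral>\<^sup>+t. ennreal \<bar>f t x + g t x\<bar> \<partial>lborel) \<le> (\<integral>\<^sup>+t. ennreal \<bar>f t x\<bar> + ennreal \<bar>g t x\<bar> \<partial>lborel)"
      by (intro nn_integral_mono) (auto simp flip: ennreal_plus intro!: ennreal_leI abs_triangle_ineq)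
    also have "\<dots> = ?F x + ?G x" by (rule nn_integral_add) auto
    finally show "(\<integral>\<^sup>+t. ennreal \<bar>f t x + g t x\<bar> \<partial>lborel) \<le> ?F x + ?G x" .
  qed
qed (use mixed_causal[OF f] mixed_causal[OF g] in auto)

lemma mixed_mult_bounded:
  assumes f: "mixed f" and [measurable]: "b \<in> borel_measurable borel" and B: "\<And>t. \<bar>b t\<bar> \<le> B"
  shows "mixed (\<lambda>t x. b t * f t x)"
proof (rule mixedI_bound)
  note [measurable] = mixed_measurable[OF f]
  let ?F = "\<lambda>x. \<integral>\<^sup>+t. ennreal \<bar>f t x\<bar> \<partial>lborel"
  have B0: "0 \<le> B" using B[of 0] by linarith
  show "(\<lambda>(t, x). b t * f t x) \<in> borel_measurable (lborel \<Otimes>\<^sub>M M)" by measurable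
  show "(\<lambda>x. ennreal B * ?F x) \<in> borel_measurable M" by measurable
  have "(\<integral>\<^sup>+x. (ennreal B * ?F x)\<^sup>2 \<partial>M) = (ennreal B)\<^sup>2 * (\<integral>\<^sup>+x. (?F x)\<^sup>2 \<partial>M)"
    by (subst nn_integral_cmult[symmetric]) (auto simp: power_mult_distrib)
  also have "\<dots> < \<infinity>" using mixed_finite[OF f] by (simp add: ennreal_mult_less_top power2_eq_square)
  finally show "(\<integral>\<^sup>+x. (ennreal B * ?F x)\<^sup>2 \<partial>M) < \<infinity>" .
  show "AE x in M. (\<integral>\<^sup>+t. ennreal \<bar>b t * f t x\<bar> \<partial>lborel) \<le> ennreal B * ?F x"
  proof (rule AE_I2)
    fix x assume [measurable]: "x \<in> space M"
    have "(\<integral>\<^sup>+t. ennreal \<bar>b t * f t x\<bar> \<partial>lborel) \<le> (\<integral>\<^sup>+t. ennreal B * ennreal \<bar>f t x\<bar> \<partial>lborel)"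
      using B B0 by (intro nn_integral_mono) (auto simp: abs_mult simp flip: ennreal_mult intro!: ennreal_leI mult_right_mono)
    also have "\<dots> = ennreal B * ?F x" by (rule nn_integral_cmult) auto
    finally show "(\<integral>\<^sup>+t. ennreal \<bar>b t * f t x\<bar> \<partial>lborel) \<le> ennreal B * ?F x" .
  qed
qed (use mixed_causal[OF f] in auto)

lemma mixed_scale: "mixed f \<Longrightarrow> mixed (\<lambda>t x. c * f t x)"
  by (rule mixed_mult_bounded[where B="\<bar>c\<bar>"]) auto

lemma mixed_diff: "mixed f \<Longrightarrow> mixed g \<Longrightarrow> mixed (\<lambda>t x. f t x - g t x)"
  using mixed_add[of f "\<lambda>t x. - 1 * g t x"] mixed_scale[of g "-1"] by simp

lemma mixed_zero: "mixed (\<lambda>t x. 0)"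
  by (auto simp: mixed_def)

lemma mixed_sum: "finite I \<Longrightarrow> (\<And>i. i \<in> I \<Longrightarrow> mixed (f i)) \<Longrightarrow> mixed (\<lambda>t x. \<Sum>i\<in>I. f i t x)"
  by (induction I rule: finite_induct) (auto simp: mixed_zero intro: mixed_add)

lemma mixed_star:
  assumes h: "causal h" and f: "mixed f"
  shows "mixed (\<lambda>t x. (h \<diamond> f) t x)"
proof (rule mixedI_bound)
  note [measurable] = mixed_measurable[OF f] causalD(3)[OF h]
  let ?F = "\<lambda>x. \<integral>\<^sup>+t. ennreal \<bar>f t x\<bar> \<partial>lborel" and ?H = "\<integral>\<^sup>+t. ennreal \<bar>h t\<bar> \<partial>lborel"
  show "(\<lambda>(t, x). (h \<diamond> f) t x) \<in> borel_measurable (lborel \<Otimes>\<^sub>M M)" by (rule measurable_star_pair) measurable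
  show "(\<lambda>x. ?H * ?F x) \<in> borel_measurable M" by measurable
  have "(\<integral>\<^sup>+x. (?H * ?F x)\<^sup>2 \<partial>M) = ?H\<^sup>2 * (\<integral>\<^sup>+x. (?F x)\<^sup>2 \<partial>M)"
    by (subst nn_integral_cmult[symmetric]) (auto simp: power_mult_distrib)
  also have "\<dots> < \<infinity>" using mixed_finite[OF f] causalD(1)[OF h]
    by (simp add: ennreal_mult_less_top power2_eq_square integrable_iff_bounded)
  finally show "(\<integral>\<^sup>+x. (?H * ?F x)\<^sup>2 \<partial>M) < \<infinity>" .
  show "AE x in M. (\<integral>\<^sup>+t. ennreal \<bar>(h \<diamond> f) t x\<bar> \<partial>lborel) \<le> ?H * ?F x"
  proof (rule AE_I2)
    fix x assume [measurable]: "x \<in> space M"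
    show "(\<integral>\<^sup>+t. ennreal \<bar>(h \<diamond> f) t x\<bar> \<partial>lborel) \<le> ?H * ?F x"
      by (rule nn_integral_star_le) auto
  qed
  show "(h \<diamond> f) t x = 0" if "t \<le> 0" for t x
    using mixed_causal[OF f] causalD(2)[OF h] that by (intro star_causal) auto
qed

lemma mixed_integrable_L2:
  assumes f: "mixed f" and \<psi>: "L2 \<psi>"
  shows "integrable (lborel \<Otimes>\<^sub>M M) (\<lambda>(t, x). f t x * \<psi> x)"
proof (rule integrableI_bounded)
  note [measurable] = mixed_measurable[OF f]
  have [measurable]: "\<psi> \<in> borel_measurable M" using \<psi> by (simp add: L2_def)
  show "(\<lambda>(t, x). f t x * \<psi> x) \<in> borel_measurable (lborel \<Otimes>\<^sub>M M)" by measurable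
  have "(\<integral>\<^sup>+p. ennreal (norm (case p of (t, x) \<Rightarrow> f t x * \<psi> x)) \<partial>(lborel \<Otimes>\<^sub>M M)) =
    (\<integral>\<^sup>+x. (\<integral>\<^sup>+t. ennreal \<bar>f t x\<bar> * ennreal \<bar>\<psi> x\<bar> \<partial>lborel) \<partial>M)"
    by (subst P.nn_integral_snd[symmetric]) (auto simp: abs_mult ennreal_mult case_prod_unfold)
  also have "\<dots> = (\<integral>\<^sup>+x. (\<integral>\<^sup>+t. ennreal \<bar>f t x\<bar> \<partial>lborel) * ennreal \<bar>\<psi> x\<bar> \<partial>M)"
    by (intro nn_integral_cong nn_integral_multc) auto
  also have "\<dots> < \<infinity>" using mixed_finite[OF f] \<psi>
    by (intro nn_integral_mult_finite) (auto simp: L2_def)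
  finally show "(\<integral>\<^sup>+p. ennreal (norm (case p of (t, x) \<Rightarrow> f t x * \<psi> x)) \<partial>(lborel \<Otimes>\<^sub>M M)) < \<infinity>" .
qed

definition pairing :: "('a \<Rightarrow> real) \<Rightarrow> (real \<Rightarrow> 'a \<Rightarrow> real) \<Rightarrow> real \<Rightarrow> real" where
  "pairing \<psi> f t = (LINT x|M. f t x * \<psi> x)"

lemma
  assumes f: "mixed f" and \<psi>: "L2 \<psi>"
  shows pairing_causal: "causal (pairing \<psi> f)"
    and pairing_AE_integrable: "AE t in lborel. integrable M (\<lambda>x. f t x * \<psi> x)"
  using P.integrable_fst[OF mixed_integrable_L2[OF assms]] P.AE_integrable_fst[OF mixed_integrable_L2[OF assms]]
  by (auto intro!: causalI simp: pairing_def[abs_def] mixed_causal[OF f])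

lemma pairing_star:
  assumes h: "causal h" and f: "mixed f" and \<psi>: "L2 \<psi>"
  shows "AE t in lborel. pairing \<psi> (\<lambda>t x. (h \<diamond> f) t x) t = (h \<star> pairing \<psi> f) t"
  using star_integral_swap[OF sigma_finite_measure_axioms causalD(1)[OF h] mixed_integrable_L2[OF f \<psi>]]
proof eventually_elim
  case (elim t)
  have "(h \<star> (\<lambda>\<tau>. f \<tau> y * \<psi> y)) t = (h \<star> (\<lambda>\<tau>. f \<tau> y)) t * \<psi> y" for y
    using star_scale_right[of h "\<psi> y" "\<lambda>\<tau>. f \<tau> y" t] by (simp add: mult.commute)
  moreover have "pairing \<psi> f = (\<lambda>\<tau>. LINT y|M. f \<tau> y * \<psi> y)" by (auto simp: pairing_def)
  ultimately show ?case using elim by (simp add: pairing_def)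
qed

lemma
  assumes f: "mixed f" and g: "mixed g"
  shows mixed_prod_AE_integrable: "AE s in lborel. AE t in lborel. integrable M (\<lambda>x. f s x * g t x)"
    and mixed_prod_integrable: "integrable (lborel \<Otimes>\<^sub>M lborel) (\<lambda>(s, t). LINT x|M. f s x * g t x)"
    and mixed_prod_integral: "integral\<^sup>L (lborel \<Otimes>\<^sub>M lborel) (\<lambda>(s, t). LINT x|M. f s x * g t x) =
        (LINT x|M. (LINT t|lborel. f t x) * (LINT t|lborel. g t x))"
proof -
  note [measurable] = mixed_measurable_comp[OF f] mixed_measurable_comp[OF g]
  interpret Q: sigma_finite_measure "lborel \<Otimes>\<^sub>M lborel :: (real \<times> real) measure" by (rule lborel_pair.sigma_finite_measure_axioms)
  interpret PQ: pair_sigma_finite "lborel \<Otimes>\<^sub>M lborel :: (real \<times> real) measure" M ..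
  have [measurable]: "(\<lambda>(p, x). f (fst p) x * g (snd p) x) \<in> borel_measurable ((lborel \<Otimes>\<^sub>M lborel) \<Otimes>\<^sub>M M)"
    by measurable
  have nn: "(\<integral>\<^sup>+p. ennreal \<bar>f (fst p) x * g (snd p) x\<bar> \<partial>(lborel \<Otimes>\<^sub>M lborel)) =
     (\<integral>\<^sup>+t. ennreal \<bar>f t x\<bar> \<partial>lborel) * (\<integral>\<^sup>+t. ennreal \<bar>g t x\<bar> \<partial>lborel)" if [measurable]: "x \<in> space M" for x
  proof -
    have [measurable]: "(\<lambda>t. f t x) \<in> borel_measurable borel" "(\<lambda>t. g t x) \<in> borel_measurable borel"
      by measurable
    have "(\<integral>\<^sup>+p. ennreal \<bar>f (fst p) x * g (snd p) x\<bar> \<partial>(lborel \<Otimes>\<^sub>M lborel)) =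
       (\<integral>\<^sup>+s. (\<integral>\<^sup>+t. ennreal \<bar>f s x\<bar> * ennreal \<bar>g t x\<bar> \<partial>lborel) \<partial>lborel)"
      by (subst lborel.nn_integral_fst[symmetric]) (auto simp: abs_mult ennreal_mult)
    then show ?thesis by (simp add: nn_integral_cmult nn_integral_multc)
  qed
  have int: "integrable ((lborel \<Otimes>\<^sub>M lborel) \<Otimes>\<^sub>M M) (\<lambda>(p, x). f (fst p) x * g (snd p) x)"
  proof (rule integrableI_bounded)
    have "(\<integral>\<^sup>+p. ennreal (norm (case p of (q, x) \<Rightarrow> f (fst q) x * g (snd q) x)) \<partial>((lborel \<Otimes>\<^sub>M lborel) \<Otimes>\<^sub>M M)) =
      (\<integral>\<^sup>+x. (\<integral>\<^sup>+t. ennreal \<bar>f t x\<bar> \<partial>lborel) * (\<integral>\<^sup>+t. ennreal \<bar>g t x\<bar> \<partial>lborel) \<partial>M)"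
      by (subst PQ.nn_integral_snd[symmetric]) (auto intro!: nn_integral_cong simp: nn case_prod_unfold)
    also have "\<dots> < \<infinity>" by (rule mixed_mult_finite[OF f g])
    finally show "(\<integral>\<^sup>+p. ennreal (norm (case p of (q, x) \<Rightarrow> f (fst q) x * g (snd q) x)) \<partial>((lborel \<Otimes>\<^sub>M lborel) \<Otimes>\<^sub>M M)) < \<infinity>" .
  qed measurable
  have int': "integrable ((lborel \<Otimes>\<^sub>M lborel) \<Otimes>\<^sub>M M) (case_prod (\<lambda>p x. f (fst p) x * g (snd p) x))"
    using int .
  show "AE s in lborel. AE t in lborel. integrable M (\<lambda>x. f s x * g t x)"
    using lborel_pair.AE_pair[OF PQ.AE_integrable_fst[OF int']] by simp
  show "integrable (lborel \<Otimes>\<^sub>M lborel) (\<lambda>(s, t). LINT x|M. f s x * g t x)"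
    using PQ.integrable_fst[OF int'] by (simp add: case_prod_unfold)
  have eq: "AE x in M. (LINT p|(lborel \<Otimes>\<^sub>M lborel). f (fst p) x * g (snd p) x) = (LINT t|lborel. f t x) * (LINT t|lborel. g t x)"
    using PQ.AE_integrable_snd[OF int']
  proof eventually_elim
    case (elim x)
    have "(LINT p|(lborel \<Otimes>\<^sub>M lborel). f (fst p) x * g (snd p) x) = (LINT s|lborel. LINT t|lborel. f s x * g t x)"
      using lborel_pair.integral_fst'[OF elim] by simp
    then show ?case by simp
  qed
  show "integral\<^sup>L (lborel \<Otimes>\<^sub>M lborel) (\<lambda>(s, t). LINT x|M. f s x * g t x) =
        (LINT x|M. (LINT t|lborel. f t x) * (LINT t|lborel. g t x))"
  proof -
    have "integral\<^sup>L (lborel \<Otimes>\<^sub>M lborel) (\<lambda>(s, t). LINT x|M. f s x * g t x) =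
       (LINT x|M. LINT p|(lborel \<Otimes>\<^sub>M lborel). f (fst p) x * g (snd p) x)"
      using PQ.Fubini_integral[OF int'] by (simp add: case_prod_unfold)
    also have "\<dots> = (LINT x|M. (LINT t|lborel. f t x) * (LINT t|lborel. g t x))"
      by (rule integral_cong_AE) (use eq in auto)
    finally show ?thesis .
  qed
qed

end

section \<open>Averaging in time and the energy inequality\<close>

text \<open>
Convolution with a bounded kernel converges at every point, so that averages can be evaluated at
each single time.
\<close>

lemma bounded_reflect_mult_integrable:
  fixes b f :: "real \<Rightarrow> real"
  assumes b: "b \<in> borel_measurable borel" "\<And>s. \<bar>b s\<bar> \<le> B" and f: "integrable lborel f"
  shows "integrable lborel (\<lambda>\<tau>. b (t - \<tau>) * f \<tau>)"
proof (rule Bochner_Integration.integrable_bound[where f="\<lambda>\<tau>. B * f \<tau>"])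
  note [measurable] = b(1)
  have [measurable]: "f \<in> borel_measurable borel" using f by auto
  have "0 \<le> B" using b(2)[of 0] by linarith
  then show "AE \<tau> in lborel. norm (b (t - \<tau>) * f \<tau>) \<le> norm (B * f \<tau>)"
    using b(2) by (auto simp: abs_mult intro!: AE_I2 mult_right_mono)
  show "(\<lambda>\<tau>. b (t - \<tau>) * f \<tau>) \<in> borel_measurable lborel" by measurable
qed (use f in auto)

lemma integral_add_sum:
  fixes f :: "'b \<Rightarrow> real"
  assumes "integrable M f" "\<And>j. j \<in> J \<Longrightarrow> integrable M (g j)"
  shows "(LINT x|M. f x) + (\<Sum>j\<in>J. LINT x|M. g j x) = (LINT x|M. f x + (\<Sum>j\<in>J. g j x))"
  using assms by (subst Bochner_Integration.integral_add) (auto simp: Bochner_Integration.integral_sum)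

lemma avg_measurable: "avg n \<in> borel_measurable borel"
  using causalD(3)[OF causal_avg] .

lemma avg_bound: "\<bar>avg n s\<bar> \<le> real (Suc n)"
  by (auto simp: avg_def split: split_indicator)

lemma avg_nonneg: "0 \<le> avg n s"
  by (simp add: avg_def)

lemma nn_integral_avg: "(\<integral>\<^sup>+s. ennreal \<bar>avg n s\<bar> \<partial>lborel) = 1"
proof -
  have "(\<integral>\<^sup>+s. ennreal \<bar>avg n s\<bar> \<partial>lborel) = (\<integral>\<^sup>+s. ennreal (real (Suc n)) * indicator {0<..1 / real (Suc n)} s \<partial>lborel)"
    by (intro nn_integral_cong) (auto simp: avg_def split: split_indicator)
  also have "\<dots> = ennreal (real (Suc n)) * ennreal (1 / real (Suc n))"
    by (subst nn_integral_cmult_indicator) auto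
  also have "\<dots> = ennreal (real (Suc n) * (1 / real (Suc n)))" by (rule ennreal_mult[symmetric]) auto
  also have "\<dots> = 1" by simp
  finally show ?thesis .
qed

lemma avg_integral: "integrable lborel (avg n)" "(LINT s|lborel. avg n s) = 1"
proof -
  show i: "integrable lborel (avg n)" using causalD(1)[OF causal_avg] .
  have "ennreal (LINT s|lborel. avg n s) = (\<integral>\<^sup>+s. ennreal (avg n s) \<partial>lborel)"
    by (rule nn_integral_eq_integral[symmetric, OF i]) (auto simp: avg_nonneg)
  also have "\<dots> = 1" using nn_integral_avg[of n] by (simp add: avg_nonneg)
  finally show "(LINT s|lborel. avg n s) = 1" by simp
qed

lemma avg_star_bound: "integrable lborel f \<Longrightarrow> \<bar>(avg n \<star> f) t\<bar> \<le> real (Suc n) * (LINT \<tau>|lborel. \<bar>f \<tau>\<bar>)"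
proof -
  assume f: "integrable lborel f"
  have "\<bar>(avg n \<star> f) t\<bar> \<le> (LINT \<tau>|lborel. \<bar>avg n (t - \<tau>) * f \<tau>\<bar>)"
    unfolding star_def using integral_norm_bound[of lborel "\<lambda>\<tau>. avg n (t - \<tau>) * f \<tau>"] by simp
  also have "\<dots> \<le> (LINT \<tau>|lborel. real (Suc n) * \<bar>f \<tau>\<bar>)"
  proof (rule integral_mono)
    show "integrable lborel (\<lambda>\<tau>. \<bar>avg n (t - \<tau>) * f \<tau>\<bar>)"
      by (intro integrable_abs bounded_reflect_mult_integrable[OF avg_measurable avg_bound f])
    show "\<bar>avg n (t - \<tau>) * f \<tau>\<bar> \<le> real (Suc n) * \<bar>f \<tau>\<bar>" for \<tau>
      unfolding abs_mult by (intro mult_right_mono avg_bound) auto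
  qed (use f in auto)
  finally show ?thesis by simp
qed

lemma avg_star_diff:
  assumes "integrable lborel f" "integrable lborel g"
  shows "(avg n \<star> (\<lambda>\<tau>. f \<tau> - g \<tau>)) t = (avg n \<star> f) t - (avg n \<star> g) t"
  unfolding star_def right_diff_distrib
  by (intro Bochner_Integration.integral_diff bounded_reflect_mult_integrable[OF avg_measurable avg_bound] assms)

lemma avg_star_tendsto:
  assumes f: "integrable lborel f" and c: "isCont f t"
  shows "(\<lambda>n. (avg n \<star> f) t) \<longlonglongrightarrow> f t"
proof (rule LIMSEQ_I)
  fix e :: real assume "e > 0"
  then have "e / 2 > 0" by simp
  with c obtain d where d: "d > 0" "\<And>s. \<bar>s - t\<bar> < d \<Longrightarrow> \<bar>f s - f t\<bar> < e / 2"
    unfolding continuous_at_eps_delta dist_real_def by blast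
  obtain N where N: "1 / real (Suc N) < d" using d nat_approx_posE by blast
  have "norm ((avg n \<star> f) t - f t) < e" if "n \<ge> N" for n
  proof -
    have "1 / real (Suc n) \<le> 1 / real (Suc N)" using that by (simp add: frac_le)
    with N have nd: "1 / real (Suc n) < d" by linarith
    have ri: "integrable lborel (\<lambda>\<tau>. avg n (t - \<tau>))" "(LINT \<tau>|lborel. avg n (t - \<tau>)) = 1"
      using integrable_reflect[OF avg_integral(1)] integral_reflect[of "avg n" t] avg_integral(2) by auto
    note fi = bounded_reflect_mult_integrable[OF avg_measurable avg_bound f, of n t]
    have "(avg n \<star> f) t - f t = (LINT \<tau>|lborel. avg n (t - \<tau>) * f \<tau> - avg n (t - \<tau>) * f t)"
      unfolding star_def using fi ri by simp
    also have "\<bar>\<dots>\<bar> \<le> (LINT \<tau>|lborel. \<bar>avg n (t - \<tau>) * f \<tau> - avg n (t - \<tau>) * f t\<bar>)"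
      using integral_norm_bound[of lborel "\<lambda>\<tau>. avg n (t - \<tau>) * f \<tau> - avg n (t - \<tau>) * f t"] by simp
    also have "\<dots> \<le> (LINT \<tau>|lborel. avg n (t - \<tau>) * (e / 2))"
    proof (rule integral_mono)
      fix \<tau>
      have "\<bar>avg n (t - \<tau>) * f \<tau> - avg n (t - \<tau>) * f t\<bar> = avg n (t - \<tau>) * \<bar>f \<tau> - f t\<bar>"
        using avg_nonneg[of n "t - \<tau>"] by (simp add: abs_mult flip: right_diff_distrib)
      also have "\<dots> \<le> avg n (t - \<tau>) * (e / 2)"
      proof (cases "avg n (t - \<tau>) = 0")
        case False
        then have "\<bar>\<tau> - t\<bar> < d" using nd by (auto simp: avg_def split: split_indicator_asm)
        then show ?thesis using d(2)[of \<tau>] avg_nonneg[of n "t - \<tau>"] by (intro mult_left_mono) auto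
      qed simp
      finally show "\<bar>avg n (t - \<tau>) * f \<tau> - avg n (t - \<tau>) * f t\<bar> \<le> avg n (t - \<tau>) * (e / 2)" .
    qed (use fi ri in auto)
    also have "\<dots> = e / 2" using ri(2) by simp
    finally show ?thesis using \<open>e > 0\<close> by simp
  qed
  then show "\<exists>N. \<forall>n\<ge>N. norm ((avg n \<star> f) t - f t) < e" by blast
qed

context finite_measure begin

interpretation P: pair_sigma_finite "lborel :: real measure" M by unfold_locales

lemma mixedI_L2:
  assumes [measurable]: "(\<lambda>(t, x). f t x) \<in> borel_measurable (lborel \<Otimes>\<^sub>M M)"
    and supp: "\<And>t x. t \<notin> {0<..<T} \<Longrightarrow> f t x = 0"
    and fin: "(\<integral>\<^sup>+x. (\<integral>\<^sup>+t. (ennreal \<bar>f t x\<bar>)\<^sup>2 \<partial>lborel) \<partial>M) < \<infinity>"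
  shows "mixed f"
  unfolding mixed_def
proof (intro conjI allI impI)
  have le: "(\<integral>\<^sup>+t. ennreal \<bar>f t x\<bar> \<partial>lborel)\<^sup>2 \<le> emeasure lborel {0<..<T} * (\<integral>\<^sup>+t. (ennreal \<bar>f t x\<bar>)\<^sup>2 \<partial>lborel)"
    if [measurable]: "x \<in> space M" for x
  proof -
    have "(\<integral>\<^sup>+t. ennreal \<bar>f t x\<bar> \<partial>lborel) = (\<integral>\<^sup>+t. indicator {0<..<T} t * ennreal \<bar>f t x\<bar> \<partial>lborel)"
      using supp by (intro nn_integral_cong) (auto split: split_indicator)
    moreover have "(\<integral>\<^sup>+t. indicator {0<..<T} t * ennreal \<bar>f t x\<bar> \<partial>lborel)\<^sup>2 \<le>
      (\<integral>\<^sup>+t. (indicator {0<..<T} t)\<^sup>2 \<partial>lborel) * (\<integral>\<^sup>+t. (ennreal \<bar>f t x\<bar>)\<^sup>2 \<partial>lborel)"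
      by (rule Cauchy_Schwarz_nn_integral) auto
    moreover have "(\<integral>\<^sup>+t. (indicator {0<..<T} t)\<^sup>2 \<partial>lborel) = emeasure lborel {0<..<T}"
    proof -
      have "(indicator {0<..<T} t)\<^sup>2 = (indicator {0<..<T} t :: ennreal)" for t
        by (auto split: split_indicator)
      then show ?thesis by simp
    qed
    ultimately show ?thesis by simp
  qed
  have "(\<integral>\<^sup>+x. (\<integral>\<^sup>+t. ennreal \<bar>f t x\<bar> \<partial>lborel)\<^sup>2 \<partial>M) \<le> (\<integral>\<^sup>+x. emeasure lborel {0<..<T} * (\<integral>\<^sup>+t. (ennreal \<bar>f t x\<bar>)\<^sup>2 \<partial>lborel) \<partial>M)"
    by (rule nn_integral_mono[OF le])
  also have "\<dots> = emeasure lborel {0<..<T} * (\<integral>\<^sup>+x. (\<integral>\<^sup>+t. (ennreal \<bar>f t x\<bar>)\<^sup>2 \<partial>lborel) \<partial>M)"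
    by (rule nn_integral_cmult) measurable
  also have "\<dots> < \<infinity>" using fin by (cases "0 \<le> T") (auto simp: ennreal_mult_less_top)
  finally show "(\<integral>\<^sup>+x. (\<integral>\<^sup>+t. ennreal \<bar>f t x\<bar> \<partial>lborel)\<^sup>2 \<partial>M) < \<infinity>" .
qed (use supp in auto)

lemma mixed_star_measurable:
  assumes "b \<in> borel_measurable borel" "mixed f" "a \<in> N \<rightarrow>\<^sub>M lborel" "c \<in> N \<rightarrow>\<^sub>M M"
  shows "(\<lambda>y. (b \<diamond> f) (a y) (c y)) \<in> borel_measurable N"
proof -
  have "(\<lambda>(t, x). (b \<diamond> f) t x) \<in> borel_measurable (lborel \<Otimes>\<^sub>M M)"
    by (rule measurable_star_pair[OF assms(1) mixed_measurable[OF assms(2)]])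
  from measurable_compose[OF measurable_Pair[OF assms(3,4)] this] show ?thesis by simp
qed

lemma avg_prod_integrable:
  assumes f: "mixed f" and g: "mixed g"
  shows "integrable (lborel \<Otimes>\<^sub>M M) (\<lambda>(r, x). one T r * ((avg n \<diamond> f) r x * (avg n \<diamond> g) r x))"
proof (rule integrableI_bounded)
  note [measurable] = mixed_star_measurable[OF avg_measurable f] mixed_star_measurable[OF avg_measurable g]
    causalD(3)[OF causal_one] mixed_measurable_comp[OF f] mixed_measurable_comp[OF g]
  let ?H = "\<lambda>r x. one T r * ((avg n \<diamond> f) r x * (avg n \<diamond> g) r x)"
  show m [measurable]: "(\<lambda>(r, x). ?H r x) \<in> borel_measurable (lborel \<Otimes>\<^sub>M M)"
    unfolding case_prod_unfold by measurable
  let ?N = "\<lambda>f x. \<integral>\<^sup>+t. ennreal \<bar>f t x\<bar> \<partial>lborel"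
  let ?c = "ennreal (real (Suc n) * real (Suc n))"
  have bd: "AE x in M. (\<integral>\<^sup>+r. ennreal \<bar>?H r x\<bar> \<partial>lborel) \<le> (emeasure lborel {0<..<T} * ?c) * (?N f x * ?N g x)"
    using mixed_AE_causal[OF f] mixed_AE_causal[OF g]
  proof eventually_elim
    case (elim x)
    let ?F = "LINT t|lborel. \<bar>f t x\<bar>" and ?G = "LINT t|lborel. \<bar>g t x\<bar>"
    have FG: "?N f x = ennreal ?F" "?N g x = ennreal ?G"
      using causalD(1)[OF elim(1)] causalD(1)[OF elim(2)] by (auto intro!: nn_integral_eq_integral)
    have F0: "0 \<le> ?F" "0 \<le> ?G" by (auto intro: integral_nonneg_AE)
    have "(\<integral>\<^sup>+r. ennreal \<bar>?H r x\<bar> \<partial>lborel) \<le> (\<integral>\<^sup>+r. ennreal ((real (Suc n) * ?F) * (real (Suc n) * ?G)) * indicator {0<..<T} r \<partial>lborel)"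
    proof (rule nn_integral_mono)
      fix r
      have "\<bar>(avg n \<diamond> f) r x * (avg n \<diamond> g) r x\<bar> \<le> (real (Suc n) * ?F) * (real (Suc n) * ?G)"
        unfolding abs_mult using avg_star_bound[OF causalD(1)[OF elim(1)], of n r] avg_star_bound[OF causalD(1)[OF elim(2)], of n r] F0
        by (intro mult_mono) auto
      then show "ennreal \<bar>?H r x\<bar> \<le> ennreal ((real (Suc n) * ?F) * (real (Suc n) * ?G)) * indicator {0<..<T} r"
        by (auto simp: one_def split: split_indicator intro!: ennreal_leI)
    qed
    also have "\<dots> = ennreal ((real (Suc n) * ?F) * (real (Suc n) * ?G)) * emeasure lborel {0<..<T}"
      by (rule nn_integral_cmult_indicator) auto
    also have "ennreal ((real (Suc n) * ?F) * (real (Suc n) * ?G)) = ?c * (?N f x * ?N g x)"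
      unfolding FG using F0 by (simp add: mult_ac flip: ennreal_mult)
    finally show ?case by (simp add: mult_ac)
  qed
  have "(\<integral>\<^sup>+p. ennreal (norm (case p of (r, x) \<Rightarrow> ?H r x)) \<partial>(lborel \<Otimes>\<^sub>M M)) = (\<integral>\<^sup>+x. (\<integral>\<^sup>+r. ennreal \<bar>?H r x\<bar> \<partial>lborel) \<partial>M)"
    by (subst P.nn_integral_snd[symmetric]) (auto simp: case_prod_unfold)
  also have "\<dots> \<le> (\<integral>\<^sup>+x. (emeasure lborel {0<..<T} * ?c) * (?N f x * ?N g x) \<partial>M)"
    by (rule nn_integral_mono_AE[OF bd])
  also have "\<dots> = (emeasure lborel {0<..<T} * ?c) * (\<integral>\<^sup>+x. ?N f x * ?N g x \<partial>M)"
    by (rule nn_integral_cmult) measurable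
  also have "\<dots> < \<infinity>"
  proof -
    have "emeasure lborel {0<..<T} < \<infinity>" by (cases "0 \<le> T") auto
    then show ?thesis using mixed_mult_finite[OF f g] by (simp add: ennreal_mult_less_top)
  qed
  finally show "(\<integral>\<^sup>+p. ennreal (norm (case p of (r, x) \<Rightarrow> ?H r x)) \<partial>(lborel \<Otimes>\<^sub>M M)) < \<infinity>" .
qed

text \<open>
Both time variables are averaged over the interval that ends at \<open>r\<close>. Since the identity is assumed for
almost all pairs \<open>(s, t)\<close>, it may be integrated against \<open>avg n (r - s) * avg n (r - t)\<close>, and the
integrals over \<open>s\<close>, \<open>t\<close> and \<open>x\<close> may be interchanged.
\<close>

lemma smoothed_tensor_identity:
  assumes z: "mixed z" and W: "mixed W" and G: "\<And>j. j < N \<Longrightarrow> mixed (G j)" and g: "\<And>j. j < N \<Longrightarrow> mixed (g j)"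
    and eq: "AE s in lborel. AE t in lborel. (LINT x|M. z s x * W t x) + (\<Sum>j<N. LINT x|M. G j s x * g j t x) = 0"
  shows "(LINT x|M. (avg n \<diamond> z) r x * (avg n \<diamond> W) r x) +
    (\<Sum>j<N. LINT x|M. (avg n \<diamond> G j) r x * (avg n \<diamond> g j) r x) = 0"
proof -
  let ?a = "\<lambda>f s x. avg n (r - s) * f s x"
  have mb: "mixed (?a f)" if "mixed f" for f
    using avg_measurable avg_bound by (intro mixed_mult_bounded[OF that, where B="real (Suc n)"]) (auto intro: measurable_compose)
  have e: "(LINT x|M. (avg n \<diamond> f) r x * (avg n \<diamond> g) r x) =
     (LINT p|(lborel \<Otimes>\<^sub>M lborel). avg n (r - fst p) * avg n (r - snd p) * (LINT x|M. f (fst p) x * g (snd p) x))"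
    and i: "integrable (lborel \<Otimes>\<^sub>M lborel) (\<lambda>p. avg n (r - fst p) * avg n (r - snd p) * (LINT x|M. f (fst p) x * g (snd p) x))"
    if f: "mixed f" and g: "mixed g" for f g
  proof -
    have *: "(LINT x|M. ?a f s x * ?a g t x) = avg n (r - s) * avg n (r - t) * (LINT x|M. f s x * g t x)" for s t
    proof -
      have "(\<lambda>x. ?a f s x * ?a g t x) = (\<lambda>x. (avg n (r - s) * avg n (r - t)) * (f s x * g t x))"
        by (auto simp: mult_ac)
      then show ?thesis by (simp only: integral_mult_right_zero)
    qed
    show "(LINT x|M. (avg n \<diamond> f) r x * (avg n \<diamond> g) r x) =
      (LINT p|(lborel \<Otimes>\<^sub>M lborel). avg n (r - fst p) * avg n (r - snd p) * (LINT x|M. f (fst p) x * g (snd p) x))"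
      using mixed_prod_integral[OF mb[OF f] mb[OF g]] unfolding * star_def by (simp add: case_prod_unfold)
    show "integrable (lborel \<Otimes>\<^sub>M lborel) (\<lambda>p. avg n (r - fst p) * avg n (r - snd p) * (LINT x|M. f (fst p) x * g (snd p) x))"
      using mixed_prod_integrable[OF mb[OF f] mb[OF g]] unfolding * by (simp add: case_prod_unfold)
  qed
  let ?S = "\<lambda>p. (LINT x|M. z (fst p) x * W (snd p) x) + (\<Sum>j<N. LINT x|M. G j (fst p) x * g j (snd p) x)"
  have "(LINT x|M. (avg n \<diamond> z) r x * (avg n \<diamond> W) r x) +
    (\<Sum>j<N. LINT x|M. (avg n \<diamond> G j) r x * (avg n \<diamond> g j) r x) =
    (LINT p|(lborel \<Otimes>\<^sub>M lborel). avg n (r - fst p) * avg n (r - snd p) * ?S p)"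
  proof -
    have "(\<Sum>j<N. LINT x|M. (avg n \<diamond> G j) r x * (avg n \<diamond> g j) r x) =
      (\<Sum>j<N. LINT p|(lborel \<Otimes>\<^sub>M lborel). avg n (r - fst p) * avg n (r - snd p) * (LINT x|M. G j (fst p) x * g j (snd p) x))"
      by (intro sum.cong refl e G g) auto
    then show ?thesis
      unfolding e[OF z W] distrib_left sum_distrib_left
      by (simp only:) (intro integral_add_sum i z W G g, auto)
  qed
  also have "\<dots> = 0"
  proof (rule integral_eq_zero_AE)
    have [measurable]: "(\<lambda>p. LINT x|M. f (fst p) x * g (snd p) x) \<in> borel_measurable (lborel \<Otimes>\<^sub>M lborel)"
      if "mixed f" "mixed g" for f g
      using mixed_prod_integrable[OF that] by (auto simp: case_prod_unfold dest: borel_measurable_integrable)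
    have S: "?S \<in> borel_measurable (lborel \<Otimes>\<^sub>M lborel)"
      using z W G g by (intro borel_measurable_add borel_measurable_sum) auto
    have "AE p in lborel \<Otimes>\<^sub>M lborel. ?S p = 0"
    proof (rule lborel_pair.AE_pair_measure)
      show "{p \<in> space (lborel \<Otimes>\<^sub>M lborel). ?S p = 0} \<in> sets (lborel \<Otimes>\<^sub>M lborel)"
        using S by (rule borel_measurable_eq[OF _ borel_measurable_const])
      show "AE s in lborel. AE t in lborel. ?S (s, t) = 0" using eq by simp
    qed
    then show "AE p in lborel \<Otimes>\<^sub>M lborel. avg n (r - fst p) * avg n (r - snd p) * ?S p = 0"
      by eventually_elim simp
  qed
  finally show ?thesis .
qed

text \<open>
Integrate the averaged identity over \<open>r \<in> (0, T)\<close>. For fixed \<open>x\<close>, the gradient terms are of the form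
treated in \<open>integral_positive_avg\<close>; the factor \<open>one T t\<close> may be dropped there because averages are
causal.
\<close>

lemma smoothed_energy_nonpos:
  assumes k: "causal k" "\<And>t. 0 \<le> k t" "\<And>s t. 0 < s \<Longrightarrow> s \<le> t \<Longrightarrow> k t \<le> k s"
    and l: "causal l" and kl: "eq_below T (k \<star> l) (one T)"
    and z: "mixed z" and W: "mixed W" and G: "\<And>j. j < N \<Longrightarrow> mixed (G j)"
    and eq: "AE s in lborel. AE t in lborel. (LINT x|M. z s x * W t x) +
       (\<Sum>j<N. LINT x|M. G j s x * (one T t * (l \<diamond> G j) t x)) = 0"
  shows "(LINT p|(lborel \<Otimes>\<^sub>M M). one T (fst p) * ((avg n \<diamond> z) (fst p) (snd p) * (avg n \<diamond> W) (fst p) (snd p))) \<le> 0"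
proof -
  let ?g = "\<lambda>j t x. one T t * (l \<diamond> G j) t x"
  have g: "mixed (?g j)" if "j < N" for j
    using causalD(3)[OF causal_one]
    by (intro mixed_mult_bounded[where B=1] mixed_star l G that) (auto simp: one_def split: split_indicator)
  let ?H = "\<lambda>f g r x. one T r * ((avg n \<diamond> f) r x * (avg n \<diamond> g) r x)"
  note i = avg_prod_integrable[of _ _ T n]
  have fst: "(LINT p|(lborel \<Otimes>\<^sub>M M). ?H f g (fst p) (snd p)) = (LINT r|lborel. LINT x|M. ?H f g r x)"
    and fsti: "integrable lborel (\<lambda>r. LINT x|M. ?H f g r x)"
    and snd: "(LINT p|(lborel \<Otimes>\<^sub>M M). ?H f g (fst p) (snd p)) = (LINT x|M. LINT r|lborel. ?H f g r x)"
    if "mixed f" "mixed g" for f g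
    using P.integral_fst[OF i[OF that]] P.integral_snd[OF i[OF that]] P.integrable_fst[OF i[OF that]] by (simp_all add: case_prod_unfold)
  have pos: "(LINT p|(lborel \<Otimes>\<^sub>M M). ?H (G j) (?g j) (fst p) (snd p)) \<ge> 0" if j: "j < N" for j
    unfolding snd[OF G[OF j] g[OF j]]
  proof (rule integral_nonneg_AE)
    show "AE x in M. 0 \<le> (LINT r|lborel. ?H (G j) (?g j) r x)"
      using mixed_AE_causal[OF G[OF j]]
    proof eventually_elim
      case (elim x)
      have lg: "causal (l \<star> (\<lambda>\<tau>. G j \<tau> x))" by (intro causal_star l elim)
      have ol: "causal (\<lambda>\<tau>. ?g j \<tau> x)"
        unfolding one_def by (intro causalI integrable_indicator_times causalD(1)[OF lg]) auto
      have "eq_below T (\<lambda>\<tau>. ?g j \<tau> x) (l \<star> (\<lambda>\<tau>. G j \<tau> x))"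
        unfolding eq_below_def using causalD(2)[OF lg] by (auto simp: one_def not_less split: split_indicator)
      from star_cong_right[OF this ol lg causal_avg]
      have *: "?H (G j) (?g j) r x = one T r * ((avg n \<diamond> G j) r x * (avg n \<star> (l \<star> (\<lambda>\<tau>. G j \<tau> x))) r)" for r
        by (cases "r \<le> T") (auto simp: one_def)
      show ?case unfolding * by (rule integral_positive_avg[OF k l kl elim])
    qed
  qed
  have "(LINT p|(lborel \<Otimes>\<^sub>M M). ?H z W (fst p) (snd p)) + (\<Sum>j<N. LINT p|(lborel \<Otimes>\<^sub>M M). ?H (G j) (?g j) (fst p) (snd p)) =
     (LINT r|lborel. (LINT x|M. ?H z W r x) + (\<Sum>j<N. LINT x|M. ?H (G j) (?g j) r x))"
  proof -
    have "(\<Sum>j<N. LINT p|(lborel \<Otimes>\<^sub>M M). ?H (G j) (?g j) (fst p) (snd p)) = (\<Sum>j<N. LINT r|lborel. LINT x|M. ?H (G j) (?g j) r x)"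
      by (intro sum.cong refl fst G g) auto
    then show ?thesis
      unfolding fst[OF z W]
      by (simp only:) (intro integral_add_sum fsti z W G g, auto)
  qed
  also have "\<dots> = (LINT r|lborel. one T r * ((LINT x|M. (avg n \<diamond> z) r x * (avg n \<diamond> W) r x) +
    (\<Sum>j<N. LINT x|M. (avg n \<diamond> G j) r x * (avg n \<diamond> ?g j) r x)))"
    by (simp add: distrib_left sum_distrib_left)
  also have "\<dots> = 0" using smoothed_tensor_identity[OF z W G g eq] by simp
  finally have eq0: "(LINT p|(lborel \<Otimes>\<^sub>M M). ?H z W (fst p) (snd p)) + (\<Sum>j<N. LINT p|(lborel \<Otimes>\<^sub>M M). ?H (G j) (?g j) (fst p) (snd p)) = 0" .
  have "0 \<le> (\<Sum>j<N. LINT p|(lborel \<Otimes>\<^sub>M M). ?H (G j) (?g j) (fst p) (snd p))"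
    by (intro sum_nonneg pos) auto
  with eq0 show ?thesis by linarith
qed

text \<open>
Write \<open>W = w - w0\<close> in the averaged inequality. Averages of the constant \<open>w0\<close> are at most \<open>w0\<close>, and
averaging does not increase the integral of \<open>z\<close>, so the averages of \<open>z\<close> and \<open>w\<close> satisfy the
inequality with the right-hand side claimed for the limit. Continuity in time gives pointwise convergence
of the averages, and Fatou's lemma gives the result without any uniform bound on \<open>z\<close> and \<open>w\<close>.
\<close>

lemma energy_inequality:
  assumes k: "causal k" "\<And>t. 0 \<le> k t" "\<And>s t. 0 < s \<Longrightarrow> s \<le> t \<Longrightarrow> k t \<le> k s"
    and l: "causal l" and kl: "eq_below T (k \<star> l) (one T)"
    and z: "mixed z" and w: "mixed w" and G: "\<And>j. j < N \<Longrightarrow> mixed (G j)" and w0: "mixed (\<lambda>t x. one T t * w0 x)"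
    and eq: "AE s in lborel. AE t in lborel. (LINT x|M. z s x * (w t x - one T t * w0 x)) +
       (\<Sum>j<N. LINT x|M. G j s x * (one T t * (l \<diamond> G j) t x)) = 0"
    and z0: "\<And>t x. 0 \<le> z t x" and wn: "\<And>t x. 0 \<le> w t x" and w00: "AE x in M. 0 \<le> w0 x" and w0m: "w0 \<in> borel_measurable M"
    and cont: "\<And>t x. x \<in> space M \<Longrightarrow> 0 < t \<Longrightarrow> t < T \<Longrightarrow> isCont (\<lambda>t. z t x) t \<and> isCont (\<lambda>t. w t x) t"
  shows "(\<integral>\<^sup>+x. \<integral>\<^sup>+t. ennreal (one T t * (z t x * w t x)) \<partial>lborel \<partial>M) \<le> (\<integral>\<^sup>+x. ennreal (w0 x) * (\<integral>\<^sup>+t. ennreal (z t x) \<partial>lborel) \<partial>M)"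
    (is "?L \<le> ?R")
proof -
  note mm [measurable] = mixed_star_measurable[OF avg_measurable z] mixed_star_measurable[OF avg_measurable w]
    causalD(3)[OF causal_one] mixed_measurable_comp[OF z] mixed_measurable_comp[OF w] w0m
  let ?A = "\<lambda>n f r x. (avg n \<diamond> f) r x"
  let ?w0 = "\<lambda>t x. one T t * w0 x"
  let ?u = "\<lambda>n r x. one T r * (?A n z r x * ?A n w r x)"
  have A0: "0 \<le> ?A n f r x" if "\<And>t x. 0 \<le> f t x" for n f r x
    unfolding star_def by (intro integral_nonneg_AE) (auto simp: avg_nonneg that)
  have u_le: "(\<integral>\<^sup>+x. \<integral>\<^sup>+r. ennreal (?u n r x) \<partial>lborel \<partial>M) \<le> ?R" for n
  proof -
    let ?H = "\<lambda>f g p. one T (fst p) * (?A n f (fst p) (snd p) * ?A n g (fst p) (snd p))"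
    have i: "integrable (lborel \<Otimes>\<^sub>M M) (?H f g)" if "mixed f" "mixed g" for f g
      using avg_prod_integrable[OF that, of T n] by (simp add: case_prod_unfold)
    have W: "mixed (\<lambda>t x. w t x - ?w0 t x)" by (rule mixed_diff[OF w w0])
    have "(\<integral>\<^sup>+x. \<integral>\<^sup>+r. ennreal (?u n r x) \<partial>lborel \<partial>M) = (\<integral>\<^sup>+p. ennreal (?H z w p) \<partial>(lborel \<Otimes>\<^sub>M M))"
      by (subst P.nn_integral_snd[symmetric]) (auto simp: case_prod_unfold)
    also have "\<dots> = ennreal (integral\<^sup>L (lborel \<Otimes>\<^sub>M M) (?H z w))"
      using z0 wn by (intro nn_integral_eq_integral i z w) (auto simp: one_def intro!: AE_I2 mult_nonneg_nonneg A0)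
    also have "\<dots> \<le> ennreal (integral\<^sup>L (lborel \<Otimes>\<^sub>M M) (?H z ?w0))"
    proof (rule ennreal_leI)
      have "integral\<^sup>L (lborel \<Otimes>\<^sub>M M) (?H z (\<lambda>t x. w t x - ?w0 t x)) =
        integral\<^sup>L (lborel \<Otimes>\<^sub>M M) (\<lambda>p. ?H z w p - ?H z ?w0 p)"
      proof (rule integral_cong_AE)
        have "AE x in M. \<forall>r. ?A n (\<lambda>t x. w t x - ?w0 t x) r x = ?A n w r x - ?A n ?w0 r x"
          using mixed_AE_causal[OF w] mixed_AE_causal[OF w0]
          by eventually_elim (intro allI avg_star_diff causalD(1))
        then have "AE x in M. ?A n (\<lambda>t x. w t x - ?w0 t x) r x = ?A n w r x - ?A n ?w0 r x" for r
          by eventually_elim blast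
        then have "AE r in lborel. AE x in M. ?A n (\<lambda>t x. w t x - ?w0 t x) r x = ?A n w r x - ?A n ?w0 r x"
          by (rule AE_I2)
        moreover have "{p \<in> space (lborel \<Otimes>\<^sub>M M). ?A n (\<lambda>t x. w t x - ?w0 t x) (fst p) (snd p) = ?A n w (fst p) (snd p) - ?A n ?w0 (fst p) (snd p)} \<in> sets (lborel \<Otimes>\<^sub>M M)"
          by (intro borel_measurable_eq borel_measurable_diff mixed_star_measurable[OF avg_measurable] W w w0) auto
        ultimately have "AE p in lborel \<Otimes>\<^sub>M M. ?A n (\<lambda>t x. w t x - ?w0 t x) (fst p) (snd p) = ?A n w (fst p) (snd p) - ?A n ?w0 (fst p) (snd p)"
          by (intro P.AE_pair_measure) auto
        then show "AE p in lborel \<Otimes>\<^sub>M M. ?H z (\<lambda>t x. w t x - ?w0 t x) p = ?H z w p - ?H z ?w0 p"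
          by eventually_elim (simp only: right_diff_distrib)
      qed (use i[OF z W] i[OF z w] i[OF z w0] in auto)
      also have "\<dots> = integral\<^sup>L (lborel \<Otimes>\<^sub>M M) (?H z w) - integral\<^sup>L (lborel \<Otimes>\<^sub>M M) (?H z ?w0)"
        by (intro Bochner_Integration.integral_diff i z w w0)
      finally show "integral\<^sup>L (lborel \<Otimes>\<^sub>M M) (?H z w) \<le> integral\<^sup>L (lborel \<Otimes>\<^sub>M M) (?H z ?w0)"
        using smoothed_energy_nonpos[OF k l kl z W G eq, of n] by simp
    qed
    also have "\<dots> \<le> (\<integral>\<^sup>+p. ennreal (norm (?H z ?w0 p)) \<partial>(lborel \<Otimes>\<^sub>M M))"
      by (rule order_trans[OF _ integral_norm_bound_ennreal[OF i[OF z w0]]]) (simp add: ennreal_leI)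
    also have "\<dots> = (\<integral>\<^sup>+x. \<integral>\<^sup>+r. ennreal (norm (?H z ?w0 (r, x))) \<partial>lborel \<partial>M)"
      using i[OF z w0] by (subst P.nn_integral_snd[symmetric]) (auto dest: borel_measurable_integrable)
    also have "\<dots> \<le> ?R"
    proof (rule nn_integral_mono_AE)
      show "AE x in M. (\<integral>\<^sup>+r. ennreal (norm (?H z ?w0 (r, x))) \<partial>lborel) \<le> ennreal (w0 x) * (\<integral>\<^sup>+t. ennreal (z t x) \<partial>lborel)"
        using w00 mixed_AE_causal[OF z] mixed_AE_causal[OF w0]
      proof eventually_elim
        case (elim x)
        have zm [measurable]: "(\<lambda>t. z t x) \<in> borel_measurable borel" using causalD(3)[OF elim(2)] .
        have bnd: "norm (?H z ?w0 (r, x)) \<le> w0 x * \<bar>?A n z r x\<bar>" for r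
        proof -
          have "?A n ?w0 r x \<le> (LINT \<tau>|lborel. avg n (r - \<tau>) * w0 x)"
            unfolding star_def
            using bounded_reflect_mult_integrable[OF avg_measurable avg_bound causalD(1)[OF elim(3)], of n r] integrable_reflect[OF avg_integral(1)] elim(1)
            by (intro integral_mono) (auto intro!: mult_left_mono simp: avg_nonneg one_def split: split_indicator)
          also have "\<dots> = w0 x" using integral_reflect[of "avg n" r] avg_integral(2)[of n] by simp
          finally have 1: "?A n ?w0 r x \<le> w0 x" .
          have 2: "0 \<le> ?A n ?w0 r x"
            unfolding star_def using elim(1) by (intro integral_nonneg_AE) (auto simp: avg_nonneg one_def)
          have "\<bar>?A n z r x * ?A n ?w0 r x\<bar> \<le> w0 x * \<bar>?A n z r x\<bar>"
            unfolding abs_mult using 1 2 by (subst mult.commute) (intro mult_right_mono, auto)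
          then show ?thesis using elim(1) by (auto simp: one_def split: split_indicator)
        qed
        have "(\<integral>\<^sup>+r. ennreal (norm (?H z ?w0 (r, x))) \<partial>lborel) \<le> (\<integral>\<^sup>+r. ennreal (w0 x) * ennreal \<bar>?A n z r x\<bar> \<partial>lborel)"
          using bnd elim(1) by (intro nn_integral_mono) (auto simp flip: ennreal_mult intro!: ennreal_leI)
        also have "\<dots> = ennreal (w0 x) * (\<integral>\<^sup>+r. ennreal \<bar>?A n z r x\<bar> \<partial>lborel)"
          using measurable_star[OF avg_measurable zm] by (intro nn_integral_cmult) auto
        also have "(\<integral>\<^sup>+r. ennreal \<bar>?A n z r x\<bar> \<partial>lborel) \<le> (\<integral>\<^sup>+s. ennreal \<bar>avg n s\<bar> \<partial>lborel) * (\<integral>\<^sup>+t. ennreal \<bar>z t x\<bar> \<partial>lborel)"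
          by (rule nn_integral_star_le[OF avg_measurable zm])
        also have "\<dots> = (\<integral>\<^sup>+t. ennreal (z t x) \<partial>lborel)" using nn_integral_avg z0 by simp
        finally show ?case by (simp add: mult_left_mono)
      qed
    qed
    finally show ?thesis .
  qed
  have "?L \<le> (\<integral>\<^sup>+x. liminf (\<lambda>n. \<integral>\<^sup>+r. ennreal (?u n r x) \<partial>lborel) \<partial>M)"
  proof (rule nn_integral_mono_AE)
    show "AE x in M. (\<integral>\<^sup>+t. ennreal (one T t * (z t x * w t x)) \<partial>lborel) \<le> liminf (\<lambda>n. \<integral>\<^sup>+r. ennreal (?u n r x) \<partial>lborel)"
      using mixed_AE_causal[OF z] mixed_AE_causal[OF w] AE_space
    proof eventually_elim
      case (elim x)
      have [measurable]: "(\<lambda>r. ?A n f r x) \<in> borel_measurable lborel" if "causal (\<lambda>t. f t x)" for f n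
        using measurable_star[OF avg_measurable causalD(3)[OF that]] by simp
      have um: "(\<lambda>r. ennreal (?u n r x)) \<in> borel_measurable lborel" for n
        using elim(1,2) causalD(3)[OF causal_one] by (intro measurable_compose[OF _ measurable_ennreal] borel_measurable_times) auto
      have "(\<integral>\<^sup>+t. ennreal (one T t * (z t x * w t x)) \<partial>lborel) \<le> (\<integral>\<^sup>+r. liminf (\<lambda>n. ennreal (?u n r x)) \<partial>lborel)"
      proof (rule nn_integral_mono)
        fix t
        have "(\<lambda>n. ennreal (?u n t x)) \<longlonglongrightarrow> ennreal (one T t * (z t x * w t x))"
        proof (cases "0 < t \<and> t < T")
          case True
          then show ?thesis using cont[OF elim(3), of t]
            by (intro tendsto_ennrealI tendsto_mult tendsto_const avg_star_tendsto causalD(1)[OF elim(1)] causalD(1)[OF elim(2)]) auto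
        next
          case False
          then show ?thesis by (simp add: one_def)
        qed
        then show "ennreal (one T t * (z t x * w t x)) \<le> liminf (\<lambda>n. ennreal (?u n t x))"
          by (simp add: lim_imp_Liminf)
      qed
      also have "\<dots> \<le> liminf (\<lambda>n. \<integral>\<^sup>+r. ennreal (?u n r x) \<partial>lborel)"
        by (rule nn_integral_liminf[OF um])
      finally show ?case .
    qed
  qed
  also have "\<dots> \<le> liminf (\<lambda>n. \<integral>\<^sup>+x. \<integral>\<^sup>+r. ennreal (?u n r x) \<partial>lborel \<partial>M)"
    by (rule nn_integral_liminf) measurable
  also have "\<dots> \<le> ?R"
    using u_le by (intro Liminf_le) auto
  finally show ?thesis .
qed

text \<open>
The hypothesis says \<open>\<kappa> = 1 - 1 * h\<close>, hence \<open>\<kappa> * u = 1 * (u - h * u)\<close>, and a derivative of this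
primitive should be \<open>u - h * u\<close>. The difference quotients converge in \<open>L\<^sub>1\<close> in time for almost
every \<open>x\<close>, hence in \<open>L\<^sub>1\<close> of time and space by dominated convergence, hence almost everywhere along a
subsequence that does not depend on \<open>(t, x)\<close>. Where a derivative exists, it is that limit.
\<close>

lemma derivative_of_convolution:
  assumes \<kappa>: "causal \<kappa>" and h: "causal h" and eq: "eq_below T \<kappa> (\<lambda>t. one T t - (one T \<star> h) t)" and u: "mixed u"
  shows "AE t in lborel. AE x in M. t < T \<longrightarrow> (\<forall>D. ((\<lambda>s. (\<kappa> \<star> (\<lambda>\<tau>. u \<tau> x)) s) has_real_derivative D) (at t) \<longrightarrow>
     D = u t x - (h \<diamond> u) t x)"
proof -
  define f where "f t x = u t x - (h \<diamond> u) t x" for t x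
  have f: "mixed f" unfolding f_def by (intro mixed_diff mixed_star u h)
  define F where "F t x = (\<kappa> \<diamond> u) t x" for t x
  have Fm: "mixed F" unfolding F_def by (intro mixed_star u \<kappa>)
  let ?d = "\<lambda>n. 1 / real (Suc n)"
  let ?q = "\<lambda>n t x. real (Suc n) * (F (t + ?d n) x - F t x)"
  let ?p = "\<lambda>n t x. (fdiff n \<diamond> f) t x"
  have fdm: "fdiff n \<in> borel_measurable borel" for n using fdiff_integrable[of n] by auto
  note [measurable] = mixed_measurable_comp[OF f] mixed_measurable_comp[OF Fm] mixed_star_measurable[OF fdm f]
  have "AE t in lborel. AE x in M. t + ?d n < T \<longrightarrow> ?q n t x = ?p n t x" for n
  proof (rule P.AE_commute[THEN iffD2])
    show "{p \<in> space (lborel \<Otimes>\<^sub>M M). fst p + ?d n < T \<longrightarrow> ?q n (fst p) (snd p) = ?p n (fst p) (snd p)} \<in> sets (lborel \<Otimes>\<^sub>M M)"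
      by measurable
    show "AE x in M. AE t in lborel. t + ?d n < T \<longrightarrow> ?q n t x = ?p n t x"
      using mixed_AE_causal[OF u] mixed_AE_causal[OF f]
    proof eventually_elim
      case (elim x)
      let ?u = "\<lambda>\<tau>. u \<tau> x" and ?f = "\<lambda>\<tau>. f \<tau> x"
      note ca = causal_intros \<kappa> h elim
      have "eq_below T (\<kappa> \<star> ?u) (?u \<star> (\<lambda>t. one T t - (one T \<star> h) t))"
        unfolding star_commute[of \<kappa>] by (intro eq_below_star eq_below_refl eq ca)
      also have "eq_below T (?u \<star> (\<lambda>t. one T t - (one T \<star> h) t)) (\<lambda>t. (?u \<star> one T) t - (?u \<star> (one T \<star> h)) t)"
        by (intro eq_below_star_diff ca)
      also have "eq_below T (\<lambda>t. (?u \<star> one T) t - (?u \<star> (one T \<star> h)) t) (\<lambda>t. (one T \<star> ?u) t - (one T \<star> (h \<star> ?u)) t)"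
        unfolding star_commute[of ?u "one T"] star_commute[of h ?u]
        by (intro eq_below_diff eq_below_refl eq_below_left_commute ca)
      also have "eq_below T (\<lambda>t. (one T \<star> ?u) t - (one T \<star> (h \<star> ?u)) t) (one T \<star> ?f)"
        unfolding f_def by (intro eq_below_sym[OF eq_below_star_diff] ca)
      finally have Fp: "AE t in lborel. t < T \<longrightarrow> F t x = prim ?f t"
        unfolding eq_below_def F_def
        by eventually_elim (use one_star_eq_prim[OF elim(2)] in auto)
      have "AE t in lborel. t + ?d n < T \<longrightarrow> F (t + ?d n) x = prim ?f (t + ?d n)"
        using AE_reflect[OF AE_reflect[OF Fp, of "0"], of "- ?d n"] by (simp add: algebra_simps)
      then show ?case using Fp
      proof eventually_elim
        case (elim t)
        have "?d n > 0" by simp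
        then have "t + ?d n < T \<longrightarrow> t < T" by linarith
        then show ?case using elim fdiff_star_eq[OF causalD(1)[OF \<open>causal ?f\<close>], of n t] by auto
      qed
    qed
  qed
  then have q: "AE t in lborel. AE x in M. \<forall>n. t + ?d n < T \<longrightarrow> ?q n t x = ?p n t x"
    by (simp add: AE_all_countable)
  have fi: "integrable (lborel \<Otimes>\<^sub>M M) (\<lambda>p. f (fst p) (snd p))"
  proof -
    have "emeasure M (space M) < \<infinity>" by (metis emeasure_finite infinity_ennreal_def top.not_eq_extremum)
    then have "L2 (\<lambda>x. 1)" by (simp add: L2_def)
    from mixed_integrable_L2[OF f this] show ?thesis by (simp add: case_prod_unfold)
  qed
  let ?g = "\<lambda>n p. ?p n (fst p) (snd p) - f (fst p) (snd p)"
  have gi: "integrable (lborel \<Otimes>\<^sub>M M) (?g n)" for n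
  proof -
    have "integrable (lborel \<Otimes>\<^sub>M M) (\<lambda>p. ?p n (fst p) (snd p))"
    proof (rule integrableI_bounded)
      have "(\<integral>\<^sup>+p. ennreal (norm (?p n (fst p) (snd p))) \<partial>(lborel \<Otimes>\<^sub>M M)) = (\<integral>\<^sup>+x. \<integral>\<^sup>+t. ennreal \<bar>?p n t x\<bar> \<partial>lborel \<partial>M)"
        by (subst P.nn_integral_snd[symmetric]) auto
      also have "\<dots> \<le> (\<integral>\<^sup>+x. (\<integral>\<^sup>+t. ennreal \<bar>fdiff n t\<bar> \<partial>lborel) * (\<integral>\<^sup>+t. ennreal \<bar>f t x\<bar> \<partial>lborel) \<partial>M)"
        by (intro nn_integral_mono nn_integral_star_le fdm) measurable
      also have "\<dots> = (\<integral>\<^sup>+t. ennreal \<bar>fdiff n t\<bar> \<partial>lborel) * (\<integral>\<^sup>+x. (\<integral>\<^sup>+t. ennreal \<bar>f t x\<bar> \<partial>lborel) \<partial>M)"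
        by (rule nn_integral_cmult) measurable
      also have "(\<integral>\<^sup>+x. (\<integral>\<^sup>+t. ennreal \<bar>f t x\<bar> \<partial>lborel) \<partial>M) = (\<integral>\<^sup>+p. ennreal (norm (f (fst p) (snd p))) \<partial>(lborel \<Otimes>\<^sub>M M))"
        by (subst P.nn_integral_snd[symmetric]) auto
      also have "(\<integral>\<^sup>+t. ennreal \<bar>fdiff n t\<bar> \<partial>lborel) * \<dots> < \<infinity>"
        using fi fdiff_integrable[of n] unfolding integrable_iff_bounded by (simp add: ennreal_mult_less_top)
      finally show "(\<integral>\<^sup>+p. ennreal (norm (?p n (fst p) (snd p))) \<partial>(lborel \<Otimes>\<^sub>M M)) < \<infinity>" .
    qed measurable
    then show ?thesis using fi by (rule Bochner_Integration.integrable_diff)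
  qed
  have "(\<lambda>n. LINT p|(lborel \<Otimes>\<^sub>M M). norm (?g n p)) \<longlonglongrightarrow> 0"
  proof -
    let ?E = "\<lambda>n x. LINT t|lborel. \<bar>?p n t x - f t x\<bar>"
    have abs_i: "integrable (lborel \<Otimes>\<^sub>M M) (\<lambda>(t, x). \<bar>?p n t x - f t x\<bar>)" for n
      using integrable_abs[OF gi[of n]] by (simp add: case_prod_unfold)
    have fabs_i: "integrable (lborel \<Otimes>\<^sub>M M) (\<lambda>(t, x). \<bar>f t x\<bar>)"
      using integrable_abs[OF fi] by (simp add: case_prod_unfold)
    have "(\<lambda>n. LINT x|M. ?E n x) \<longlonglongrightarrow> (LINT x|M. 0)"
    proof (rule integral_dominated_convergence)
      show "integrable M (\<lambda>x. 2 * (LINT t|lborel. \<bar>f t x\<bar>))"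
        by (intro integrable_mult_right P.integrable_snd[OF fabs_i])
      show "?E n \<in> borel_measurable M" for n
        using P.integrable_snd[OF abs_i[of n]] by (rule borel_measurable_integrable)
      show "AE x in M. (\<lambda>n. ?E n x) \<longlonglongrightarrow> 0"
        using mixed_AE_causal[OF f]
        by eventually_elim (use fdiff_conv_integrable causalD(1) in \<open>auto simp: fdiff_conv_def\<close>)
      show "AE x in M. norm (?E n x) \<le> 2 * (LINT t|lborel. \<bar>f t x\<bar>)" for n
        using mixed_AE_causal[OF f]
      proof eventually_elim
        case (elim x)
        have "?E n x \<le> 2 * (LINT t|lborel. \<bar>f t x\<bar>)"
          using fdiff_err_triangle[OF causalD(1)[OF elim], of "\<lambda>t. 0" n] by (simp add: star_def)
        moreover have "0 \<le> ?E n x" by (intro integral_nonneg_AE) auto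
        ultimately show ?case by simp
      qed
    qed auto
    moreover have "(LINT p|(lborel \<Otimes>\<^sub>M M). norm (?g n p)) = (LINT x|M. ?E n x)" for n
      using P.integral_snd[OF abs_i[of n]] by (simp add: case_prod_unfold)
    ultimately show ?thesis by simp
  qed
  from tendsto_L1_AE_subseq[OF gi this] obtain r where r: "strict_mono r"
    "AE p in lborel \<Otimes>\<^sub>M M. (\<lambda>n. ?g (r n) p) \<longlonglongrightarrow> 0" by auto
  from P.AE_pair[OF r(2)] q show ?thesis
  proof eventually_elim
    case (elim t)
    from elim(1,2) show ?case
    proof eventually_elim
      case (elim x)
      show ?case
      proof (intro impI allI)
        fix D assume t: "t < T" and D: "((\<lambda>s. (\<kappa> \<star> (\<lambda>\<tau>. u \<tau> x)) s) has_real_derivative D) (at t)"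
        have "((\<lambda>h. (F (t + h) x - F t x) / h) \<longlongrightarrow> D) (at 0)"
          using D unfolding DERIV_def F_def .
        moreover have dl: "filterlim (\<lambda>n. ?d n) (at 0) sequentially"
          unfolding filterlim_at using LIMSEQ_inverse_real_of_nat by (auto simp: inverse_eq_divide)
        ultimately have "(\<lambda>n. (F (t + ?d n) x - F t x) / ?d n) \<longlonglongrightarrow> D"
          by (rule filterlim_compose)
        then have "(\<lambda>n. ?q n t x) \<longlonglongrightarrow> D" by (simp add: mult.commute)
        then have 1: "(\<lambda>n. ?q (r n) t x) \<longlonglongrightarrow> D"
          using LIMSEQ_subseq_LIMSEQ[OF _ r(1)] by (simp add: o_def)
        obtain N where N: "?d N < T - t" using nat_approx_posE[of "T - t"] t by auto
        have "?q (r n) t x = ?p (r n) t x" if "n \<ge> N" for n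
        proof -
          have "?d (r n) \<le> ?d N" using seq_suble[OF r(1), of n] that by (simp add: frac_le)
          then show ?thesis using N elim(2) by (auto simp del: of_nat_Suc)
        qed
        then have "\<forall>\<^sub>F n in sequentially. ?q (r n) t x = ?p (r n) t x"
          by (auto simp: eventually_sequentially)
        from Lim_transform_eventually[OF 1 this] have "(\<lambda>n. ?p (r n) t x) \<longlonglongrightarrow> D" .
        moreover have "(\<lambda>n. ?p (r n) t x) \<longlonglongrightarrow> f t x"
          using elim(1) by (simp add: LIM_zero_iff)
        ultimately have "D = f t x" by (rule LIMSEQ_unique)
        then show "D = u t x - (h \<diamond> u) t x" by (simp add: f_def)
      qed
    qed
  qed
qed

end

section \<open>The tested equation\<close>

lemma causal_sum: "finite I \<Longrightarrow> (\<And>i. i \<in> I \<Longrightarrow> causal (f i)) \<Longrightarrow> causal (\<lambda>t. \<Sum>i\<in>I. f i t)"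
  by (induction I rule: finite_induct) (auto simp: causal_zero intro: causal_add)

lemma eq_below_sum:
  assumes "finite I" "\<And>i. i \<in> I \<Longrightarrow> eq_below T (f i) (g i)"
  shows "eq_below T (\<lambda>t. \<Sum>i\<in>I. f i t) (\<lambda>t. \<Sum>i\<in>I. g i t)"
  using assms by (induction I rule: finite_induct) (auto simp: eq_below_refl intro: eq_below_add)

lemma eq_below_star_sum:
  assumes "finite I" "causal f" "\<And>i. i \<in> I \<Longrightarrow> causal (g i)"
  shows "eq_below T (f \<star> (\<lambda>t. \<Sum>i\<in>I. c i * g i t)) (\<lambda>t. \<Sum>i\<in>I. c i * (f \<star> g i) t)"
  using assms(1,3)
proof (induction I rule: finite_induct)
  case empty
  then show ?case by (simp add: eq_below_def star_def)
next
  case (insert i I)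
  have "eq_below T (f \<star> (\<lambda>t. c i * g i t + (\<Sum>i\<in>I. c i * g i t)))
     (\<lambda>t. (f \<star> (\<lambda>t. c i * g i t)) t + (f \<star> (\<lambda>t. \<Sum>i\<in>I. c i * g i t)) t)"
    using insert by (intro eq_below_star_add assms(2) causal_scale causal_sum) auto
  also have "eq_below T (\<lambda>t. (f \<star> (\<lambda>t. c i * g i t)) t + (f \<star> (\<lambda>t. \<Sum>i\<in>I. c i * g i t)) t)
     (\<lambda>t. c i * (f \<star> g i) t + (\<Sum>i\<in>I. c i * (f \<star> g i) t))"
    using insert by (intro eq_below_add) (auto simp: eq_below_def star_scale_right)
  finally show ?case using insert by simp
qed

lemma causal_cut:
  assumes "L1loc f" "T > 0" shows "causal (\<lambda>t. one T t * f t)"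
  using assms unfolding L1loc_def set_integrable_def
  by (intro causalI) (auto simp: one_def)

text \<open>
With \<open>C = A - B\<close> the equation reads \<open>A = h * C\<close>. Convolving \<open>l = h + h * l\<close> with \<open>C\<close> gives
\<open>l * C = A + l * A\<close>, that is \<open>A + l * B = 0\<close>.
\<close>

lemma resolvent_inversion:
  assumes h: "causal h" and l: "causal l" and A: "causal A" and B: "causal B"
    and hl: "eq_below T l (\<lambda>t. h t + (h \<star> l) t)"
    and eq: "eq_below T A (\<lambda>t. (h \<star> A) t - (h \<star> B) t)"
  shows "eq_below T (\<lambda>t. A t + (l \<star> B) t) (\<lambda>t. 0)"
proof -
  let ?C = "\<lambda>t. A t - B t"
  note ca = causal_intros h l A B
  have AC: "eq_below T A (h \<star> ?C)"
    using eq by (rule eq_below_trans) (intro eq_below_sym[OF eq_below_star_diff] ca)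
  have "eq_below T (l \<star> ?C) (?C \<star> (\<lambda>t. h t + (h \<star> l) t))"
    unfolding star_commute[of l] by (intro eq_below_star eq_below_refl hl ca)
  also have "eq_below T (?C \<star> (\<lambda>t. h t + (h \<star> l) t)) (\<lambda>t. (?C \<star> h) t + (?C \<star> (h \<star> l)) t)"
    by (intro eq_below_star_add ca)
  also have "eq_below T (\<lambda>t. (?C \<star> h) t + (?C \<star> (h \<star> l)) t) (\<lambda>t. A t + (l \<star> A) t)"
  proof (rule eq_below_add)
    show "eq_below T (?C \<star> h) A" using eq_below_sym[OF AC] by (simp add: star_commute)
    have "eq_below T (?C \<star> (h \<star> l)) (l \<star> (h \<star> ?C))"
      using eq_below_assoc[OF l h _, of ?C T] by (simp add: star_commute[of ?C] star_commute[of l h] eq_below_sym causal_diff A B)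
    also have "eq_below T (l \<star> (h \<star> ?C)) (l \<star> A)"
      by (intro eq_below_star eq_below_refl eq_below_sym[OF AC] ca)
    finally show "eq_below T (?C \<star> (h \<star> l)) (l \<star> A)" .
  qed
  finally have 1: "eq_below T (l \<star> ?C) (\<lambda>t. A t + (l \<star> A) t)" .
  have 2: "eq_below T (l \<star> ?C) (\<lambda>t. (l \<star> A) t - (l \<star> B) t)" by (intro eq_below_star_diff ca)
  from 1 2 show ?thesis unfolding eq_below_def by eventually_elim auto
qed

text \<open>
Convolve \<open>l = h + h * l\<close> with \<open>k\<close> and use \<open>k * l = 1\<close>.
\<close>

lemma resolvent_kernel:
  assumes k: "causal k" and h: "causal h" and l: "causal l"
    and kl: "eq_below T (k \<star> l) (one T)" and hl: "eq_below T l (\<lambda>t. h t + (h \<star> l) t)"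
  shows "eq_below T (k \<star> h) (\<lambda>t. one T t - (one T \<star> h) t)"
proof -
  note ca = causal_intros h l k
  have "eq_below T (k \<star> l) (k \<star> (\<lambda>t. h t + (h \<star> l) t))" by (intro eq_below_star eq_below_refl hl ca)
  also have "eq_below T (k \<star> (\<lambda>t. h t + (h \<star> l) t)) (\<lambda>t. (k \<star> h) t + (k \<star> (h \<star> l)) t)"
    by (intro eq_below_star_add ca)
  also have "eq_below T (\<lambda>t. (k \<star> h) t + (k \<star> (h \<star> l)) t) (\<lambda>t. (k \<star> h) t + (one T \<star> h) t)"
  proof (intro eq_below_add eq_below_refl)
    have "eq_below T (k \<star> (h \<star> l)) (h \<star> (k \<star> l))" by (intro eq_below_left_commute ca)
    also have "eq_below T (h \<star> (k \<star> l)) (one T \<star> h)"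
      unfolding star_commute[of "one T"] by (intro eq_below_star eq_below_refl kl ca)
    finally show "eq_below T (k \<star> (h \<star> l)) (one T \<star> h)" .
  qed
  finally show ?thesis using kl unfolding eq_below_def by eventually_elim auto
qed

context finite_measure begin

interpretation P: pair_sigma_finite "lborel :: real measure" M by unfold_locales

lemma pairing_sum:
  assumes "finite I" "\<And>i. i \<in> I \<Longrightarrow> mixed (u i)" "L2 \<psi>"
  shows "eq_below T (pairing \<psi> (\<lambda>t x. \<Sum>i\<in>I. c i * u i t x)) (\<lambda>t. \<Sum>i\<in>I. c i * pairing \<psi> (u i) t)"
proof -
  have "AE t in lborel. \<forall>i\<in>I. integrable M (\<lambda>x. u i t x * \<psi> x)"
    using assms by (intro AE_finite_allI pairing_AE_integrable) auto
  then show ?thesis unfolding eq_below_def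
  proof eventually_elim
    case (elim t)
    have "(\<lambda>x. (\<Sum>i\<in>I. c i * u i t x) * \<psi> x) = (\<lambda>x. \<Sum>i\<in>I. c i * (u i t x * \<psi> x))"
      by (simp add: sum_distrib_right mult.assoc)
    then show ?case unfolding pairing_def using elim by simp
  qed
qed

text \<open>
For fixed test data \<open>\<psi>\<close>, \<open>g\<close> the equations concern only the scalar functions \<open>t \<mapsto> \<integral> u i t x \<psi> x\<close>
and \<open>t \<mapsto> \<integral> G i j t x g j x\<close>. Convolutions commute with the integrals over the domain, so
\<open>resolvent_inversion\<close> applies to the weighted sums, and the resulting convolution with \<open>l\<close> is moved
back under the integral.
\<close>

lemma tested_equation:
  fixes u :: "'i \<Rightarrow> real \<Rightarrow> 'a \<Rightarrow> real" and N :: nat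
  assumes h: "causal h" and l: "causal l" and hl: "eq_below T l (\<lambda>t. h t + (h \<star> l) t)"
    and I: "finite I" and u: "\<And>i. i \<in> I \<Longrightarrow> mixed (u i)" and G: "\<And>i j. i \<in> I \<Longrightarrow> j < N \<Longrightarrow> mixed (G i j)"
    and \<psi>: "L2 \<psi>" and g: "\<And>j. j < N \<Longrightarrow> L2 (g j)"
    and eq: "AE t in lborel. t < T \<longrightarrow> (\<Sum>i\<in>I. \<alpha> i * (LINT x|M. \<psi> x * (u i t x - (h \<diamond> u i) t x) +
        d i * (\<Sum>j<N. (h \<diamond> G i j) t x * g j x))) = 0"
  shows "AE t in lborel. t < T \<longrightarrow> (LINT x|M. (\<Sum>i\<in>I. \<alpha> i * u i t x) * \<psi> x) +
     (\<Sum>j<N. LINT x|M. (l \<star> (\<lambda>\<tau>. \<Sum>i\<in>I. \<alpha> i * d i * G i j \<tau> x)) t * g j x) = 0"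
proof -
  let ?A = "\<lambda>i. pairing \<psi> (u i)" and ?B = "\<lambda>i j. pairing (g j) (G i j)"
  let ?W = "\<lambda>t x. \<Sum>i\<in>I. \<alpha> i * u i t x" and ?Gz = "\<lambda>j t x. \<Sum>i\<in>I. \<alpha> i * d i * G i j t x"
  have W: "mixed ?W" using I u by (intro mixed_sum mixed_scale)
  have Gz: "mixed (?Gz j)" if "j < N" for j using I G that by (intro mixed_sum mixed_scale)
  have cA: "causal (?A i)" if "i \<in> I" for i using pairing_causal[OF u \<psi>] that by simp
  have cB: "causal (?B i j)" if "i \<in> I" "j < N" for i j using pairing_causal[OF G g] that by simp
  have cBz: "causal (pairing (g j) (?Gz j))" if "j < N" for j using pairing_causal[OF Gz g] that by simp
  let ?Bs = "\<lambda>t. \<Sum>j\<in>{..<N}. 1 * pairing (g j) (?Gz j) t"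
  have cBs: "causal ?Bs" by (intro causal_sum causal_scale cBz) auto
  have s1: "eq_below T (\<lambda>t. \<Sum>i\<in>I. \<alpha> i * ((?A i t - (h \<star> ?A i) t) + d i * (\<Sum>j<N. (h \<star> ?B i j) t))) (\<lambda>t. 0)"
  proof -
    have 1: "AE t in lborel. \<forall>i\<in>I. integrable M (\<lambda>x. u i t x * \<psi> x)"
      using I u \<psi> by (intro AE_finite_allI pairing_AE_integrable) auto
    have 2: "AE t in lborel. \<forall>i\<in>I. integrable M (\<lambda>x. (h \<diamond> u i) t x * \<psi> x)"
      using I u \<psi> h by (intro AE_finite_allI pairing_AE_integrable mixed_star) auto
    have 3: "AE t in lborel. \<forall>i\<in>I. \<forall>j\<in>{..<N}. integrable M (\<lambda>x. (h \<diamond> G i j) t x * g j x)"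
      using I G g h by (intro AE_finite_allI pairing_AE_integrable mixed_star) auto
    have 4: "AE t in lborel. \<forall>i\<in>I. pairing \<psi> (\<lambda>t x. (h \<diamond> u i) t x) t = (h \<star> ?A i) t"
      using I u \<psi> h by (intro AE_finite_allI pairing_star) auto
    have 5: "AE t in lborel. \<forall>i\<in>I. \<forall>j\<in>{..<N}. pairing (g j) (\<lambda>t x. (h \<diamond> G i j) t x) t = (h \<star> ?B i j) t"
      using I G g h by (intro AE_finite_allI pairing_star) auto
    show ?thesis unfolding eq_below_def
      using eq 1 2 3 4 5
    proof eventually_elim
      case (elim t)
      have "(LINT x|M. \<psi> x * (u i t x - (h \<diamond> u i) t x) + d i * (\<Sum>j<N. (h \<diamond> G i j) t x * g j x)) =
         (?A i t - (h \<star> ?A i) t) + d i * (\<Sum>j<N. (h \<star> ?B i j) t)" if i: "i \<in> I" for i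
      proof -
        have "(LINT x|M. \<psi> x * (u i t x - (h \<diamond> u i) t x) + d i * (\<Sum>j<N. (h \<diamond> G i j) t x * g j x)) =
          (LINT x|M. (u i t x * \<psi> x - (h \<diamond> u i) t x * \<psi> x) + d i * (\<Sum>j<N. (h \<diamond> G i j) t x * g j x))"
          by (simp add: algebra_simps)
        also have "\<dots> = ((LINT x|M. u i t x * \<psi> x) - (LINT x|M. (h \<diamond> u i) t x * \<psi> x)) +
           d i * (\<Sum>j<N. LINT x|M. (h \<diamond> G i j) t x * g j x)"
          using elim i by (subst Bochner_Integration.integral_add) (auto simp: Bochner_Integration.integral_sum)
        also have "\<dots> = (?A i t - (h \<star> ?A i) t) + d i * (\<Sum>j<N. (h \<star> ?B i j) t)"
          using elim(5,6) i unfolding pairing_def by simp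
        finally show ?thesis .
      qed
      with elim(1) show ?case by simp
    qed
  qed
  have W1: "eq_below T (pairing \<psi> ?W) (\<lambda>t. \<Sum>i\<in>I. \<alpha> i * ?A i t)" by (rule pairing_sum[OF I u \<psi>])
  have W2: "eq_below T (h \<star> pairing \<psi> ?W) (\<lambda>t. \<Sum>i\<in>I. \<alpha> i * (h \<star> ?A i) t)"
  proof -
    have "eq_below T (h \<star> pairing \<psi> ?W) (h \<star> (\<lambda>t. \<Sum>i\<in>I. \<alpha> i * ?A i t))"
      by (intro eq_below_star eq_below_refl W1 h pairing_causal W \<psi> causal_sum causal_scale I u)
    also have "eq_below T (h \<star> (\<lambda>t. \<Sum>i\<in>I. \<alpha> i * ?A i t)) (\<lambda>t. \<Sum>i\<in>I. \<alpha> i * (h \<star> ?A i) t)"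
      by (intro eq_below_star_sum I h cA)
    finally show ?thesis .
  qed
  have B2: "eq_below T (h \<star> ?Bs) (\<lambda>t. \<Sum>j\<in>{..<N}. 1 * (\<Sum>i\<in>I. \<alpha> i * d i * (h \<star> ?B i j) t))"
  proof -
    have "eq_below T (h \<star> ?Bs) (\<lambda>t. \<Sum>j\<in>{..<N}. 1 * (h \<star> pairing (g j) (?Gz j)) t)"
      by (intro eq_below_star_sum h cBz) auto
    also have "eq_below T (\<lambda>t. \<Sum>j\<in>{..<N}. 1 * (h \<star> pairing (g j) (?Gz j)) t) (\<lambda>t. \<Sum>j\<in>{..<N}. 1 * (\<Sum>i\<in>I. \<alpha> i * d i * (h \<star> ?B i j) t))"
    proof (rule eq_below_sum)
      fix j assume "j \<in> {..<N}"
      then have j: "j < N" by simp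
      have "eq_below T (h \<star> pairing (g j) (?Gz j)) (h \<star> (\<lambda>t. \<Sum>i\<in>I. \<alpha> i * d i * ?B i j t))"
        using I cB j by (intro eq_below_star eq_below_refl pairing_sum h pairing_causal Gz G g causal_sum causal_scale)
      also have "eq_below T (h \<star> (\<lambda>t. \<Sum>i\<in>I. \<alpha> i * d i * ?B i j t)) (\<lambda>t. \<Sum>i\<in>I. \<alpha> i * d i * (h \<star> ?B i j) t)"
        by (intro eq_below_star_sum I h cB j)
      finally show "eq_below T (\<lambda>t. 1 * (h \<star> pairing (g j) (?Gz j)) t) (\<lambda>t. 1 * (\<Sum>i\<in>I. \<alpha> i * d i * (h \<star> ?B i j) t))"
        by simp
    qed simp
    finally show ?thesis .
  qed
  have main: "eq_below T (\<lambda>t. pairing \<psi> ?W t + (l \<star> ?Bs) t) (\<lambda>t. 0)"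
  proof (rule resolvent_inversion[OF h l pairing_causal[OF W \<psi>] cBs hl])
    show "eq_below T (pairing \<psi> ?W) (\<lambda>t. (h \<star> pairing \<psi> ?W) t - (h \<star> ?Bs) t)"
      using s1 W1 W2 B2 unfolding eq_below_def
    proof eventually_elim
      case (elim t)
      show ?case
      proof
        assume t: "t < T"
        have "(\<Sum>j\<in>{..<N}. 1 * (\<Sum>i\<in>I. \<alpha> i * d i * (h \<star> ?B i j) t)) = (\<Sum>i\<in>I. \<alpha> i * (d i * (\<Sum>j<N. (h \<star> ?B i j) t)))"
          unfolding mult_1 by (subst sum.swap) (simp add: sum_distrib_left mult.assoc)
        moreover have "(\<Sum>i\<in>I. \<alpha> i * ?A i t) - (\<Sum>i\<in>I. \<alpha> i * (h \<star> ?A i) t) + (\<Sum>i\<in>I. \<alpha> i * (d i * (\<Sum>j<N. (h \<star> ?B i j) t))) = 0"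
          using elim(1) t by (simp add: distrib_left right_diff_distrib sum.distrib sum_subtractf)
        ultimately show "pairing \<psi> ?W t = (h \<star> pairing \<psi> ?W) t - (h \<star> ?Bs) t"
          using elim(2-4) t by simp
      qed
    qed
  qed
  have "eq_below T (l \<star> ?Bs) (\<lambda>t. \<Sum>j\<in>{..<N}. 1 * (l \<star> pairing (g j) (?Gz j)) t)"
    by (intro eq_below_star_sum l cBz) auto
  moreover have "AE t in lborel. \<forall>j\<in>{..<N}. pairing (g j) (\<lambda>t x. (l \<diamond> ?Gz j) t x) t = (l \<star> pairing (g j) (?Gz j)) t"
    using Gz g l by (intro AE_finite_allI pairing_star) auto
  ultimately show ?thesis using main unfolding eq_below_def
    by eventually_elim (simp add: pairing_def)
qed

end

section \<open>The space-time domain and the kernels of the problem\<close>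

text \<open>
The estimate of the measure by that of a box also covers the case in which \<open>\<Omega>\<close> is not known to be
measurable, since \<open>emeasure\<close> is then 0.
\<close>

lemma finite_measure_dom_measure:
  assumes "\<Omega> \<subseteq> topspace (powertop_real {..<N})" and B: "\<And>x j. x \<in> \<Omega> \<Longrightarrow> j < N \<Longrightarrow> \<bar>x j\<bar> \<le> B"
  shows "finite_measure (dom_measure N \<Omega>)" and "space (dom_measure N \<Omega>) = \<Omega>"
proof -
  interpret product_sigma_finite "\<lambda>_::nat. lborel :: real measure" ..
  let ?P = "Pi\<^sub>M {..<N} (\<lambda>_::nat. lborel :: real measure)"
  have \<Omega>: "\<Omega> \<subseteq> space ?P" using assms(1) by (auto simp: space_PiM)
  show sp: "space (dom_measure N \<Omega>) = \<Omega>" using \<Omega> by (auto simp: dom_measure_def space_restrict_space)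
  let ?box = "PiE {..<N} (\<lambda>_::nat. {-B..B})"
  have box: "\<Omega> \<subseteq> ?box"
  proof
    fix x assume x: "x \<in> \<Omega>"
    have "-B \<le> x j \<and> x j \<le> B" if "j < N" for j using B[OF x that] by linarith
    with x \<Omega> show "x \<in> ?box" by (auto simp: space_PiM PiE_iff)
  qed
  have "emeasure ?P ?box = (\<Prod>i<N. emeasure lborel {-B..B})" by (rule emeasure_PiM) auto
  also have "\<dots> < \<infinity>"
  proof -
    have "emeasure lborel {-B..B} < \<infinity>" by (cases "0 \<le> B") auto
    then show ?thesis by (simp add: power_less_top_ennreal)
  qed
  finally have fb: "emeasure ?P ?box < \<infinity>" .
  have "emeasure ?P \<Omega> < \<infinity>"
  proof (cases "\<Omega> \<in> sets ?P")
    case True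
    have "emeasure ?P \<Omega> \<le> emeasure ?P ?box" by (rule emeasure_mono[OF box]) (auto intro!: sets_PiM_I_finite)
    then show ?thesis using fb by simp
  qed (simp add: emeasure_notin_sets)
  moreover have "emeasure (dom_measure N \<Omega>) \<Omega> \<le> emeasure ?P \<Omega>"
    using \<Omega> unfolding dom_measure_def restrict_space_def emeasure_measure_of_conv by (auto simp: Int_absorb2)
  ultimately show "finite_measure (dom_measure N \<Omega>)"
    by (intro finite_measureI) (auto simp: sp)
qed

context finite_measure begin

text \<open>
Outside \<open>(0, T)\<close> the time is replaced by \<open>T / 2\<close> before \<open>f\<close> is applied, because nothing is known
about the values of \<open>f\<close> there.
\<close>

lemma cyl_extend_measurable:
  fixes f :: "real \<Rightarrow> 'a \<Rightarrow> real"
  assumes "(\<lambda>(t, x). f t x) \<in> borel_measurable (restrict_space lborel {0<..<T} \<Otimes>\<^sub>M M)"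
  shows "(\<lambda>(t, x). one T t * f t x) \<in> borel_measurable (lborel \<Otimes>\<^sub>M M)"
proof (cases "T > 0")
  case True
  let ?\<phi> = "\<lambda>p. (if fst p \<in> {0<..<T} then fst p else T / 2, snd p)"
  have "?\<phi> \<in> lborel \<Otimes>\<^sub>M M \<rightarrow>\<^sub>M restrict_space lborel {0<..<T} \<Otimes>\<^sub>M M"
    using True by (intro measurable_Pair measurable_restrict_space2) auto
  from measurable_compose[OF this assms] have [measurable]: "(\<lambda>p. f (fst (?\<phi> p)) (snd (?\<phi> p))) \<in> borel_measurable (lborel \<Otimes>\<^sub>M M)"
    by (simp add: case_prod_unfold)
  note [measurable] = causalD(3)[OF causal_one, of T]
  have "(\<lambda>p. one T (fst p) * f (fst (?\<phi> p)) (snd (?\<phi> p))) \<in> borel_measurable (lborel \<Otimes>\<^sub>M M)" by measurable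
  moreover have "(\<lambda>p. one T (fst p) * f (fst (?\<phi> p)) (snd (?\<phi> p))) = (\<lambda>(t, x). one T t * f t x)"
    by (auto simp: one_def split: split_indicator)
  ultimately show ?thesis by simp
next
  case False
  then have "one T t = 0" for t by (auto simp: one_def)
  then show ?thesis by simp
qed

lemma cyl_nn_integral:
  fixes T :: real
  assumes [measurable]: "g \<in> borel_measurable (restrict_space lborel {0<..<T} \<Otimes>\<^sub>M M)"
  shows "(\<integral>\<^sup>+p. g p \<partial>(restrict_space lborel {0<..<T} \<Otimes>\<^sub>M M)) = (\<integral>\<^sup>+x. \<integral>\<^sup>+t. g (t, x) * indicator {0<..<T} t \<partial>lborel \<partial>M)"
proof -
  interpret R: finite_measure "restrict_space lborel {0<..<T}"
  proof (rule finite_measureI)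
    have "emeasure (restrict_space lborel {0<..<T}) {0<..<T} = emeasure lborel {0<..<T}"
      by (rule emeasure_restrict_space) simp_all
    then show "emeasure (restrict_space lborel {0<..<T}) (space (restrict_space lborel {0<..<T})) \<noteq> \<infinity>"
      by (cases "0 \<le> T") (auto simp: space_restrict_space)
  qed
  interpret PR: pair_sigma_finite "restrict_space lborel {0<..<T}" M ..
  have "(\<integral>\<^sup>+p. g p \<partial>(restrict_space lborel {0<..<T} \<Otimes>\<^sub>M M)) = (\<integral>\<^sup>+x. \<integral>\<^sup>+t. g (t, x) \<partial>restrict_space lborel {0<..<T} \<partial>M)"
    by (rule PR.nn_integral_snd[symmetric]) measurable
  also have "\<dots> = (\<integral>\<^sup>+x. \<integral>\<^sup>+t. g (t, x) * indicator {0<..<T} t \<partial>lborel \<partial>M)"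
    by (intro nn_integral_cong nn_integral_restrict_space) auto
  finally show ?thesis .
qed

lemma in_Lp_nn_integral_finite:
  assumes "in_Lp K p f" shows "(\<integral>\<^sup>+y. ennreal (\<bar>f y\<bar> powr p) \<partial>K) < \<infinity>"
  using assms unfolding in_Lp_def integrable_iff_bounded by simp

lemma cyl_L2_mixed:
  fixes f :: "real \<Rightarrow> 'a \<Rightarrow> real"
  assumes f: "in_Lp (restrict_space lborel {0<..<T} \<Otimes>\<^sub>M M) 2 (\<lambda>(t, x). f t x)"
  shows "mixed (\<lambda>t x. one T t * f t x)"
    and "(\<integral>\<^sup>+x. (\<integral>\<^sup>+t. (ennreal \<bar>one T t * f t x\<bar>)\<^sup>2 \<partial>lborel) \<partial>M) < \<infinity>"
proof -
  have m: "(\<lambda>(t, x). f t x) \<in> borel_measurable (restrict_space lborel {0<..<T} \<Otimes>\<^sub>M M)"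
    using f by (simp add: in_Lp_def)
  have "(\<integral>\<^sup>+x. (\<integral>\<^sup>+t. (ennreal \<bar>one T t * f t x\<bar>)\<^sup>2 \<partial>lborel) \<partial>M) =
    (\<integral>\<^sup>+x. \<integral>\<^sup>+t. ennreal (\<bar>case (t, x) of (t, x) \<Rightarrow> f t x\<bar> powr 2) * indicator {0<..<T} t \<partial>lborel \<partial>M)"
    by (intro nn_integral_cong) (auto simp: one_def ennreal_power powr_numeral split: split_indicator)
  also have "\<dots> = (\<integral>\<^sup>+p. ennreal (\<bar>case p of (t, x) \<Rightarrow> f t x\<bar> powr 2) \<partial>(restrict_space lborel {0<..<T} \<Otimes>\<^sub>M M))"
  proof (rule cyl_nn_integral[symmetric])
    have "(\<lambda>y::real. ennreal (\<bar>y\<bar> powr 2)) \<in> borel \<rightarrow>\<^sub>M borel" by measurable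
    from measurable_compose[OF m this]
    show "(\<lambda>p. ennreal (\<bar>case p of (t, x) \<Rightarrow> f t x\<bar> powr 2)) \<in> borel_measurable (restrict_space lborel {0<..<T} \<Otimes>\<^sub>M M)" .
  qed
  also have "\<dots> < \<infinity>" by (rule in_Lp_nn_integral_finite[OF f])
  finally show fin: "(\<integral>\<^sup>+x. (\<integral>\<^sup>+t. (ennreal \<bar>one T t * f t x\<bar>)\<^sup>2 \<partial>lborel) \<partial>M) < \<infinity>" .
  show "mixed (\<lambda>t x. one T t * f t x)"
    by (rule mixedI_L2[OF cyl_extend_measurable[OF m] _ fin, where T=T]) (auto simp: one_def)
qed

lemma in_Lp_2_L2: "in_Lp M 2 \<psi> \<Longrightarrow> L2 \<psi>"
  using in_Lp_nn_integral_finite[of M 2 \<psi>] by (auto simp: L2_def in_Lp_def ennreal_power powr_numeral)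

lemma in_Linf_mixed:
  assumes "in_Linf M f" shows "mixed (\<lambda>t x. one T t * f x)"
proof -
  obtain B where B: "AE x in M. \<bar>f x\<bar> \<le> B" and [measurable]: "f \<in> borel_measurable M"
    using assms by (auto simp: in_Linf_def)
  note [measurable] = causalD(3)[OF causal_one, of T]
  show ?thesis
  proof (rule mixedI_L2[where T=T])
    have "(\<integral>\<^sup>+x. (\<integral>\<^sup>+t. (ennreal \<bar>one T t * f x\<bar>)\<^sup>2 \<partial>lborel) \<partial>M) \<le> (\<integral>\<^sup>+x. (ennreal B)\<^sup>2 * emeasure lborel {0<..<T} \<partial>M)"
    proof (rule nn_integral_mono_AE)
      show "AE x in M. (\<integral>\<^sup>+t. (ennreal \<bar>one T t * f x\<bar>)\<^sup>2 \<partial>lborel) \<le> (ennreal B)\<^sup>2 * emeasure lborel {0<..<T}"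
        using B
      proof eventually_elim
        case (elim x)
        have "(\<integral>\<^sup>+t. (ennreal \<bar>one T t * f x\<bar>)\<^sup>2 \<partial>lborel) \<le> (\<integral>\<^sup>+t. (ennreal B)\<^sup>2 * indicator {0<..<T} t \<partial>lborel)"
          using elim by (intro nn_integral_mono) (auto simp: one_def split: split_indicator intro!: power_mono ennreal_leI)
        also have "\<dots> = (ennreal B)\<^sup>2 * emeasure lborel {0<..<T}" by (rule nn_integral_cmult_indicator) auto
        finally show ?case .
      qed
    qed
    also have "\<dots> < \<infinity>"
    proof -
      have "emeasure M (space M) < \<infinity>" by (metis emeasure_finite infinity_ennreal_def top.not_eq_extremum)
      moreover have "emeasure lborel {0<..<T} < \<infinity>" by (cases "0 \<le> T") auto
      ultimately show ?thesis by (simp add: ennreal_mult_less_top power2_eq_square)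
    qed
    finally show "(\<integral>\<^sup>+x. (\<integral>\<^sup>+t. (ennreal \<bar>one T t * f x\<bar>)\<^sup>2 \<partial>lborel) \<partial>M) < \<infinity>" .
    show "(\<lambda>(t, x). one T t * f x) \<in> borel_measurable (lborel \<Otimes>\<^sub>M M)" by measurable
  qed (auto simp: one_def)
qed

end

lemma PC_causal:
  assumes PC: "PC k l" and T: "T > 0"
  defines "k' \<equiv> \<lambda>t. one T t * k t" and "l' \<equiv> \<lambda>t. one T t * l t"
  shows "causal k'" "causal l'" "0 \<le> k' t" "0 < s \<Longrightarrow> s \<le> t \<Longrightarrow> k' t \<le> k' s" "eq_below T (k' \<star> l') (one T)"
proof -
  show ck: "causal k'" and cl: "causal l'" using PC T causal_cut by (auto simp: PC_def k'_def l'_def)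
  show "0 \<le> k' t" using PC by (auto simp: k'_def PC_def one_def split: split_indicator)
  show "0 < s \<Longrightarrow> s \<le> t \<Longrightarrow> k' t \<le> k' s" using PC by (auto simp: k'_def PC_def one_def split: split_indicator)
  have "AE t in lborel. 0 < t \<longrightarrow> conv k l t = 1" using PC by (simp add: PC_def)
  then show "eq_below T (k' \<star> l') (one T)" unfolding eq_below_def
  proof eventually_elim
    case (elim t)
    show ?case
    proof
      assume "t < T"
      show "(k' \<star> l') t = one T t"
      proof (cases "t > 0")
        case True
        then show ?thesis using elim conv_eq_star[of t T k l] \<open>t < T\<close> by (simp add: k'_def l'_def one_def)
      next
        case False
        then show ?thesis using causalD(2)[OF causal_star[OF ck cl], of t] by (simp add: one_def)
      qed
    qed
  qed
qed

lemma is_h_causal: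
  assumes h: "is_h l 1 h" and l: "L1loc l" and T: "T > 0"
  defines "h' \<equiv> \<lambda>t. one T t * h t" and "l' \<equiv> \<lambda>t. one T t * l t"
  shows "causal h'" "eq_below T l' (\<lambda>t. h' t + (h' \<star> l') t)"
proof -
  show ch: "causal h'" using h T causal_cut by (auto simp: is_h_def h'_def)
  have cl: "causal l'" using l T causal_cut by (auto simp: l'_def)
  have "AE t in lborel. 0 < t \<longrightarrow> h t + real 1 * conv h l t = real 1 * l t" using h by (simp add: is_h_def)
  then show "eq_below T l' (\<lambda>t. h' t + (h' \<star> l') t)" unfolding eq_below_def
  proof eventually_elim
    case (elim t)
    show ?case
    proof
      assume "t < T"
      show "l' t = h' t + (h' \<star> l') t"
      proof (cases "t > 0")
        case True
        then show ?thesis using elim conv_eq_star[of t T h l] \<open>t < T\<close> by (simp add: h'_def l'_def one_def)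
      next
        case False
        then show ?thesis using causalD(2)[OF causal_star[OF ch cl], of t] causalD(2)[OF ch, of t] causalD(2)[OF cl, of t] by simp
      qed
    qed
  qed
qed

lemma conv_conv_causal:
  assumes k: "L1loc k" and h: "L1loc h" and T: "T > 0"
  defines "k' \<equiv> \<lambda>t. one T t * k t" and "h' \<equiv> \<lambda>t. one T t * h t"
  shows "causal (\<lambda>t. one T t * conv k h t)" "eq_below T (\<lambda>t. one T t * conv k h t) (k' \<star> h')"
proof -
  have ck: "causal k'" and ch: "causal h'" using k h T causal_cut by (auto simp: k'_def h'_def)
  have e: "one T t * conv k h t = indicator {0<..<T} t * (k' \<star> h') t" for t
    using conv_eq_star[of t T k h] by (auto simp: k'_def h'_def one_def split: split_indicator)
  show "causal (\<lambda>t. one T t * conv k h t)" unfolding e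
    by (intro causalI integrable_indicator_times causalD(1)[OF causal_star[OF ck ch]]) auto
  show "eq_below T (\<lambda>t. one T t * conv k h t) (k' \<star> h')"
    unfolding e eq_below_def using causalD(2)[OF causal_star[OF ck ch]] by (auto split: split_indicator)
qed

section \<open>Weak solutions\<close>

lemma conv_scale: "conv k (\<lambda>\<tau>. r * v \<tau>) t = r * conv k v t"
proof -
  have "(\<lambda>\<tau>. indicator {0<..<t} \<tau> *\<^sub>R (k (t - \<tau>) * (r * v \<tau>))) = (\<lambda>\<tau>. r * (indicator {0<..<t} \<tau> *\<^sub>R (k (t - \<tau>) * v \<tau>)))"
    by (auto simp: mult_ac)
  then show ?thesis unfolding conv_def set_lebesgue_integral_def by (simp only: integral_mult_right_zero)
qed

text \<open>
The innermost condition of \<open>weak_solution\<close> for one component, one kernel \<open>h\<close> and one test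
function \<open>\<psi>\<close> with gradient \<open>g\<close>.
\<close>

definition tested_weakly ::
  "real \<Rightarrow> nat \<Rightarrow> (nat \<Rightarrow> real) set \<Rightarrow> (real \<Rightarrow> real) \<Rightarrow> (real \<Rightarrow> real) \<Rightarrow> (nat \<Rightarrow> nat) \<Rightarrow> (nat \<Rightarrow> real) \<Rightarrow>
   real \<Rightarrow> real \<Rightarrow> (nat \<Rightarrow> (nat \<Rightarrow> real) \<Rightarrow> real) \<Rightarrow> (nat \<Rightarrow> real \<Rightarrow> (nat \<Rightarrow> real) \<Rightarrow> real) \<Rightarrow> nat \<Rightarrow>
   (nat \<Rightarrow> real \<Rightarrow> (nat \<Rightarrow> real) \<Rightarrow> real) \<Rightarrow> ((nat \<Rightarrow> real) \<Rightarrow> real) \<Rightarrow> (nat \<Rightarrow> (nat \<Rightarrow> real) \<Rightarrow> real) \<Rightarrow> bool" where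
  "tested_weakly T N \<Omega> k h a d \<nu>f \<nu>b c0 c i G \<psi> g \<longleftrightarrow>
     (AE t in lborel. t \<in> {0<..<T} \<longrightarrow>
        (\<exists>D. (AE x in dom_measure N \<Omega>.
                ((\<lambda>s. conv (conv k h) (\<lambda>\<tau>. c i \<tau> x - c0 i x) s) has_real_derivative D x) (at t)) \<and>
             integrable (dom_measure N \<Omega>) (\<lambda>x. \<psi> x * D x +
                d i * (\<Sum>j<N. conv h (\<lambda>\<tau>. G j \<tau> x) t * g j x)) \<and>
             integrable (dom_measure N \<Omega>) (\<lambda>x.
                conv h (\<lambda>\<tau>. reaction \<nu>f \<nu>b a i (\<lambda>j. c j \<tau> x)) t * \<psi> x) \<and>
             (LINT x|dom_measure N \<Omega>. \<psi> x * D x +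
                d i * (\<Sum>j<N. conv h (\<lambda>\<tau>. G j \<tau> x) t * g j x)) =
             (LINT x|dom_measure N \<Omega>.
                conv h (\<lambda>\<tau>. reaction \<nu>f \<nu>b a i (\<lambda>j. c j \<tau> x)) t * \<psi> x)))"

lemma weak_solution_gradient:
  assumes weak: "weak_solution T N \<Omega> k h m a d \<nu>f \<nu>b c0 c" and i: "i \<in> {1..4}"
  obtains G where "L2_W12_with_grad T N \<Omega> (\<lambda>t x. c i t x powr m) G"
    and "\<And>\<psi> g. W12_with_grad N \<Omega> \<psi> g \<Longrightarrow> tested_weakly T N \<Omega> k (h 1) a d \<nu>f \<nu>b c0 c i G \<psi> g"
proof -
  from conjunct2[OF conjunct2[OF bspec[OF weak[unfolded weak_solution_def, folded tested_weakly_def] i]]]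
  obtain G where G: "L2_W12_with_grad T N \<Omega> (\<lambda>t x. c i t x powr m) G"
    "\<forall>n\<ge>1. \<forall>\<psi> g. W12_with_grad N \<Omega> \<psi> g \<longrightarrow> tested_weakly T N \<Omega> k (h n) a d \<nu>f \<nu>b c0 c i G \<psi> g"
    by blast
  then show thesis by (intro that[of G]) auto
qed

text \<open>
The integrals of \<open>(h * R i) \<psi>\<close> are \<open>\<plusminus> a i\<close> times a common number, with two signs of each kind, so they
cancel in the sum with weights \<open>1 / a i\<close>. What remains has the form required by \<open>tested_equation\<close>
once the derivative \<open>D\<close> is identified.
\<close>

lemma weak_solution_tested:
  fixes N :: nat and a :: "nat \<Rightarrow> nat"
  assumes fin: "finite_measure (dom_measure N \<Omega>)" and sp: "space (dom_measure N \<Omega>) = \<Omega>"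
    and T: "T > 0" and PC: "PC k l" and h: "is_h l 1 (h 1)" and a: "\<And>i. i \<in> {1..4} \<Longrightarrow> a i \<ge> 1"
    and u: "\<And>i. i \<in> {1..4} \<Longrightarrow> finite_measure.mixed (dom_measure N \<Omega>) (u i)"
    and u_eq: "\<And>i \<tau> x. i \<in> {1..4} \<Longrightarrow> x \<in> \<Omega> \<Longrightarrow> u i \<tau> x = one T \<tau> * (c i \<tau> x - c0 i x)"
    and G: "\<And>i j. i \<in> {1..4} \<Longrightarrow> j < N \<Longrightarrow> finite_measure.mixed (dom_measure N \<Omega>) (\<lambda>t x. one T t * G i j t x)"
    and \<psi>: "W12_with_grad N \<Omega> \<psi> g"
    and weak: "\<And>i. i \<in> {1..4} \<Longrightarrow> tested_weakly T N \<Omega> k (h 1) a d \<nu>f \<nu>b c0 c i (G i) \<psi> g"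
  shows "AE t in lborel. t < T \<longrightarrow> (LINT x|dom_measure N \<Omega>. (\<Sum>i\<in>{1..4}. (1 / real (a i)) * u i t x) * \<psi> x) +
     (\<Sum>j<N. LINT x|dom_measure N \<Omega>. ((\<lambda>t. one T t * l t) \<star> (\<lambda>\<tau>. \<Sum>i\<in>{1..4}. (1 / real (a i)) * d i * (one T \<tau> * G i j \<tau> x))) t * g j x) = 0"
proof -
  interpret finite_measure "dom_measure N \<Omega>" by (rule fin)
  let ?M = "dom_measure N \<Omega>"
  let ?k = "\<lambda>t. one T t * k t" and ?l = "\<lambda>t. one T t * l t" and ?h = "\<lambda>t. one T t * h 1 t"
  let ?\<kappa> = "\<lambda>t. one T t * conv k (h 1) t" and ?G = "\<lambda>i j t x. one T t * G i j t x"
  note pc = PC_causal[OF PC T]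
  have kl1: "L1loc k" "L1loc l" using PC by (auto simp: PC_def)
  have h1: "L1loc (h 1)" using h by (simp add: is_h_def)
  note hc = is_h_causal[OF h kl1(2) T]
  note \<kappa> = conv_conv_causal[OF kl1(1) h1 T]
  have \<kappa>_eq: "eq_below T ?\<kappa> (\<lambda>t. one T t - (one T \<star> ?h) t)"
    by (rule eq_below_trans[OF \<kappa>(2) resolvent_kernel[OF pc(1) hc(1) pc(2) pc(5) hc(2)]])
  have L2\<psi>: "L2 \<psi>" and L2g: "\<And>j. j < N \<Longrightarrow> L2 (g j)"
    using \<psi> by (auto simp: W12_with_grad_def intro: in_Lp_2_L2)
  have [measurable]: "\<psi> \<in> borel_measurable ?M" and gm: "\<And>j. j < N \<Longrightarrow> g j \<in> borel_measurable ?M"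
    using L2\<psi> L2g by (auto simp: L2_def)
  let ?s = "\<lambda>i::nat. if i \<in> {1, 2} then 1 else - 1 :: real"
  \<comment> \<open>The common factor of the four reaction terms.\<close>
  define Q where "Q t = (LINT x|?M. conv (h 1) (\<lambda>\<tau>. rate \<nu>f \<nu>b a (\<lambda>j. c j \<tau> x)) t * \<psi> x)" for t
  have R: "(LINT x|?M. conv (h 1) (\<lambda>\<tau>. reaction \<nu>f \<nu>b a i (\<lambda>j. c j \<tau> x)) t * \<psi> x) = ?s i * real (a i) * Q t" for i t
  proof -
    have "conv (h 1) (\<lambda>\<tau>. reaction \<nu>f \<nu>b a i (\<lambda>j. c j \<tau> x)) t = ?s i * real (a i) * conv (h 1) (\<lambda>\<tau>. rate \<nu>f \<nu>b a (\<lambda>j. c j \<tau> x)) t" for x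
      unfolding reaction_def by (rule conv_scale)
    then show ?thesis unfolding Q_def by (simp only: mult.assoc integral_mult_right_zero)
  qed
  show ?thesis
  proof (rule tested_equation[OF hc(1) pc(2) hc(2) _ u G L2\<psi> L2g])
    have w: "AE t in lborel. \<forall>i\<in>{1..4}. t \<in> {0<..<T} \<longrightarrow>
              (\<exists>D. (AE x in ?M.
                      ((\<lambda>s. conv (conv k (h 1)) (\<lambda>\<tau>. c i \<tau> x - c0 i x) s)
                         has_real_derivative D x) (at t)) \<and>
                   integrable ?M (\<lambda>x. \<psi> x * D x +
                      d i * (\<Sum>j<N. conv (h 1) (\<lambda>\<tau>. G i j \<tau> x) t * g j x)) \<and>
                   integrable ?M (\<lambda>x.
                      conv (h 1) (\<lambda>\<tau>. reaction \<nu>f \<nu>b a i (\<lambda>j. c j \<tau> x)) t * \<psi> x) \<and>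
                   (LINT x|?M. \<psi> x * D x +
                      d i * (\<Sum>j<N. conv (h 1) (\<lambda>\<tau>. G i j \<tau> x) t * g j x)) =
                   (LINT x|?M.
                      conv (h 1) (\<lambda>\<tau>. reaction \<nu>f \<nu>b a i (\<lambda>j. c j \<tau> x)) t * \<psi> x))"
      by (rule AE_finite_allI[OF _ weak[unfolded tested_weakly_def]]) auto
    have dv: "AE t in lborel. \<forall>i\<in>{1..4}. AE x in ?M. t < T \<longrightarrow> (\<forall>D. ((\<lambda>s. (?\<kappa> \<star> (\<lambda>\<tau>. u i \<tau> x)) s) has_real_derivative D) (at t) \<longrightarrow>
       D = u i t x - (?h \<diamond> u i) t x)"
      by (rule AE_finite_allI[OF _ derivative_of_convolution[OF \<kappa>(1) hc(1) \<kappa>_eq u]]) auto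
    show "AE t in lborel. t < T \<longrightarrow> (\<Sum>i\<in>{1..4}. (1 / real (a i)) * (LINT x|?M. \<psi> x * (u i t x - (?h \<diamond> u i) t x) +
        d i * (\<Sum>j<N. (?h \<diamond> ?G i j) t x * g j x))) = 0"
      using w dv
    proof eventually_elim
      case (elim t)
      show ?case
      proof
        assume "t < T"
        show "(\<Sum>i\<in>{1..4}. (1 / real (a i)) * (LINT x|?M. \<psi> x * (u i t x - (?h \<diamond> u i) t x) +
          d i * (\<Sum>j<N. (?h \<diamond> ?G i j) t x * g j x))) = 0"
        proof (cases "t > 0")
          case True
          have "(LINT x|?M. \<psi> x * (u i t x - (?h \<diamond> u i) t x) +
            d i * (\<Sum>j<N. (?h \<diamond> ?G i j) t x * g j x)) = ?s i * real (a i) * Q t" if i: "i \<in> {1..4}" for i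
          proof -
            obtain D where D: "AE x in ?M. ((\<lambda>s. conv (conv k (h 1)) (\<lambda>\<tau>. c i \<tau> x - c0 i x) s) has_real_derivative D x) (at t)"
              "integrable ?M (\<lambda>x. \<psi> x * D x + d i * (\<Sum>j<N. conv (h 1) (\<lambda>\<tau>. G i j \<tau> x) t * g j x))"
              "(LINT x|?M. \<psi> x * D x + d i * (\<Sum>j<N. conv (h 1) (\<lambda>\<tau>. G i j \<tau> x) t * g j x)) = ?s i * real (a i) * Q t"
              using elim(1)[rule_format, OF i] True \<open>t < T\<close> unfolding R greaterThanLessThan_iff by blast
            have Deq: "AE x in ?M. D x = u i t x - (?h \<diamond> u i) t x"
              using D(1) elim(2)[rule_format, OF i] AE_space
            proof eventually_elim
              case (elim x)
              have "conv (conv k (h 1)) (\<lambda>\<tau>. c i \<tau> x - c0 i x) s = (?\<kappa> \<star> (\<lambda>\<tau>. u i \<tau> x)) s" if "s \<in> {0<..<T}" for s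
                using conv_eq_star[of s T "conv k (h 1)" "\<lambda>\<tau>. c i \<tau> x - c0 i x"] that elim(3) u_eq[OF i, of x] sp by simp
              then have "((\<lambda>s. (?\<kappa> \<star> (\<lambda>\<tau>. u i \<tau> x)) s) has_real_derivative D x) (at t)"
                using True \<open>t < T\<close>
                by (intro has_field_derivative_transform_within_open[OF elim(1), of "{0<..<T}"]) auto
              then show ?case using elim(2) \<open>t < T\<close> by blast
            qed
            have cG: "conv (h 1) (\<lambda>\<tau>. G i j \<tau> x) t = (?h \<diamond> ?G i j) t x" for j x
              using conv_eq_star[of t T "h 1" "\<lambda>\<tau>. G i j \<tau> x"] \<open>t < T\<close> by simp
            have "(LINT x|?M. \<psi> x * (u i t x - (?h \<diamond> u i) t x) +
               d i * (\<Sum>j<N. (?h \<diamond> ?G i j) t x * g j x)) =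
              (LINT x|?M. \<psi> x * D x + d i * (\<Sum>j<N. conv (h 1) (\<lambda>\<tau>. G i j \<tau> x) t * g j x))"
            proof (rule integral_cong_AE)
              show "AE x in ?M. \<psi> x * (u i t x - (?h \<diamond> u i) t x) + d i * (\<Sum>j<N. (?h \<diamond> ?G i j) t x * g j x) =
                \<psi> x * D x + d i * (\<Sum>j<N. conv (h 1) (\<lambda>\<tau>. G i j \<tau> x) t * g j x)"
                using Deq by eventually_elim (simp add: cG)
              show "(\<lambda>x. \<psi> x * D x + d i * (\<Sum>j<N. conv (h 1) (\<lambda>\<tau>. G i j \<tau> x) t * g j x)) \<in> borel_measurable ?M"
                using D(2) by (rule borel_measurable_integrable)
              show "(\<lambda>x. \<psi> x * (u i t x - (?h \<diamond> u i) t x) + d i * (\<Sum>j<N. (?h \<diamond> ?G i j) t x * g j x)) \<in> borel_measurable ?M"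
                using i by (intro borel_measurable_add borel_measurable_times borel_measurable_diff borel_measurable_sum borel_measurable_const
                   mixed_measurable_comp[OF u] mixed_star_measurable[OF causalD(3)[OF hc(1)] u] mixed_star_measurable[OF causalD(3)[OF hc(1)] G] gm) auto
            qed
            then show ?thesis using D(3) by simp
          qed
          then have "(\<Sum>i\<in>{1..4}. (1 / real (a i)) * (LINT x|?M. \<psi> x * (u i t x - (?h \<diamond> u i) t x) +
            d i * (\<Sum>j<N. (?h \<diamond> ?G i j) t x * g j x))) = (\<Sum>i\<in>{1..4}. (1 / real (a i)) * (?s i * real (a i) * Q t))"
            by (intro sum.cong refl) simp
          also have "\<dots> = (\<Sum>i\<in>{1..4}. ?s i * Q t)"
          proof (intro sum.cong refl)
            fix i :: nat assume "i \<in> {1..4}"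
            then have "real (a i) \<noteq> 0" using a[of i] by auto
            then show "(1 / real (a i)) * (?s i * real (a i) * Q t) = ?s i * Q t" by simp
          qed
          also have "\<dots> = 0"
          proof -
            have "{1..4::nat} = {1, 2, 3, 4}" by auto
            then show ?thesis by simp
          qed
          finally show ?thesis .
        next
          case False
          have "u i t x = 0" "(?h \<diamond> u i) t x = 0" if "i \<in> {1..4}" for i x
            using mixed_causal[OF u[OF that]] causalD(2)[OF hc(1)] False by (auto intro!: star_causal)
          moreover have "(?h \<diamond> ?G i j) t x = 0" for i j x
            using causalD(2)[OF hc(1)] False by (intro star_causal) (auto simp: one_def)
          ultimately show ?thesis by simp
        qed
      qed
    qed
  qed auto
qed

text \<open>
Gives \<open>c i \<in> L\<^sub>2\<close> and \<open>c i \<in> L\<^bsub>m+1\<^esub>\<close> from \<open>(c i)\<^sup>m \<in> L\<^sub>2\<close> on a set of finite measure.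
\<close>

lemma powr_le_1_plus_square:
  fixes y :: real
  assumes "0 \<le> y" "0 < e" "e \<le> 2 * m"
  shows "y powr e \<le> 1 + (y powr m)\<^sup>2"
proof (cases "y \<le> 1")
  case True
  have "y powr e \<le> 1 powr e" using assms True by (intro powr_mono2) auto
  then show ?thesis by (simp add: add_increasing2)
next
  case False
  then have "y powr e \<le> y powr (m + m)" using assms by (intro powr_mono) auto
  also have "\<dots> = (y powr m)\<^sup>2" using powr_add[of y m m] by (simp add: power2_eq_square)
  finally show ?thesis by simp
qed

lemma (in finite_measure) nn_integral_one_plus_square_finite:
  assumes f: "mixed f" "(\<integral>\<^sup>+x. (\<integral>\<^sup>+t. (ennreal \<bar>f t x\<bar>)\<^sup>2 \<partial>lborel) \<partial>M) < \<infinity>"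
    and le: "\<And>t x. g t x \<le> one T t + (f t x)\<^sup>2"
  shows "(\<integral>\<^sup>+x. (\<integral>\<^sup>+t. ennreal (g t x) \<partial>lborel) \<partial>M) < \<infinity>"
proof -
  note [measurable] = mixed_measurable_comp[OF f(1)] causalD(3)[OF causal_one, of T]
  have "(\<integral>\<^sup>+x. (\<integral>\<^sup>+t. ennreal (g t x) \<partial>lborel) \<partial>M) \<le> (\<integral>\<^sup>+x. (\<integral>\<^sup>+t. indicator {0<..<T} t + (ennreal \<bar>f t x\<bar>)\<^sup>2 \<partial>lborel) \<partial>M)"
  proof (intro nn_integral_mono)
    fix x t
    have "ennreal (g t x) \<le> ennreal (one T t + (f t x)\<^sup>2)" by (rule ennreal_leI[OF le])
    also have "\<dots> = ennreal (one T t) + ennreal ((f t x)\<^sup>2)" by (rule ennreal_plus) (auto simp: one_def)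
    also have "\<dots> = indicator {0<..<T} t + (ennreal \<bar>f t x\<bar>)\<^sup>2"
      by (auto simp: one_def ennreal_power split: split_indicator)
    finally show "ennreal (g t x) \<le> indicator {0<..<T} t + (ennreal \<bar>f t x\<bar>)\<^sup>2" .
  qed
  also have "\<dots> = (\<integral>\<^sup>+x. emeasure lborel {0<..<T} + (\<integral>\<^sup>+t. (ennreal \<bar>f t x\<bar>)\<^sup>2 \<partial>lborel) \<partial>M)"
    by (intro nn_integral_cong) (subst nn_integral_add, auto)
  also have "\<dots> = emeasure lborel {0<..<T} * emeasure M (space M) + (\<integral>\<^sup>+x. (\<integral>\<^sup>+t. (ennreal \<bar>f t x\<bar>)\<^sup>2 \<partial>lborel) \<partial>M)"
    by (subst nn_integral_add) auto
  also have "\<dots> < \<infinity>"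
  proof -
    have "emeasure M (space M) < \<infinity>" by (metis emeasure_finite infinity_ennreal_def top.not_eq_extremum)
    moreover have "emeasure lborel {0<..<T} < \<infinity>" by (cases "0 \<le> T") auto
    ultimately show ?thesis using f(2) by (simp add: ennreal_mult_less_top)
  qed
  finally show ?thesis .
qed

lemma classical_solution_continuous:
  assumes cl: "classical_solution T N \<Omega> k m a d \<nu>f \<nu>b c0 c" and i: "i \<in> {1..4}"
    and x: "x \<in> \<Omega>" and \<Omega>: "\<Omega> \<subseteq> topspace (powertop_real {..<N})"
  shows "continuous_on {0<..T} (\<lambda>t. c i t x)"
proof -
  let ?X = "top_of_set {0<..T}" and ?Y = "subtopology (powertop_real {..<N}) \<Omega>"
  have "continuous_map (prod_topology ?X ?Y) euclideanreal (\<lambda>(t, x). c i t x)"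
    using cl i by (auto simp: classical_solution_def)
  moreover have "continuous_map ?X (prod_topology ?X ?Y) (\<lambda>t. (t, x))"
    using x \<Omega> by (intro continuous_map_pairedI) (auto simp: continuous_map_const)
  ultimately have "continuous_map ?X euclideanreal ((\<lambda>(t, x). c i t x) \<circ> (\<lambda>t. (t, x)))"
    by (rule continuous_map_compose[rotated])
  then show ?thesis by (simp add: o_def)
qed

text \<open>
The functions \<open>p i\<close> and \<open>y i\<close> are \<open>(c i)\<^sup>m\<close> and \<open>c i\<close>, extended by zero in time. Recovering \<open>y i\<close>
as the \<open>m\<close>-th root of \<open>p i\<close> makes it nonnegative everywhere, and measurable because \<open>(c i)\<^sup>m\<close> is. The components \<open>p i (s)\<close> serve as test functions separately, and the
resulting identities are added with the weights \<open>d i / a i\<close> to one with \<open>z = \<Sum> (d i / a i) p i\<close>.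
\<close>

lemma solution_energy_inequality:
  fixes N :: nat and a :: "nat \<Rightarrow> nat" and d :: "nat \<Rightarrow> real" and T m :: real and \<Omega> c
  defines "M \<equiv> dom_measure N \<Omega>"
  defines "p \<equiv> \<lambda>i t x. one T t * (c i t x powr m)" and "y \<equiv> \<lambda>i t x. (one T t * (c i t x powr m)) powr (1 / m)"
  defines "\<alpha> \<equiv> \<lambda>i. 1 / real (a i)" and "\<delta> \<equiv> \<lambda>i. 1 / real (a i) * d i"
  assumes fin: "finite_measure M" and sp: "space M = \<Omega>" and \<Omega>: "\<Omega> \<subseteq> topspace (powertop_real {..<N})"
    and T: "T > 0" and m: "m \<ge> 1" and a': "\<forall>i\<in>{1..4}. a i \<ge> 1" and d': "\<forall>i\<in>{1..4}. d i > 0"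
    and PC: "PC k l" and h: "is_h l 1 (h 1)"
    and c0': "\<forall>i\<in>{1..4}. in_Linf M (c0 i) \<and> (AE x in M. c0 i x \<ge> 0)"
    and cl: "classical_solution T N \<Omega> k m a d \<nu>f \<nu>b c0 c"
    and weak: "weak_solution T N \<Omega> k h m a d \<nu>f \<nu>b c0 c"
    and nonneg': "\<forall>i\<in>{1..4}. \<forall>t\<in>{0<..<T}. \<forall>x\<in>\<Omega>. c i t x \<ge> 0"
  shows "(\<integral>\<^sup>+x. \<integral>\<^sup>+t. ennreal (one T t * ((\<Sum>i\<in>{1..4}. \<delta> i * p i t x) * (\<Sum>i\<in>{1..4}. \<alpha> i * y i t x))) \<partial>lborel \<partial>M) \<le>
     (\<integral>\<^sup>+x. ennreal (\<Sum>i\<in>{1..4}. \<alpha> i * c0 i x) * (\<integral>\<^sup>+t. ennreal (\<Sum>i\<in>{1..4}. \<delta> i * p i t x) \<partial>lborel) \<partial>M)"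
    and "\<And>i. i \<in> {1..4} \<Longrightarrow> (\<integral>\<^sup>+x. \<integral>\<^sup>+t. ennreal (y i t x powr (m + 1)) \<partial>lborel \<partial>M) < \<infinity>"
    and "\<And>i. i \<in> {1..4} \<Longrightarrow> finite_measure.mixed M (y i)"
    and "\<And>i t x. i \<in> {1..4} \<Longrightarrow> x \<in> \<Omega> \<Longrightarrow> y i t x = one T t * c i t x"
    and "\<And>i t x. p i t x = y i t x powr m"
proof -
  interpret finite_measure M by (rule fin)
  let ?I = "{1..4} :: nat set"
  note a = bspec[OF a'] and d = bspec[OF d'] and c0 = conjunct1[OF bspec[OF c0']] and c00 = conjunct2[OF bspec[OF c0']]
    and nonneg = bspec[OF bspec[OF bspec[OF nonneg']]]
  show y_eq: "y i t x = one T t * c i t x" if "i \<in> ?I" "x \<in> \<Omega>" for i t x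
    using nonneg[OF that(1) _ that(2), of t] m by (cases "t \<in> {0<..<T}") (auto simp: y_def one_def powr_powr)
  show p_eq: "p i t x = y i t x powr m" for i t x
    using m by (auto simp: p_def y_def powr_powr one_def split: split_indicator)
  have y0: "0 \<le> y i t x" for i t x by (simp add: y_def)
  have p0: "0 \<le> p i t x" for i t x by (simp add: p_def one_def)
  have "\<forall>i\<in>?I. \<exists>G. L2_W12_with_grad T N \<Omega> (\<lambda>t x. c i t x powr m) G \<and>
    (\<forall>\<psi> g. W12_with_grad N \<Omega> \<psi> g \<longrightarrow> tested_weakly T N \<Omega> k (h 1) a d \<nu>f \<nu>b c0 c i G \<psi> g)"
    using weak_solution_gradient[OF weak] by metis
  from bchoice[OF this] obtain G where
    GL: "\<And>i. i \<in> ?I \<Longrightarrow> L2_W12_with_grad T N \<Omega> (\<lambda>t x. c i t x powr m) (G i)" and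
    Gw: "\<And>i \<psi> g. i \<in> ?I \<Longrightarrow> W12_with_grad N \<Omega> \<psi> g \<Longrightarrow> tested_weakly T N \<Omega> k (h 1) a d \<nu>f \<nu>b c0 c i (G i) \<psi> g"
    by blast
  have pL: "in_Lp (restrict_space lborel {0<..<T} \<Otimes>\<^sub>M M) 2 (\<lambda>(t, x). c i t x powr m)" if "i \<in> ?I" for i
    using GL[OF that] by (simp add: L2_W12_with_grad_def cyl_measure_def M_def)
  have pm: "mixed (p i)" and pfin: "(\<integral>\<^sup>+x. (\<integral>\<^sup>+t. (ennreal \<bar>p i t x\<bar>)\<^sup>2 \<partial>lborel) \<partial>M) < \<infinity>" if "i \<in> ?I" for i
    using cyl_L2_mixed[OF pL[OF that]] unfolding p_def by auto
  have Gm: "mixed (\<lambda>t x. one T t * G i j t x)" if "i \<in> ?I" "j < N" for i j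
    using GL[OF that(1)] that(2) by (intro cyl_L2_mixed) (simp add: L2_W12_with_grad_def cyl_measure_def M_def)
  have yle: "y i t x powr e \<le> one T t + (p i t x)\<^sup>2" if "0 < e" "e \<le> 2 * m" for i t x e
  proof (cases "t \<in> {0<..<T}")
    case True
    then show ?thesis using powr_le_1_plus_square[OF y0 that, of i t x] by (simp add: p_eq one_def)
  qed (auto simp: y_def one_def)
  show "(\<integral>\<^sup>+x. \<integral>\<^sup>+t. ennreal (y i t x powr (m + 1)) \<partial>lborel \<partial>M) < \<infinity>" if "i \<in> ?I" for i
    by (rule nn_integral_one_plus_square_finite[OF pm[OF that] pfin[OF that], where T=T]) (use yle m in auto)
  show ym: "mixed (y i)" if i: "i \<in> ?I" for i
  proof (rule mixedI_L2[where T=T])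
    note [measurable] = mixed_measurable_comp[OF pm[OF i]]
    have "(\<lambda>q. p i (fst q) (snd q) powr (1 / m)) \<in> borel_measurable (lborel \<Otimes>\<^sub>M M)" by measurable
    then show "(\<lambda>(t, x). y i t x) \<in> borel_measurable (lborel \<Otimes>\<^sub>M M)" by (simp add: y_def p_def case_prod_unfold)
    show "(\<integral>\<^sup>+x. (\<integral>\<^sup>+t. (ennreal \<bar>y i t x\<bar>)\<^sup>2 \<partial>lborel) \<partial>M) < \<infinity>"
    proof -
      have "(\<integral>\<^sup>+x. (\<integral>\<^sup>+t. ennreal (y i t x powr 2) \<partial>lborel) \<partial>M) < \<infinity>"
        by (rule nn_integral_one_plus_square_finite[OF pm[OF i] pfin[OF i], where T=T]) (use yle m in auto)
      then show ?thesis using y0 by (simp add: ennreal_power powr_numeral)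
    qed
  qed (auto simp: y_def one_def)
  have c0m: "mixed (\<lambda>t x. one T t * c0 i x)" if "i \<in> ?I" for i by (rule in_Linf_mixed[OF c0[OF that]])
  let ?u = "\<lambda>i t x. y i t x - one T t * c0 i x"
  let ?z = "\<lambda>t x. \<Sum>i\<in>?I. \<delta> i * p i t x" and ?w = "\<lambda>t x. \<Sum>i\<in>?I. \<alpha> i * y i t x" and ?wini = "\<lambda>x. \<Sum>i\<in>?I. \<alpha> i * c0 i x"
  let ?W = "\<lambda>t x. \<Sum>i\<in>?I. \<alpha> i * ?u i t x"
  let ?Gz = "\<lambda>j t x. \<Sum>i\<in>?I. \<delta> i * (one T t * G i j t x)"
  let ?l = "\<lambda>t. one T t * l t" and ?k = "\<lambda>t. one T t * k t"
  let ?L = "\<lambda>j t x. (?l \<diamond> ?Gz j) t x"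
  note pc = PC_causal[OF PC T]
  have um: "mixed (?u i)" if "i \<in> ?I" for i by (intro mixed_diff ym c0m that)
  have zm: "mixed ?z" by (intro mixed_sum mixed_scale pm) auto
  have wm: "mixed ?w" by (intro mixed_sum mixed_scale ym) auto
  have Wm: "mixed ?W" by (intro mixed_sum mixed_scale um) auto
  have Gzm: "mixed (?Gz j)" if "j < N" for j using that by (intro mixed_sum mixed_scale Gm) auto
  have Lm: "mixed (?L j)" if "j < N" for j by (intro mixed_star pc(2) Gzm that)
  have W_eq: "?W t x = ?w t x - one T t * ?wini x" for t x
    by (simp add: right_diff_distrib sum_subtractf sum_distrib_left mult.left_commute)
  have w0m: "mixed (\<lambda>t x. one T t * ?wini x)"
  proof -
    have "mixed (\<lambda>t x. \<Sum>i\<in>?I. \<alpha> i * (one T t * c0 i x))" by (intro mixed_sum mixed_scale c0m) auto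
    then show ?thesis by (simp add: sum_distrib_left mult.left_commute)
  qed
  have tested: "AE s in lborel. AE t in lborel. t < T \<longrightarrow> (LINT x|M. p i s x * ?W t x) +
      (\<Sum>j<N. LINT x|M. (one T s * G i j s x) * ?L j t x) = 0" if i: "i \<in> ?I" for i
  proof -
    have "AE s in lborel. s \<in> {0<..<T} \<longrightarrow> W12_with_grad N \<Omega> (\<lambda>x. c i s x powr m) (\<lambda>j. G i j s)"
      using GL[OF i] by (simp add: L2_W12_with_grad_def)
    then show ?thesis
    proof eventually_elim
      case (elim s)
      show ?case
      proof (cases "s \<in> {0<..<T}")
        case True
        have "AE t in lborel. t < T \<longrightarrow> (LINT x|M. ?W t x * (c i s x powr m)) +
          (\<Sum>j<N. LINT x|M. ?L j t x * G i j s x) = 0"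
          unfolding \<alpha>_def \<delta>_def M_def
          by (rule weak_solution_tested[where u="?u" and G=G and c=c and h=h and \<psi>="\<lambda>x. c i s x powr m" and g="\<lambda>j. G i j s", OF fin[unfolded M_def] sp[unfolded M_def] T PC h a um[unfolded M_def] _ Gm[unfolded M_def] elim[rule_format, OF True] Gw])
             (use True elim y_eq in \<open>auto simp: right_diff_distrib\<close>)
        then show ?thesis using True by (simp add: p_def one_def mult.commute)
      next
        case False
        then show ?thesis by (auto simp: p_def one_def)
      qed
    qed
  qed
  show "(\<integral>\<^sup>+x. \<integral>\<^sup>+t. ennreal (one T t * (?z t x * ?w t x)) \<partial>lborel \<partial>M) \<le>
     (\<integral>\<^sup>+x. ennreal (?wini x) * (\<integral>\<^sup>+t. ennreal (?z t x) \<partial>lborel) \<partial>M)"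
  proof (rule energy_inequality[OF pc(1) pc(3) pc(4) pc(2) pc(5) zm wm Gzm w0m])
    have t': "AE s in lborel. \<forall>i\<in>?I. AE t in lborel. t < T \<longrightarrow> (LINT x|M. p i s x * ?W t x) +
      (\<Sum>j<N. LINT x|M. (one T s * G i j s x) * ?L j t x) = 0"
      by (rule AE_finite_allI[OF _ tested]) auto
    have i1: "AE s in lborel. \<forall>i\<in>?I. AE t in lborel. integrable M (\<lambda>x. p i s x * ?W t x)"
      by (rule AE_finite_allI[OF _ mixed_prod_AE_integrable[OF pm Wm]]) auto
    have i2: "AE s in lborel. \<forall>i\<in>?I. \<forall>j\<in>{..<N}. AE t in lborel. integrable M (\<lambda>x. (one T s * G i j s x) * ?L j t x)"
      by (rule AE_finite_allI, simp, rule AE_finite_allI[OF _ mixed_prod_AE_integrable[OF Gm Lm]]) auto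
    show "AE s in lborel. AE t in lborel. (LINT x|M. ?z s x * (?w t x - one T t * ?wini x)) +
       (\<Sum>j<N. LINT x|M. ?Gz j s x * (one T t * ?L j t x)) = 0"
      using t' i1 i2
    proof eventually_elim
      case (elim s)
      have "AE t in lborel. \<forall>i\<in>?I. t < T \<longrightarrow> (LINT x|M. p i s x * ?W t x) +
        (\<Sum>j<N. LINT x|M. (one T s * G i j s x) * ?L j t x) = 0"
        by (rule AE_finite_allI) (use elim(1) in auto)
      moreover have "AE t in lborel. \<forall>i\<in>?I. integrable M (\<lambda>x. p i s x * ?W t x)"
        by (rule AE_finite_allI) (use elim(2) in auto)
      moreover have "AE t in lborel. \<forall>i\<in>?I. \<forall>j\<in>{..<N}. integrable M (\<lambda>x. (one T s * G i j s x) * ?L j t x)"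
        by (rule AE_finite_allI, simp, rule AE_finite_allI) (use elim(3) in auto)
      ultimately show ?case
      proof eventually_elim
        case (elim t)
        show ?case
        proof (cases "t \<in> {0<..<T}")
          case True
          then have t: "t < T" and o: "one T t = 1" by (auto simp: one_def)
          have "(LINT x|M. ?z s x * ?W t x) = (LINT x|M. (\<Sum>i\<in>?I. \<delta> i * (p i s x * ?W t x)))"
            by (intro Bochner_Integration.integral_cong refl) (simp only: sum_distrib_right mult.assoc)
          also have "\<dots> = (\<Sum>i\<in>?I. \<delta> i * (LINT x|M. p i s x * ?W t x))"
            using elim(2) by (subst Bochner_Integration.integral_sum) auto
          finally have e1: "(LINT x|M. ?z s x * ?W t x) = (\<Sum>i\<in>?I. \<delta> i * (LINT x|M. p i s x * ?W t x))" .
          have e2: "(LINT x|M. ?Gz j s x * ?L j t x) = (\<Sum>i\<in>?I. \<delta> i * (LINT x|M. (one T s * G i j s x) * ?L j t x))" if "j < N" for j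
          proof -
            have "(LINT x|M. ?Gz j s x * ?L j t x) = (LINT x|M. (\<Sum>i\<in>?I. \<delta> i * ((one T s * G i j s x) * ?L j t x)))"
              by (intro Bochner_Integration.integral_cong refl) (simp only: sum_distrib_right mult.assoc)
            also have "\<dots> = (\<Sum>i\<in>?I. \<delta> i * (LINT x|M. (one T s * G i j s x) * ?L j t x))"
              using elim(3) that by (subst Bochner_Integration.integral_sum) auto
            finally show ?thesis .
          qed
          have "(\<Sum>j<N. LINT x|M. ?Gz j s x * ?L j t x) = (\<Sum>i\<in>?I. \<delta> i * (\<Sum>j<N. LINT x|M. (one T s * G i j s x) * ?L j t x))"
            using e2 by (simp add: sum_distrib_left) (rule sum.swap)
          then have "(LINT x|M. ?z s x * ?W t x) + (\<Sum>j<N. LINT x|M. ?Gz j s x * ?L j t x) =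
            (\<Sum>i\<in>?I. \<delta> i * ((LINT x|M. p i s x * ?W t x) + (\<Sum>j<N. LINT x|M. (one T s * G i j s x) * ?L j t x)))"
            unfolding e1 by (simp only: distrib_left sum.distrib)
          also have "\<dots> = 0" using elim(1) t by simp
          finally have "(LINT x|M. ?z s x * ?W t x) + (\<Sum>j<N. LINT x|M. ?Gz j s x * ?L j t x) = 0" .
          then have "(LINT x|M. ?z s x * (?w t x - one T t * ?wini x)) + (\<Sum>j<N. LINT x|M. ?Gz j s x * ?L j t x) = 0"
            by (simp only: W_eq)
          then show ?thesis by (simp only: o mult_1_left)
        next
          case False
          then have "one T t = 0" "y i t x = 0" for i x by (auto simp: one_def y_def)
          then show ?thesis by simp
        qed
      qed
    qed
    show "0 \<le> ?z t x" for t x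
      using p0 d by (intro sum_nonneg mult_nonneg_nonneg) (auto simp: \<delta>_def less_imp_le)
    show "0 \<le> ?w t x" for t x
      using y0 by (intro sum_nonneg mult_nonneg_nonneg) (auto simp: \<alpha>_def)
    have "AE x in M. \<forall>i\<in>?I. c0 i x \<ge> 0" by (rule AE_finite_allI) (use c00 in auto)
    then show "AE x in M. 0 \<le> ?wini x"
      by eventually_elim (auto intro!: sum_nonneg mult_nonneg_nonneg simp: \<alpha>_def)
    show "?wini \<in> borel_measurable M"
      using c0 by (intro borel_measurable_sum borel_measurable_times) (auto simp: in_Linf_def)
    fix t x assume x: "x \<in> space M" and t: "0 < t" "t < T"
    have cc: "continuous_on {0<..<T} (\<lambda>t. c i t x)" if "i \<in> ?I" for i
      using classical_solution_continuous[OF cl that _ \<Omega>, of x] x sp by (auto intro: continuous_on_subset)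
    have yc: "continuous_on {0<..<T} (\<lambda>t. y i t x)" if "i \<in> ?I" for i
      using y_eq[OF that, of x] x sp by (subst continuous_on_cong[OF refl, of _ _ "\<lambda>t. c i t x"]) (auto simp: one_def cc[OF that])
    have pc: "continuous_on {0<..<T} (\<lambda>t. p i t x)" if "i \<in> ?I" for i
      unfolding p_eq using yc[OF that] y0 m by (intro continuous_on_powr') auto
    have "continuous_on {0<..<T} (\<lambda>t. ?z t x)" "continuous_on {0<..<T} (\<lambda>t. ?w t x)"
      by (intro continuous_intros yc pc; simp)+
    then show "isCont (\<lambda>t. ?z t x) t \<and> isCont (\<lambda>t. ?w t x) t"
      using t by (auto simp: continuous_on_eq_continuous_at)
  qed
qed

section \<open>The a priori estimate\<close>

lemma powr_Suc_exponent: "0 \<le> (y::real) \<Longrightarrow> y powr (m + 1) = y powr m * y"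
  by (simp add: powr_add)

text \<open>
Compare \<open>b\<close> with \<open>\<epsilon> y\<close>; in either case one of the two terms on the right suffices.
\<close>

lemma young_powr:
  fixes y b \<epsilon> m :: real
  assumes y: "0 \<le> y" and b: "0 \<le> b" and \<epsilon>: "0 < \<epsilon>" and m: "0 \<le> m"
  shows "y powr m * b \<le> \<epsilon> * y powr (m + 1) + \<epsilon> powr (- m) * b powr (m + 1)"
proof (cases "b \<le> \<epsilon> * y")
  case True
  then have "y powr m * b \<le> y powr m * (\<epsilon> * y)" by (intro mult_left_mono) auto
  also have "\<dots> = \<epsilon> * y powr (m + 1)" using y by (simp add: powr_Suc_exponent)
  finally show ?thesis by (simp add: add_increasing2)
next
  case False
  then have "y \<le> b / \<epsilon>" using \<epsilon> by (simp add: field_simps)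
  then have "y powr m \<le> (b / \<epsilon>) powr m" using y m by (intro powr_mono2) auto
  also have "\<dots> = \<epsilon> powr (- m) * b powr m" using b \<epsilon> by (simp add: powr_divide powr_minus field_simps)
  finally have "y powr m * b \<le> \<epsilon> powr (- m) * b powr m * b" using b by (rule mult_right_mono)
  also have "\<dots> = \<epsilon> powr (- m) * b powr (m + 1)" using b by (simp add: powr_Suc_exponent)
  finally show ?thesis using \<epsilon> y by (simp add: add_increasing)
qed

text \<open>
Keep only the diagonal terms of the product.
\<close>

lemma product_lower_bound:
  fixes y \<delta> \<alpha> :: "'i \<Rightarrow> real"
  assumes I: "finite I" and y: "\<And>i. i \<in> I \<Longrightarrow> 0 \<le> y i" and \<delta>: "\<And>i. i \<in> I \<Longrightarrow> 0 \<le> \<delta> i" and \<alpha>: "\<And>i. i \<in> I \<Longrightarrow> 0 \<le> \<alpha> i"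
    and A: "\<And>i. i \<in> I \<Longrightarrow> A \<le> \<delta> i * \<alpha> i"
  shows "A * (\<Sum>i\<in>I. y i powr (m + 1)) \<le> (\<Sum>i\<in>I. \<delta> i * y i powr m) * (\<Sum>i\<in>I. \<alpha> i * y i)"
proof -
  have "A * (\<Sum>i\<in>I. y i powr (m + 1)) \<le> (\<Sum>i\<in>I. (\<delta> i * y i powr m) * (\<alpha> i * y i))"
    unfolding sum_distrib_left
  proof (rule sum_mono)
    fix i assume i: "i \<in> I"
    have "A * y i powr (m + 1) \<le> (\<delta> i * \<alpha> i) * y i powr (m + 1)" by (rule mult_right_mono[OF A[OF i]]) simp
    then show "A * y i powr (m + 1) \<le> (\<delta> i * y i powr m) * (\<alpha> i * y i)"
      using y[OF i] by (simp add: powr_Suc_exponent mult_ac)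
  qed
  also have "\<dots> \<le> (\<Sum>i\<in>I. (\<delta> i * y i powr m) * (\<Sum>j\<in>I. \<alpha> j * y j))"
    using I y \<delta> \<alpha> by (intro sum_mono mult_left_mono member_le_sum) auto
  finally show ?thesis by (simp add: sum_distrib_right)
qed

lemma product_upper_bound:
  fixes y b \<delta> \<alpha> :: "'i \<Rightarrow> real"
  assumes I: "finite I" and y: "\<And>i. i \<in> I \<Longrightarrow> 0 \<le> y i" and b: "\<And>i. i \<in> I \<Longrightarrow> 0 \<le> b i" 
    and \<delta>: "\<And>i. i \<in> I \<Longrightarrow> 0 \<le> \<delta> i" and \<alpha>: "\<And>i. i \<in> I \<Longrightarrow> 0 \<le> \<alpha> i"
    and B: "\<And>i j. i \<in> I \<Longrightarrow> j \<in> I \<Longrightarrow> \<delta> i * \<alpha> j \<le> B" and \<epsilon>: "0 < \<epsilon>" and m: "0 \<le> m"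
  shows "(\<Sum>i\<in>I. \<alpha> i * b i) * (\<Sum>i\<in>I. \<delta> i * y i powr m) \<le>
    B * card I * \<epsilon> * (\<Sum>i\<in>I. y i powr (m + 1)) + B * card I * \<epsilon> powr (- m) * (\<Sum>i\<in>I. b i powr (m + 1))"
proof -
  have "(\<Sum>i\<in>I. \<alpha> i * b i) * (\<Sum>i\<in>I. \<delta> i * y i powr m) = (\<Sum>j\<in>I. \<Sum>i\<in>I. (\<delta> i * \<alpha> j) * (y i powr m * b j))"
    by (simp add: sum_product mult_ac)
  also have "\<dots> \<le> (\<Sum>j\<in>I. \<Sum>i\<in>I. B * (\<epsilon> * y i powr (m + 1) + \<epsilon> powr (- m) * b j powr (m + 1)))"
  proof (intro sum_mono)
    fix j i assume i: "i \<in> I" and j: "j \<in> I"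
    have B0: "0 \<le> B" using B[OF i j] \<delta>[OF i] \<alpha>[OF j] mult_nonneg_nonneg[of "\<delta> i" "\<alpha> j"] by linarith
    show "(\<delta> i * \<alpha> j) * (y i powr m * b j) \<le> B * (\<epsilon> * y i powr (m + 1) + \<epsilon> powr (- m) * b j powr (m + 1))"
      using B[OF i j] young_powr[OF y[OF i] b[OF j] \<epsilon> m] B0 b[OF j] by (intro mult_mono) auto
  qed
  also have "\<dots> = B * card I * \<epsilon> * (\<Sum>i\<in>I. y i powr (m + 1)) + B * card I * \<epsilon> powr (- m) * (\<Sum>i\<in>I. b i powr (m + 1))"
    by (simp add: sum.distrib distrib_left flip: sum_distrib_left)
  finally show ?thesis .
qed

lemma sum_powr_root_le:
  fixes X Y :: "'i \<Rightarrow> real" and K q :: real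
  assumes I: "finite I" and X: "\<And>i. i \<in> I \<Longrightarrow> 0 \<le> X i" and Y: "\<And>i. i \<in> I \<Longrightarrow> 0 \<le> Y i"
    and K: "0 \<le> K" and q: "q > 0" and le: "(\<Sum>i\<in>I. X i) \<le> K * (\<Sum>i\<in>I. Y i)"
  shows "(\<Sum>i\<in>I. X i powr (1 / q)) \<le> card I * (K * card I) powr (1 / q) * (\<Sum>i\<in>I. Y i powr (1 / q))"
proof -
  define s where "s = (\<Sum>i\<in>I. Y i powr (1 / q))"
  have s0: "0 \<le> s" unfolding s_def by (intro sum_nonneg) auto
  have "Y i \<le> s powr q" if i: "i \<in> I" for i
  proof -
    have "Y i powr (1 / q) \<le> s" unfolding s_def using I i by (intro member_le_sum) auto
    then have "(Y i powr (1 / q)) powr q \<le> s powr q" using q by (intro powr_mono2) auto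
    then show ?thesis using Y[OF i] q by (simp add: powr_powr)
  qed
  then have "(\<Sum>i\<in>I. Y i) \<le> card I * s powr q" using sum_bounded_above[of I Y "s powr q"] by simp
  with K have 1: "K * (\<Sum>i\<in>I. Y i) \<le> K * (card I * s powr q)" by (intro mult_left_mono)
  have "X i powr (1 / q) \<le> (K * card I) powr (1 / q) * s" if i: "i \<in> I" for i
  proof -
    have "X i \<le> (\<Sum>i\<in>I. X i)" using I X i by (intro member_le_sum) auto
    with le 1 have "X i \<le> (K * card I) * s powr q" by (simp add: mult.assoc)
    then have "X i powr (1 / q) \<le> ((K * card I) * s powr q) powr (1 / q)" using X[OF i] q by (intro powr_mono2) auto
    also have "\<dots> = (K * card I) powr (1 / q) * s" using K s0 q by (simp add: powr_mult powr_powr)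
    finally show ?thesis .
  qed
  then have "(\<Sum>i\<in>I. X i powr (1 / q)) \<le> card I * ((K * card I) powr (1 / q) * s)"
    using sum_bounded_above[of I "\<lambda>i. X i powr (1 / q)"] by simp
  then show ?thesis by (simp add: s_def mult.assoc)
qed

text \<open>
Subtracting \<open>A / 2 * Y\<close> from both sides, which requires \<open>Y\<close> to be finite.
\<close>

lemma ennreal_absorb:
  assumes "ennreal A * Y \<le> ennreal (A / 2) * Y + ennreal B * V" and "Y < \<infinity>" "V < \<infinity>" and "A > 0" "B \<ge> 0"
  shows "enn2real Y \<le> 2 * B / A * enn2real V"
proof -
  obtain y v where y: "Y = ennreal y" "0 \<le> y" and v: "V = ennreal v" "0 \<le> v"
    using assms(2,3) by (cases Y; cases V) auto
  have "ennreal (A * y) \<le> ennreal (A / 2 * y + B * v)"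
    using assms y v by (simp flip: ennreal_mult ennreal_plus)
  then have "A * y \<le> A / 2 * y + B * v" using assms y v by (subst (asm) ennreal_le_iff) auto
  then show ?thesis using y v \<open>A > 0\<close> by (simp add: field_simps)
qed

text \<open>
In \<open>\<integral>\<integral> z w \<le> \<integral>\<integral> z w0\<close> the left-hand side is at least \<open>A\<close> times the integral of \<open>\<Sum> (c i)\<^bsup>m+1\<^esup>\<close>, and
the right-hand side is at most \<open>A / 2\<close> times this integral plus a term in the initial data.
\<close>

lemma a_priori_bound:
  fixes N :: nat and a :: "nat \<Rightarrow> nat" and d :: "nat \<Rightarrow> real" and T m :: real and \<Omega> c
  defines "M \<equiv> dom_measure N \<Omega>"
  assumes A: "\<And>i. i \<in> {1..4} \<Longrightarrow> A \<le> (1 / real (a i) * d i) * (1 / real (a i))" and A0: "A > 0"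
    and B: "\<And>i j. i \<in> {1..4} \<Longrightarrow> j \<in> {1..4} \<Longrightarrow> (1 / real (a i) * d i) * (1 / real (a j)) \<le> B" and B0: "B > 0"
    and T: "T > 0" and m: "m \<ge> 1" and a: "\<forall>i\<in>{1..4}. a i \<ge> 1" and d': "\<forall>i\<in>{1..4}. d i > 0"
    and dom: "smooth_bounded_domain N \<Omega>"
    and PC: "PC k l" and h: "is_h l 1 (h 1)"
    and c0': "\<forall>i\<in>{1..4}. in_Linf M (c0 i) \<and> (AE x in M. c0 i x \<ge> 0)"
    and cl: "classical_solution T N \<Omega> k m a d \<nu>f \<nu>b c0 c"
    and weak: "weak_solution T N \<Omega> k h m a d \<nu>f \<nu>b c0 c"
    and nonneg': "\<forall>i\<in>{1..4}. \<forall>t\<in>{0<..<T}. \<forall>x\<in>\<Omega>. c i t x \<ge> 0"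
  shows "\<And>i. i \<in> {1..4} \<Longrightarrow> in_Lp (cyl_measure T N \<Omega>) (m + 1) (\<lambda>(t, x). c i t x)"
    and "(\<Sum>i\<in>{1..4}. LINT p|cyl_measure T N \<Omega>. \<bar>case p of (t, x) \<Rightarrow> c i t x\<bar> powr (m + 1)) \<le>
      2 * (B * 4 * (A / (8 * B)) powr (- m) * T) / A * (\<Sum>i\<in>{1..4}. LINT x|M. \<bar>c0 i x\<bar> powr (m + 1))"
proof -
  let ?I = "{1..4} :: nat set"
  note d = bspec[OF d'] and c0 = conjunct1[OF bspec[OF c0']] and c00 = conjunct2[OF bspec[OF c0']]
    and nonneg = bspec[OF bspec[OF bspec[OF nonneg']]]
  define p where "p = (\<lambda>i t x. one T t * (c i t x powr m))"
  define y where "y = (\<lambda>i t x. (one T t * (c i t x powr m)) powr (1 / m))"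
  define \<alpha> where "\<alpha> = (\<lambda>i. 1 / real (a i))"
  define \<delta> where "\<delta> = (\<lambda>i. 1 / real (a i) * d i)"
  have \<Omega>: "\<Omega> \<subseteq> topspace (powertop_real {..<N})"
    using dom by (intro openin_subset) (simp add: smooth_bounded_domain_def)
  obtain Bd where Bd: "\<And>x j. x \<in> \<Omega> \<Longrightarrow> j < N \<Longrightarrow> \<bar>x j\<bar> \<le> Bd"
    using dom by (auto simp: smooth_bounded_domain_def)
  have fd: "finite_measure (dom_measure N \<Omega>)" "space (dom_measure N \<Omega>) = \<Omega>"
    by (rule finite_measure_dom_measure[OF \<Omega>, of Bd], rule Bd, assumption+)+
  have sp: "space M = \<Omega>" using fd(2) by (simp add: M_def)
  interpret finite_measure M using fd(1) by (simp add: M_def)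
  note sol0 = solution_energy_inequality[OF fd \<Omega> T m a d' PC h c0'[unfolded M_def] cl weak nonneg']
  have energy: "(\<integral>\<^sup>+x. \<integral>\<^sup>+t. ennreal (one T t * ((\<Sum>i\<in>?I. \<delta> i * p i t x) * (\<Sum>i\<in>?I. \<alpha> i * y i t x))) \<partial>lborel \<partial>M) \<le>
     (\<integral>\<^sup>+x. ennreal (\<Sum>i\<in>?I. \<alpha> i * c0 i x) * (\<integral>\<^sup>+t. ennreal (\<Sum>i\<in>?I. \<delta> i * p i t x) \<partial>lborel) \<partial>M)"
    unfolding p_def y_def \<alpha>_def \<delta>_def M_def by (rule sol0(1))
  have y_fin: "(\<integral>\<^sup>+x. \<integral>\<^sup>+t. ennreal (y i t x powr (m + 1)) \<partial>lborel \<partial>M) < \<infinity>" if "i \<in> ?I" for i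
    unfolding y_def M_def by (rule sol0(2)[OF that])
  have y_mixed: "mixed (y i)" if "i \<in> ?I" for i
    unfolding y_def M_def by (rule sol0(3)[OF that])
  have y_eq: "y i t x = one T t * c i t x" if "i \<in> ?I" "x \<in> \<Omega>" for i t x
    unfolding y_def by (rule sol0(4)[OF that])
  have p_eq: "p i t x = y i t x powr m" for i t x
    unfolding p_def y_def by (rule sol0(5))
  have y0: "0 \<le> y i t x" for i t x by (simp add: y_def)
  have \<alpha>0: "0 \<le> \<alpha> i" for i by (simp add: \<alpha>_def)
  have \<delta>0: "0 \<le> \<delta> i" if "i \<in> ?I" for i using d[OF that] by (simp add: \<delta>_def)
  \<comment> \<open>With four components, this choice makes the factor of the terms to be absorbed equal to \<open>A / 2\<close>.\<close>
  define e where "e = A / (8 * B)"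
  have e0: "e > 0" using A0 B0 by (simp add: e_def)
  define K where "K = B * 4 * e powr (- m)"
  have K0: "K \<ge> 0" using B0 by (simp add: K_def)
  let ?S = "\<lambda>t x. \<Sum>i\<in>?I. y i t x powr (m + 1)" and ?Q = "\<lambda>x. \<Sum>i\<in>?I. \<bar>c0 i x\<bar> powr (m + 1)"
  have c0m [measurable]: "c0 i \<in> borel_measurable M" if "i \<in> ?I" for i using c0[OF that] by (simp add: in_Linf_def)
  have ym: "(\<lambda>q. y i (fst q) (snd q) powr (m + 1)) \<in> borel_measurable (lborel \<Otimes>\<^sub>M M)" if "i \<in> ?I" for i
  proof -
    have "(\<lambda>q. y i (fst q) (snd q)) \<in> borel_measurable (lborel \<Otimes>\<^sub>M M)"
      by (rule mixed_measurable_comp[OF y_mixed[OF that]]) auto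
    moreover have "(\<lambda>v::real. v powr (m + 1)) \<in> borel \<rightarrow>\<^sub>M borel" by measurable
    ultimately show ?thesis by (rule measurable_compose)
  qed
  have Sm: "(\<lambda>q. ?S (fst q) (snd q)) \<in> borel_measurable (lborel \<Otimes>\<^sub>M M)"
    by (intro borel_measurable_sum ym)
  have Sx: "(\<lambda>t. ennreal (?S t x)) \<in> borel_measurable lborel" if "x \<in> space M" for x
    using measurable_compose[OF measurable_compose[OF measurable_Pair2'[OF that] Sm] measurable_ennreal] by simp
  have SM: "(\<lambda>x. \<integral>\<^sup>+t. ennreal (?S t x) \<partial>lborel) \<in> borel_measurable M"
  proof -
    note [measurable] = Sm
    have [measurable]: "(\<lambda>(x, t). ?S t x) \<in> borel_measurable (M \<Otimes>\<^sub>M lborel)"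
      using measurable_compose[OF measurable_pair_swap' Sm] by (simp add: case_prod_unfold)
    show ?thesis by measurable
  qed
  define Y where "Y = (\<integral>\<^sup>+x. \<integral>\<^sup>+t. ennreal (?S t x) \<partial>lborel \<partial>M)"
  define V where "V = (\<integral>\<^sup>+x. ennreal (?Q x) \<partial>M)"
  have c0i: "integrable M (\<lambda>x. \<bar>c0 i x\<bar> powr (m + 1))" if i: "i \<in> ?I" for i
  proof -
    obtain R where R: "AE x in M. \<bar>c0 i x\<bar> \<le> R" using c0[OF i] by (auto simp: in_Linf_def)
    show ?thesis
    proof (rule integrable_const_bound[where B="R powr (m + 1)"])
      show "AE x in M. norm (\<bar>c0 i x\<bar> powr (m + 1)) \<le> R powr (m + 1)"
        using R by eventually_elim (use m in \<open>auto intro!: powr_mono2\<close>)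
      show "(\<lambda>x. \<bar>c0 i x\<bar> powr (m + 1)) \<in> borel_measurable M" using c0m[OF i] by measurable
    qed
  qed
  have V_eq: "V = ennreal (\<Sum>i\<in>?I. LINT x|M. \<bar>c0 i x\<bar> powr (m + 1))"
  proof -
    have "V = ennreal (LINT x|M. ?Q x)"
      unfolding V_def by (intro nn_integral_eq_integral Bochner_Integration.integrable_sum c0i) (auto intro!: AE_I2 sum_nonneg)
    also have "(LINT x|M. ?Q x) = (\<Sum>i\<in>?I. LINT x|M. \<bar>c0 i x\<bar> powr (m + 1))"
      by (rule Bochner_Integration.integral_sum) (rule c0i)
    finally show ?thesis .
  qed
  have cyl: "cyl_measure T N \<Omega> = restrict_space lborel {0<..<T} \<Otimes>\<^sub>M M" by (simp add: cyl_measure_def M_def)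
  have cm: "(\<lambda>(t, x). c i t x) \<in> borel_measurable (cyl_measure T N \<Omega>)" if i: "i \<in> ?I" for i
  proof -
    obtain G where "L2_W12_with_grad T N \<Omega> (\<lambda>t x. c i t x powr m) G"
      by (rule weak_solution_gradient[OF weak i])
    then have "(\<lambda>(t, x). c i t x powr m) \<in> borel_measurable (cyl_measure T N \<Omega>)"
      by (simp add: L2_W12_with_grad_def in_Lp_def)
    then have "(\<lambda>q. (case q of (t, x) \<Rightarrow> c i t x powr m) powr (1 / m)) \<in> borel_measurable (cyl_measure T N \<Omega>)"
      by measurable
    moreover have "(case q of (t, x) \<Rightarrow> c i t x powr m) powr (1 / m) = (case q of (t, x) \<Rightarrow> c i t x)"
      if "q \<in> space (cyl_measure T N \<Omega>)" for q
    proof -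
      have "fst q \<in> {0<..<T}" "snd q \<in> \<Omega>" using that sp
        by (auto simp: cyl space_pair_measure space_restrict_space)
      then show ?thesis using nonneg[OF i, of "fst q" "snd q"] m by (simp add: case_prod_unfold powr_powr)
    qed
    ultimately show ?thesis by (subst (asm) measurable_cong) auto
  qed
  have nn: "(\<integral>\<^sup>+q. ennreal (\<bar>case q of (t, x) \<Rightarrow> c i t x\<bar> powr (m + 1)) \<partial>cyl_measure T N \<Omega>) =
    (\<integral>\<^sup>+x. \<integral>\<^sup>+t. ennreal (y i t x powr (m + 1)) \<partial>lborel \<partial>M)" if i: "i \<in> ?I" for i
  proof -
    have "(\<lambda>v::real. ennreal (\<bar>v\<bar> powr (m + 1))) \<in> borel \<rightarrow>\<^sub>M borel" by measurable
    from measurable_compose[OF cm[OF i] this]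
    have "(\<integral>\<^sup>+q. ennreal (\<bar>case q of (t, x) \<Rightarrow> c i t x\<bar> powr (m + 1)) \<partial>cyl_measure T N \<Omega>) =
      (\<integral>\<^sup>+x. \<integral>\<^sup>+t. ennreal (\<bar>case (t, x) of (t, x) \<Rightarrow> c i t x\<bar> powr (m + 1)) * indicator {0<..<T} t \<partial>lborel \<partial>M)"
      unfolding cyl by (rule cyl_nn_integral)
    also have "\<dots> = (\<integral>\<^sup>+x. \<integral>\<^sup>+t. ennreal (y i t x powr (m + 1)) \<partial>lborel \<partial>M)"
    proof (intro nn_integral_cong)
      fix x t assume "x \<in> space M"
      then have "y i t x = one T t * c i t x" using y_eq[OF i, of x t] sp by simp
      then show "ennreal (\<bar>case (t, x) of (t, x) \<Rightarrow> c i t x\<bar> powr (m + 1)) * indicator {0<..<T} t = ennreal (y i t x powr (m + 1))"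
        using nonneg[OF i, of t x] \<open>x \<in> space M\<close> sp by (auto simp: one_def split: split_indicator)
    qed
    finally show ?thesis .
  qed
  have ci: "integrable (cyl_measure T N \<Omega>) (\<lambda>q. \<bar>case q of (t, x) \<Rightarrow> c i t x\<bar> powr (m + 1))" if i: "i \<in> ?I" for i
  proof (rule integrableI_bounded)
    have "(\<lambda>v::real. \<bar>v\<bar> powr (m + 1)) \<in> borel \<rightarrow>\<^sub>M borel" by measurable
    from measurable_compose[OF cm[OF i] this]
    show "(\<lambda>q. \<bar>case q of (t, x) \<Rightarrow> c i t x\<bar> powr (m + 1)) \<in> borel_measurable (cyl_measure T N \<Omega>)" .
    show "(\<integral>\<^sup>+q. ennreal (norm (\<bar>case q of (t, x) \<Rightarrow> c i t x\<bar> powr (m + 1))) \<partial>cyl_measure T N \<Omega>) < \<infinity>"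
      using nn[OF i] y_fin[OF i] by simp
  qed
  show "in_Lp (cyl_measure T N \<Omega>) (m + 1) (\<lambda>(t, x). c i t x)" if i: "i \<in> ?I" for i
    using cm[OF i] ci[OF i] by (simp add: in_Lp_def)
  have Y_eq: "Y = ennreal (\<Sum>i\<in>?I. LINT q|cyl_measure T N \<Omega>. \<bar>case q of (t, x) \<Rightarrow> c i t x\<bar> powr (m + 1))"
  proof -
    have "Y = (\<integral>\<^sup>+x. (\<Sum>i\<in>?I. \<integral>\<^sup>+t. ennreal (y i t x powr (m + 1)) \<partial>lborel) \<partial>M)"
      unfolding Y_def
    proof (rule nn_integral_cong)
      fix x assume x: "x \<in> space M"
      have "(\<integral>\<^sup>+t. ennreal (?S t x) \<partial>lborel) = (\<integral>\<^sup>+t. (\<Sum>i\<in>?I. ennreal (y i t x powr (m + 1))) \<partial>lborel)"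
        by (subst sum_ennreal) auto
      also have "\<dots> = (\<Sum>i\<in>?I. \<integral>\<^sup>+t. ennreal (y i t x powr (m + 1)) \<partial>lborel)"
        using measurable_compose[OF measurable_compose[OF measurable_Pair2'[OF x] ym] measurable_ennreal]
        by (intro nn_integral_sum) simp
      finally show "(\<integral>\<^sup>+t. ennreal (?S t x) \<partial>lborel) = (\<Sum>i\<in>?I. \<integral>\<^sup>+t. ennreal (y i t x powr (m + 1)) \<partial>lborel)" .
    qed
    also have "\<dots> = (\<Sum>i\<in>?I. \<integral>\<^sup>+x. \<integral>\<^sup>+t. ennreal (y i t x powr (m + 1)) \<partial>lborel \<partial>M)"
    proof (rule nn_integral_sum)
      fix i assume i: "i \<in> ?I"
      have [measurable]: "(\<lambda>(x, t). y i t x powr (m + 1)) \<in> borel_measurable (M \<Otimes>\<^sub>M lborel)"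
        using measurable_compose[OF measurable_pair_swap' ym[OF i]] by (simp add: case_prod_unfold)
      show "(\<lambda>x. \<integral>\<^sup>+t. ennreal (y i t x powr (m + 1)) \<partial>lborel) \<in> borel_measurable M" by measurable
    qed
    also have "\<dots> = (\<Sum>i\<in>?I. ennreal (LINT q|cyl_measure T N \<Omega>. \<bar>case q of (t, x) \<Rightarrow> c i t x\<bar> powr (m + 1)))"
      by (intro sum.cong refl) (simp only: nn[symmetric], rule nn_integral_eq_integral[OF ci], auto)
    finally show ?thesis by (subst (asm) sum_ennreal) (auto intro: integral_nonneg_AE)
  qed
  have lower: "ennreal A * Y \<le> (\<integral>\<^sup>+x. \<integral>\<^sup>+t. ennreal (one T t * ((\<Sum>i\<in>?I. \<delta> i * p i t x) * (\<Sum>i\<in>?I. \<alpha> i * y i t x))) \<partial>lborel \<partial>M)"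
  proof -
    have "ennreal A * Y = (\<integral>\<^sup>+x. \<integral>\<^sup>+t. ennreal A * ennreal (?S t x) \<partial>lborel \<partial>M)"
      unfolding Y_def using Sx by (subst nn_integral_cmult[symmetric, OF SM]) (auto intro!: nn_integral_cong nn_integral_cmult[symmetric])
    also have "\<dots> \<le> (\<integral>\<^sup>+x. \<integral>\<^sup>+t. ennreal (one T t * ((\<Sum>i\<in>?I. \<delta> i * p i t x) * (\<Sum>i\<in>?I. \<alpha> i * y i t x))) \<partial>lborel \<partial>M)"
    proof (intro nn_integral_mono)
      fix x t
      show "ennreal A * ennreal (?S t x) \<le> ennreal (one T t * ((\<Sum>i\<in>?I. \<delta> i * p i t x) * (\<Sum>i\<in>?I. \<alpha> i * y i t x)))"
      proof (cases "t \<in> {0<..<T}")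
        case True
        have "A * ?S t x \<le> (\<Sum>i\<in>?I. \<delta> i * p i t x) * (\<Sum>i\<in>?I. \<alpha> i * y i t x)"
          unfolding p_eq using A y0 \<alpha>0 \<delta>0 by (intro product_lower_bound) (auto simp: \<alpha>_def \<delta>_def)
        then show ?thesis using True A0
          by (subst ennreal_mult[symmetric]) (auto simp: one_def intro!: ennreal_leI sum_nonneg)
      next
        case False
        then have "y i t x = 0" for i by (simp add: y_def one_def)
        then show ?thesis by simp
      qed
    qed
    finally show ?thesis .
  qed
  have upper: "(\<integral>\<^sup>+x. ennreal (\<Sum>i\<in>?I. \<alpha> i * c0 i x) * (\<integral>\<^sup>+t. ennreal (\<Sum>i\<in>?I. \<delta> i * p i t x) \<partial>lborel) \<partial>M) \<le>
    ennreal (A / 2) * Y + ennreal (K * T) * V"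
  proof -
    have "AE x in M. \<forall>i\<in>?I. c0 i x \<ge> 0" by (rule AE_finite_allI) (use c00 in auto)
    then have pointwise: "AE x in M. ennreal (\<Sum>i\<in>?I. \<alpha> i * c0 i x) * (\<integral>\<^sup>+t. ennreal (\<Sum>i\<in>?I. \<delta> i * p i t x) \<partial>lborel) \<le>
      ennreal (A / 2) * (\<integral>\<^sup>+t. ennreal (?S t x) \<partial>lborel) + ennreal (K * T) * ennreal (?Q x)"
      using AE_space
    proof eventually_elim
      case (elim x)
      have zm: "(\<lambda>t. ennreal (\<Sum>i\<in>?I. \<delta> i * p i t x)) \<in> borel_measurable lborel"
      proof -
        have "(\<lambda>t. y i t x) \<in> borel_measurable lborel" if "i \<in> ?I" for i
          by (rule mixed_measurable_comp[OF y_mixed[OF that]]) (use elim in auto)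
        then have "(\<lambda>t. \<delta> i * p i t x) \<in> borel_measurable lborel" if "i \<in> ?I" for i
          using that unfolding p_eq by measurable
        then show ?thesis by (intro measurable_compose[OF _ measurable_ennreal] borel_measurable_sum) auto
      qed
      have "ennreal (\<Sum>i\<in>?I. \<alpha> i * c0 i x) * (\<integral>\<^sup>+t. ennreal (\<Sum>i\<in>?I. \<delta> i * p i t x) \<partial>lborel) =
        (\<integral>\<^sup>+t. ennreal (\<Sum>i\<in>?I. \<alpha> i * c0 i x) * ennreal (\<Sum>i\<in>?I. \<delta> i * p i t x) \<partial>lborel)"
        by (rule nn_integral_cmult[OF zm, symmetric])
      also have "\<dots> \<le> (\<integral>\<^sup>+t. ennreal (A / 2) * ennreal (?S t x) + ennreal (K * ?Q x) * indicator {0<..<T} t \<partial>lborel)"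
      proof (rule nn_integral_mono)
        fix t
        show "ennreal (\<Sum>i\<in>?I. \<alpha> i * c0 i x) * ennreal (\<Sum>i\<in>?I. \<delta> i * p i t x) \<le>
          ennreal (A / 2) * ennreal (?S t x) + ennreal (K * ?Q x) * indicator {0<..<T} t"
        proof (cases "t \<in> {0<..<T}")
          case True
          have "(\<Sum>i\<in>?I. \<alpha> i * \<bar>c0 i x\<bar>) * (\<Sum>i\<in>?I. \<delta> i * y i t x powr m) \<le>
            B * card ?I * e * ?S t x + B * card ?I * e powr (- m) * ?Q x"
            using B y0 \<alpha>0 \<delta>0 e0 m by (intro product_upper_bound) (auto simp: \<alpha>_def \<delta>_def)
          also have "B * card ?I * e = A / 2" using B0 by (simp add: e_def field_simps)
          also have "B * card ?I * e powr (- m) * ?Q x = K * ?Q x" by (simp add: K_def)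
          also have "(\<Sum>i\<in>?I. \<alpha> i * \<bar>c0 i x\<bar>) = (\<Sum>i\<in>?I. \<alpha> i * c0 i x)" using elim by (intro sum.cong) auto
          finally have le: "(\<Sum>i\<in>?I. \<alpha> i * c0 i x) * (\<Sum>i\<in>?I. \<delta> i * p i t x) \<le> A / 2 * ?S t x + K * ?Q x"
            unfolding p_eq .
          have "ennreal (\<Sum>i\<in>?I. \<alpha> i * c0 i x) * ennreal (\<Sum>i\<in>?I. \<delta> i * p i t x) = ennreal ((\<Sum>i\<in>?I. \<alpha> i * c0 i x) * (\<Sum>i\<in>?I. \<delta> i * p i t x))"
            using elim \<alpha>0 \<delta>0 by (intro ennreal_mult[symmetric] sum_nonneg) (auto simp: p_eq)
          also have "\<dots> \<le> ennreal (A / 2 * ?S t x + K * ?Q x)" by (rule ennreal_leI[OF le])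
          also have "\<dots> = ennreal (A / 2 * ?S t x) + ennreal (K * ?Q x)"
            using A0 K0 by (intro ennreal_plus mult_nonneg_nonneg sum_nonneg) auto
          also have "ennreal (A / 2 * ?S t x) = ennreal (A / 2) * ennreal (?S t x)"
            using A0 by (intro ennreal_mult sum_nonneg) auto
          finally show ?thesis using True by simp
        next
          case False
          then have "p i t x = 0" for i by (simp add: p_def one_def)
          then show ?thesis by simp
        qed
      qed
      also have "\<dots> = ennreal (A / 2) * (\<integral>\<^sup>+t. ennreal (?S t x) \<partial>lborel) + ennreal (K * ?Q x) * emeasure lborel {0<..<T}"
        using Sx[OF elim(2)] by (subst nn_integral_add) (auto simp: nn_integral_cmult nn_integral_cmult_indicator)
      also have "ennreal (K * ?Q x) * emeasure lborel {0<..<T} = ennreal (K * T) * ennreal (?Q x)"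
        using T K0 by (simp add: ennreal_mult[symmetric] sum_nonneg mult_ac)
      finally show ?case .
    qed
    have "(\<integral>\<^sup>+x. ennreal (\<Sum>i\<in>?I. \<alpha> i * c0 i x) * (\<integral>\<^sup>+t. ennreal (\<Sum>i\<in>?I. \<delta> i * p i t x) \<partial>lborel) \<partial>M) \<le>
      (\<integral>\<^sup>+x. ennreal (A / 2) * (\<integral>\<^sup>+t. ennreal (?S t x) \<partial>lborel) + ennreal (K * T) * ennreal (?Q x) \<partial>M)"
      by (rule nn_integral_mono_AE[OF pointwise])
    also have "\<dots> = ennreal (A / 2) * Y + ennreal (K * T) * V"
      unfolding Y_def V_def using SM by (subst nn_integral_add) (auto simp: nn_integral_cmult)
    finally show ?thesis .
  qed
  have "enn2real Y \<le> 2 * (K * T) / A * enn2real V"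
  proof (rule ennreal_absorb)
    show "ennreal A * Y \<le> ennreal (A / 2) * Y + ennreal (K * T) * V"
      using lower energy upper by (meson order_trans)
  qed (use A0 K0 T Y_eq V_eq in auto)
  then show "(\<Sum>i\<in>?I. LINT p|cyl_measure T N \<Omega>. \<bar>case p of (t, x) \<Rightarrow> c i t x\<bar> powr (m + 1)) \<le>
      2 * (B * 4 * (A / (8 * B)) powr (- m) * T) / A * (\<Sum>i\<in>?I. LINT x|M. \<bar>c0 i x\<bar> powr (m + 1))"
    unfolding Y_eq V_eq K_def e_def
    by (subst (asm) (1 2) enn2real_ennreal) (auto intro!: sum_nonneg integral_nonneg_AE)
qed

theorem theorem6p1:
  fixes m T L :: real and a :: "nat \<Rightarrow> nat" and d :: "nat \<Rightarrow> real"
  assumes "T > 0" and "m \<ge> 1"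
    and "\<And>i. i \<in> {1..4} \<Longrightarrow> a i \<ge> 1" and "\<And>i. i \<in> {1..4} \<Longrightarrow> d i > 0"
  shows "\<exists>C::real. \<forall>(N::nat) (\<Omega>::(nat \<Rightarrow> real) set) (k::real \<Rightarrow> real) (l::real \<Rightarrow> real)
           (h::nat \<Rightarrow> real \<Rightarrow> real) (\<nu>f::real) (\<nu>b::real)
           (c0::nat \<Rightarrow> (nat \<Rightarrow> real) \<Rightarrow> real) (c::nat \<Rightarrow> real \<Rightarrow> (nat \<Rightarrow> real) \<Rightarrow> real).
         N \<ge> 1 \<and> smooth_bounded_domain N \<Omega> \<and> PC k l \<and> (LBINT t:{0<..<T}. \<bar>l t\<bar>) = L \<and>
         (\<forall>n\<ge>1. is_h l n (h n)) \<and> \<nu>f > 0 \<and> \<nu>b > 0 \<and>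
         (\<forall>i\<in>{1..4}. in_Linf (dom_measure N \<Omega>) (c0 i) \<and> (AE x in dom_measure N \<Omega>. c0 i x \<ge> 0)) \<and>
         classical_solution T N \<Omega> k m a d \<nu>f \<nu>b c0 c \<and>
         weak_solution T N \<Omega> k h m a d \<nu>f \<nu>b c0 c \<and>
         (\<forall>i\<in>{1..4}. \<forall>t\<in>{0<..<T}. \<forall>x\<in>\<Omega>. c i t x \<ge> 0) \<longrightarrow>
         (\<forall>i\<in>{1..4}. in_Lp (cyl_measure T N \<Omega>) (m + 1) (\<lambda>(t, x). c i t x)) \<and>
         (\<Sum>i=1..4. Lp_norm (cyl_measure T N \<Omega>) (m + 1) (\<lambda>(t, x). c i t x)) \<le>
           C * (\<Sum>i=1..4. Lp_norm (dom_measure N \<Omega>) (m + 1) (c0 i))"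
proof -
  let ?I = "{1..4} :: nat set"
  define \<beta> where "\<beta> i j = (1 / real (a i) * d i) * (1 / real (a j))" for i j
  have \<beta>: "\<beta> i j > 0" if "i \<in> ?I" "j \<in> ?I" for i j
  proof -
    have "real (a i) > 0" "real (a j) > 0" using assms(3)[OF that(1)] assms(3)[OF that(2)] by auto
    then show ?thesis using assms(4)[OF that(1)] by (simp add: \<beta>_def)
  qed
  define A where "A = Min ((\<lambda>i. \<beta> i i) ` ?I)"
  define B where "B = (\<Sum>i\<in>?I. \<Sum>j\<in>?I. \<beta> i j)"
  have A: "A \<le> \<beta> i i" if "i \<in> ?I" for i unfolding A_def using that by (intro Min_le) auto
  have A0: "A > 0" unfolding A_def using \<beta> by (subst Min_gr_iff) auto
  have B: "\<beta> i j \<le> B" if "i \<in> ?I" "j \<in> ?I" for i j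
  proof -
    have "\<beta> i j \<le> (\<Sum>j\<in>?I. \<beta> i j)" using \<beta> that by (intro member_le_sum) (auto intro: less_imp_le)
    also have "\<dots> \<le> B" unfolding B_def using \<beta> that
      by (intro member_le_sum[of i ?I "\<lambda>i. \<Sum>j\<in>?I. \<beta> i j"]) (auto intro!: sum_nonneg simp: less_imp_le)
    finally show ?thesis .
  qed
  have B0: "B > 0" using \<beta>[of 1 1] B[of 1 1] by simp
  define K where "K = 2 * (B * 4 * (A / (8 * B)) powr (- m) * T) / A"
  have K0: "K \<ge> 0" unfolding K_def using A0 B0 \<open>T > 0\<close> by (intro divide_nonneg_pos mult_nonneg_nonneg) auto
  show ?thesis
  proof (intro exI[of _ "4 * (K * 4) powr (1 / (m + 1))"] allI impI, elim conjE, goal_cases)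
    case (1 N \<Omega> k l h \<nu>f \<nu>b c0 c)
    have h1: "is_h l 1 (h 1)" using 1(5) by blast
    have ad: "\<forall>i\<in>?I. a i \<ge> 1" "\<forall>i\<in>?I. d i > 0" using assms(3,4) by blast+
    note bd = a_priori_bound[OF A[unfolded \<beta>_def] A0 B[unfolded \<beta>_def] B0 assms(1,2) ad 1(2) 1(3) h1 1(8) 1(9) 1(10) 1(11)]
    let ?X = "\<lambda>i. LINT p|cyl_measure T N \<Omega>. \<bar>case p of (t, x) \<Rightarrow> c i t x\<bar> powr (m + 1)"
    let ?Y = "\<lambda>i. LINT x|dom_measure N \<Omega>. \<bar>c0 i x\<bar> powr (m + 1)"
    have "(\<Sum>i\<in>?I. ?X i powr (1 / (m + 1))) \<le> card ?I * (K * card ?I) powr (1 / (m + 1)) * (\<Sum>i\<in>?I. ?Y i powr (1 / (m + 1)))"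
      using bd(2) K0 \<open>m \<ge> 1\<close> unfolding K_def[symmetric]
      by (intro sum_powr_root_le) (auto intro: integral_nonneg_AE)
    then show ?case using bd(1) by (simp add: Lp_norm_def)
  qed
qed

end
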